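(* Let $P_n$ denote the path on $[n]$ and let $J(P_n)\subset S=K[x_1,\ldots,x_n]$ be its vertex cover ideal over a field $K$, where $n\ge 2$. Let $i$ be the projective dimension of $J(P_n)$ and $j$ the (Castelnuovo–Mumford) regularity of $J(P_n)$. Let $k\ge 1$ be an integer. Then: (i) if $n=3k$, then $i=k$, $j=2k$ and $\beta_{k,k+2k}(J(P_{3k}))=1$; (ii) if $n=3k-1$, then $i=k$, $j=2k-1$ and $\beta_{k,k+(2k-1)}(J(P_{3k-1}))=1$; (iii) if $n=3k+1$, then $i=k$, $j=2k$ and $\beta_{k,k+2k}(J(P_{3k+1}))=k+1$.
   Context: $P_n$ is the graph on the vertex set $[n]=\{1,\ldots,n\}$ with edge set $\{\{1,2\},\{2,3\},\ldots,\{n-1,n\}\}$. A vertex cover of a graph on $[n]$ is a set $W\subset[n]$ meeting every edge. The vertex cover ideal $J(G)$ of a graph $G$ on $[n]$ is the ideal of $S=K[x_1,\ldots,x_n]$ generated by the monomials $\prod_{a\in W}x_a$ with $W$ a minimal (under inclusion) vertex cover of $G$. Projective dimension, regularity and graded Betti numbers $\beta_{p,q}(J(G))=\dim_K\mathrm{Tor}^S_p(J(G),K)_q$ are those of the ideal $J(G)$ itself, regarded as a graded $S$-module with the standard grading (not of $S/J(G)$). *)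

theory Defs
  imports
    "HOL-Library.Poly_Mapping"
    "HOL-Library.Function_Algebras"
    "HOL-Library.Extended_Nat"
    "HOL-Algebra.Module"
    "HOL-Algebra.Ideal"
begin

section \<open>Resolutions and projective dimension over a commutative ring\<close>

text \<open>The fields \<open>mult\<close> and \<open>one\<close> of a module record play no role for modules.\<close>

definition free_module :: "('a, 'm) ring_scheme \<Rightarrow> nat \<Rightarrow> ('a, nat \<Rightarrow> 'a) module" where
  "free_module R r =
     \<lparr>carrier = {v. (\<forall>s<r. v s \<in> carrier R) \<and> (\<forall>s\<ge>r. v s = \<zero>\<^bsub>R\<^esub>)},
      mult = undefined, one = undefined,
      zero = (\<lambda>_. \<zero>\<^bsub>R\<^esub>),
      add = (\<lambda>v w s. v s \<oplus>\<^bsub>R\<^esub> w s),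
      smult = (\<lambda>a v s. a \<otimes>\<^bsub>R\<^esub> v s)\<rparr>"

definition unit_vector :: "('a, 'm) ring_scheme \<Rightarrow> nat \<Rightarrow> nat \<Rightarrow> 'a" where
  "unit_vector R s = (\<lambda>t. if t = s then \<one>\<^bsub>R\<^esub> else \<zero>\<^bsub>R\<^esub>)"

definition ideal_module :: "('a, 'm) ring_scheme \<Rightarrow> 'a set \<Rightarrow> ('a, 'a) module" where
  "ideal_module R I =
     \<lparr>carrier = I, mult = (\<otimes>\<^bsub>R\<^esub>), one = \<one>\<^bsub>R\<^esub>, zero = \<zero>\<^bsub>R\<^esub>, add = (\<oplus>\<^bsub>R\<^esub>), smult = (\<otimes>\<^bsub>R\<^esub>)\<rparr>"

definition module_hom ::
  "('a, 'm) ring_scheme \<Rightarrow> ('a, 'b, 'p) module_scheme \<Rightarrow> ('a, 'c, 'q) module_scheme \<Rightarrow> ('b \<Rightarrow> 'c) set" where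
  "module_hom R M N = {f. f \<in> carrier M \<rightarrow> carrier N \<and>
     (\<forall>x\<in>carrier M. \<forall>y\<in>carrier M. f (x \<oplus>\<^bsub>M\<^esub> y) = f x \<oplus>\<^bsub>N\<^esub> f y) \<and>
     (\<forall>a\<in>carrier R. \<forall>x\<in>carrier M. f (a \<odot>\<^bsub>M\<^esub> x) = a \<odot>\<^bsub>N\<^esub> f x)}"

text \<open>Finitely generated projective modules: direct summands (retracts) of some \<open>R\<^sup>r\<close>.\<close>

definition fg_projective :: "('a, 'm) ring_scheme \<Rightarrow> ('a, 'b, 'p) module_scheme \<Rightarrow> bool" where
  "fg_projective R M \<longleftrightarrow> module R M \<and>
     (\<exists>r. \<exists>\<iota>\<in>module_hom R M (free_module R r). \<exists>\<pi>\<in>module_hom R (free_module R r) M.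
        \<forall>x\<in>carrier M. \<pi> (\<iota> x) = x)"

text \<open>Exactness of \<open>\<dots> \<rightarrow> P 2 \<rightarrow> P 1 \<rightarrow> P 0 \<rightarrow> M \<rightarrow> 0\<close>, where \<open>\<delta> p : P (p + 1) \<rightarrow> P p\<close> and
  \<open>\<epsilon> : P 0 \<rightarrow> M\<close>.\<close>

definition resolution ::
  "('a, 'm) ring_scheme \<Rightarrow> ('a, 'c, 'q) module_scheme \<Rightarrow> (nat \<Rightarrow> ('a, 'b, 'p) module_scheme)
     \<Rightarrow> (nat \<Rightarrow> 'b \<Rightarrow> 'b) \<Rightarrow> ('b \<Rightarrow> 'c) \<Rightarrow> bool" where
  "resolution R M P \<delta> \<epsilon> \<longleftrightarrow>
     (\<forall>p. module R (P p)) \<and>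
     (\<forall>p. \<delta> p \<in> module_hom R (P (Suc p)) (P p)) \<and>
     \<epsilon> \<in> module_hom R (P 0) M \<and>
     \<epsilon> ` carrier (P 0) = carrier M \<and>
     \<delta> 0 ` carrier (P 1) = a_kernel (P 0) M \<epsilon> \<and>
     (\<forall>p. \<delta> (Suc p) ` carrier (P (Suc (Suc p))) = a_kernel (P (Suc p)) (P p) (\<delta> p))"

text \<open>Projective dimension of a finitely generated module over a Noetherian ring: the least length
  of a resolution by finitely generated projective modules (\<open>\<infinity>\<close> if there is none of finite
  length).  Every finitely generated projective module is isomorphic to one whose elements have type
  \<^typ>\<open>nat \<Rightarrow> 'a\<close>, so fixing this type for the resolving modules is no restriction.\<close>

definition proj_dim :: "('a, 'm) ring_scheme \<Rightarrow> ('a, 'c, 'q) module_scheme \<Rightarrow> enat" where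
  "proj_dim R M = Inf {enat d | d.
     \<exists>(P :: nat \<Rightarrow> ('a, nat \<Rightarrow> 'a) module) \<delta> \<epsilon>.
       resolution R M P \<delta> \<epsilon> \<and> (\<forall>p. fg_projective R (P p)) \<and> (\<forall>p>d. carrier (P p) = {\<zero>\<^bsub>P p\<^esub>})}"


section \<open>The standard graded polynomial ring $K[x_1,\ldots,x_n]$\<close>

text \<open>Polynomials are finitely supported maps from exponent vectors to coefficients.\<close>

type_synonym 'k mpoly = "(nat \<Rightarrow>\<^sub>0 nat) \<Rightarrow>\<^sub>0 'k"

definition mpoly_ring :: "nat \<Rightarrow> ('k::field) mpoly ring" where
  "mpoly_ring n =
     \<lparr>carrier = {f. \<forall>m\<in>Poly_Mapping.keys f. Poly_Mapping.keys m \<subseteq> {1..n}},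
      mult = (*), one = 1, zero = 0, add = (+)\<rparr>"

definition var :: "nat \<Rightarrow> ('k::field) mpoly" where
  "var a = Poly_Mapping.single (Poly_Mapping.single a 1) 1"

definition const_coeff :: "('k::field) mpoly \<Rightarrow> 'k" where
  "const_coeff f = Poly_Mapping.lookup f 0"

text \<open>The zero polynomial is homogeneous of every degree, and it is the only polynomial that is
  homogeneous of a negative degree.\<close>

definition homogeneous :: "int \<Rightarrow> ('k::field) mpoly \<Rightarrow> bool" where
  "homogeneous d f \<longleftrightarrow>
     (\<forall>m\<in>Poly_Mapping.keys f. int (\<Sum>a\<in>Poly_Mapping.keys m. Poly_Mapping.lookup m a) = d)"


section \<open>Graded Betti numbers and regularity of a homogeneous ideal\<close>

text \<open>A graded free resolution of the ideal \<open>I\<close> of \<open>S = K[x\<^sub>1,\<dots>,x\<^sub>n]\<close>: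
  the \<open>p\<close>-th module is \<open>F\<^sub>p = \<Oplus>\<^sub>s S(- dg p s)\<close> with \<open>s < r p\<close>, so its \<open>s\<close>-th basis element has
  degree \<open>dg p s\<close>, and the maps \<open>\<delta> p\<close> and \<open>\<epsilon>\<close> preserve degrees, which is required on bases.\<close>

definition graded_free_resolution ::
  "nat \<Rightarrow> ('k::field) mpoly set \<Rightarrow> (nat \<Rightarrow> nat) \<Rightarrow> (nat \<Rightarrow> nat \<Rightarrow> int)
     \<Rightarrow> (nat \<Rightarrow> (nat \<Rightarrow> 'k mpoly) \<Rightarrow> (nat \<Rightarrow> 'k mpoly)) \<Rightarrow> ((nat \<Rightarrow> 'k mpoly) \<Rightarrow> 'k mpoly) \<Rightarrow> bool" where
  "graded_free_resolution n I r dg \<delta> \<epsilon> \<longleftrightarrow>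
     resolution (mpoly_ring n) (ideal_module (mpoly_ring n) I)
       (\<lambda>p. free_module (mpoly_ring n) (r p)) \<delta> \<epsilon> \<and>
     (\<forall>p. \<forall>s<r (Suc p). \<forall>t<r p.
        homogeneous (dg (Suc p) s - dg p t) (\<delta> p (unit_vector (mpoly_ring n) s) t)) \<and>
     (\<forall>s<r 0. homogeneous (dg 0 s) (\<epsilon> (unit_vector (mpoly_ring n) s)))"

text \<open>Applying \<open>- \<otimes>\<^sub>S K\<close>, where \<open>K = S/(x\<^sub>1,\<dots>,x\<^sub>n)\<close>, turns \<open>F\<^sub>p\<close> into \<open>\<Oplus>\<^sub>s K(- dg p s)\<close> and
  replaces the entries of the matrix of \<open>\<delta> p\<close> by their constant coefficients.  The component of
  degree \<open>q\<close> is spanned by the basis elements of degree \<open>q\<close>.\<close>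

definition tensor_component ::
  "(nat \<Rightarrow> nat) \<Rightarrow> (nat \<Rightarrow> nat \<Rightarrow> int) \<Rightarrow> nat \<Rightarrow> int \<Rightarrow> (nat \<Rightarrow> 'k::field) set" where
  "tensor_component r dg p q = {c. \<forall>s. c s \<noteq> 0 \<longrightarrow> s < r p \<and> dg p s = q}"

definition tensor_diff ::
  "nat \<Rightarrow> (nat \<Rightarrow> nat) \<Rightarrow> (nat \<Rightarrow> (nat \<Rightarrow> 'k mpoly) \<Rightarrow> (nat \<Rightarrow> 'k mpoly))
     \<Rightarrow> nat \<Rightarrow> (nat \<Rightarrow> 'k::field) \<Rightarrow> (nat \<Rightarrow> 'k)" where
  "tensor_diff n r \<delta> p c =
     (\<lambda>t. \<Sum>s<r (Suc p). const_coeff (\<delta> p (unit_vector (mpoly_ring n) s) t) * c s)"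

definition tor_cycles ::
  "nat \<Rightarrow> (nat \<Rightarrow> nat) \<Rightarrow> (nat \<Rightarrow> nat \<Rightarrow> int) \<Rightarrow> (nat \<Rightarrow> (nat \<Rightarrow> 'k mpoly) \<Rightarrow> (nat \<Rightarrow> 'k mpoly))
     \<Rightarrow> nat \<Rightarrow> int \<Rightarrow> (nat \<Rightarrow> 'k::field) set" where
  "tor_cycles n r dg \<delta> p q =
     {c \<in> tensor_component r dg p q. \<forall>p'. p = Suc p' \<longrightarrow> tensor_diff n r \<delta> p' c = 0}"

definition tor_boundaries ::
  "nat \<Rightarrow> (nat \<Rightarrow> nat) \<Rightarrow> (nat \<Rightarrow> nat \<Rightarrow> int) \<Rightarrow> (nat \<Rightarrow> (nat \<Rightarrow> 'k mpoly) \<Rightarrow> (nat \<Rightarrow> 'k mpoly))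
     \<Rightarrow> nat \<Rightarrow> int \<Rightarrow> (nat \<Rightarrow> 'k::field) set" where
  "tor_boundaries n r dg \<delta> p q = tensor_diff n r \<delta> p ` tensor_component r dg (Suc p) q"

definition K_dim :: "(nat \<Rightarrow> 'k::field) set \<Rightarrow> nat" where
  "K_dim = vector_space.dim (\<lambda>a c s. a * c s)"

text \<open>\<open>\<beta>\<^sub>p\<^sub>,\<^sub>q(I)\<close>, the dimension of \<open>Tor\<^sub>p(I, K)\<^sub>q\<close> computed from a chosen graded free resolution of
  \<open>I\<close>.  The dimension of the quotient cycles/boundaries is the difference of two finite dimensions.\<close>

definition graded_betti :: "nat \<Rightarrow> ('k::field) mpoly set \<Rightarrow> nat \<Rightarrow> int \<Rightarrow> nat" where
  "graded_betti n I p q =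
     (case (SOME (r, dg, \<delta>, \<epsilon>). graded_free_resolution n I r dg \<delta> \<epsilon>) of
        (r, dg, \<delta>, \<epsilon>) \<Rightarrow> K_dim (tor_cycles n r dg \<delta> p q) - K_dim (tor_boundaries n r dg \<delta> p q))"

definition regularity :: "nat \<Rightarrow> ('k::field) mpoly set \<Rightarrow> int" where
  "regularity n I = Max {q - int p | p q. graded_betti n I p q \<noteq> 0}"


section \<open>Vertex cover ideals\<close>

definition vertex_cover :: "nat \<Rightarrow> nat set set \<Rightarrow> nat set \<Rightarrow> bool" where
  "vertex_cover n E W \<longleftrightarrow> W \<subseteq> {1..n} \<and> (\<forall>e\<in>E. W \<inter> e \<noteq> {})"

definition minimal_vertex_cover :: "nat \<Rightarrow> nat set set \<Rightarrow> nat set \<Rightarrow> bool" where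
  "minimal_vertex_cover n E W \<longleftrightarrow> vertex_cover n E W \<and> (\<forall>V. V \<subset> W \<longrightarrow> \<not> vertex_cover n E V)"

definition vertex_cover_ideal :: "nat \<Rightarrow> nat set set \<Rightarrow> ('k::field) mpoly set" where
  "vertex_cover_ideal n E =
     Idl\<^bsub>mpoly_ring n\<^esub> {\<Prod>a\<in>W. var a | W. minimal_vertex_cover n E W}"

definition path_edges :: "nat \<Rightarrow> nat set set" where
  "path_edges n = {{a, a + 1} | a. 1 \<le> a \<and> a + 1 \<le> n}"

end

theory Submission
  imports Defs
begin

text \<open>Write \<open>J\<^sub>m\<close> for the vertex cover ideal of \<open>P\<^sub>m\<close>.  A cover of \<open>P\<^sub>m\<close> contains \<open>m - 1\<close>, or else both \<open>m\<close>
  and \<open>m - 2\<close>, so \<open>J\<^sub>m = x\<^sub>m\<^sub>-\<^sub>1 J\<^sub>m\<^sub>-\<^sub>2 + x\<^sub>m x\<^sub>m\<^sub>-\<^sub>2 J\<^sub>m\<^sub>-\<^sub>3\<close>, and the two summands meet in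
  \<open>x\<^sub>m x\<^sub>m\<^sub>-\<^sub>1 x\<^sub>m\<^sub>-\<^sub>2 J\<^sub>m\<^sub>-\<^sub>3\<close>.  The resulting mapping cone is a minimal graded free resolution, because the
  comparison map \<open>J\<^sub>m\<^sub>-\<^sub>3 \<rightarrow> J\<^sub>m\<^sub>-\<^sub>2 \<oplus> J\<^sub>m\<^sub>-\<^sub>3\<close> is divisible by \<open>x\<^sub>m\<close> in the first component and by \<open>x\<^sub>m\<^sub>-\<^sub>1\<close> in
  the second.  Hence \<open>\<beta>\<^sub>p\<^sub>,\<^sub>q(J\<^sub>m) = \<beta>\<^sub>p\<^sub>,\<^sub>q\<^sub>-\<^sub>1(J\<^sub>m\<^sub>-\<^sub>2) + \<beta>\<^sub>p\<^sub>,\<^sub>q\<^sub>-\<^sub>2(J\<^sub>m\<^sub>-\<^sub>3) + \<beta>\<^sub>p\<^sub>-\<^sub>1\<^sub>,\<^sub>q\<^sub>-\<^sub>3(J\<^sub>m\<^sub>-\<^sub>3)\<close>, and the claims follow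
  by induction.  Chain maps and homotopies between resolutions show that a minimal resolution computes
  the graded Betti numbers of any other one and has the least possible length among all projective ones.\<close>

section \<open>Comparison of resolutions\<close>

text \<open>\<open>graded_betti\<close> is evaluated on a resolution picked by a choice operator, of
  which only exactness and homogeneity are known, so Betti numbers must be compared with an
  arbitrary graded free resolution. \<open>proj_dim\<close> ranges over projective resolutions
  without grading, so lifting is needed both with and without degrees. All \<open>J_m\<close> with m
  \<le> n have to live in one ring in n variables for the recursion to make sense; they are monomial
  ideals given by a condition on exponent vectors, and only the one with m = n is identified with
  the vertex cover ideal. The recursion starts from \<open>J_0\<close> = \<open>J_1\<close> = S; for
  m = 2 the missing \<open>x_0\<close> is read as 1, and m - 3 is 0 by truncated subtraction, which
  gives the correct ideal S. Nonzero Betti numbers satisfy p \<le> (n + 1) div 3 and q - p \<le> 2 n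
  div 3, and the theorem concerns the corner where both are equalities: non-vanishing there yields
  both invariants at once. The value k + 1 arises because each step from n = 3k + 1 to n + 3 adds
  the corner value 1 of the path on n + 1 vertices.\<close>

lemma module_hom_closed:
  "f \<in> module_hom R M N \<Longrightarrow> x \<in> carrier M \<Longrightarrow> f x \<in> carrier N"
  by (auto simp: module_hom_def)

lemma module_hom_add:
  "f \<in> module_hom R M N \<Longrightarrow> x \<in> carrier M \<Longrightarrow> y \<in> carrier M \<Longrightarrow> f (x \<oplus>\<^bsub>M\<^esub> y) = f x \<oplus>\<^bsub>N\<^esub> f y"
  by (auto simp: module_hom_def)

lemma module_hom_smult:
  "f \<in> module_hom R M N \<Longrightarrow> a \<in> carrier R \<Longrightarrow> x \<in> carrier M \<Longrightarrow> f (a \<odot>\<^bsub>M\<^esub> x) = a \<odot>\<^bsub>N\<^esub> f x"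
  by (auto simp: module_hom_def)

lemma module_hom_zero:
  assumes "module R M" "module R N" "f \<in> module_hom R M N"
  shows "f \<zero>\<^bsub>M\<^esub> = \<zero>\<^bsub>N\<^esub>"
proof -
  interpret M: module R M by fact
  interpret N: module R N by fact
  have "f (\<zero>\<^bsub>R\<^esub> \<odot>\<^bsub>M\<^esub> \<zero>\<^bsub>M\<^esub>) = \<zero>\<^bsub>R\<^esub> \<odot>\<^bsub>N\<^esub> f \<zero>\<^bsub>M\<^esub>"
    using assms(3) by (intro module_hom_smult) auto
  then show ?thesis
    using module_hom_closed[OF assms(3) M.M.zero_closed] by simp
qed

lemma (in abelian_group) minus_eqI:
  assumes "a \<in> carrier G" "b \<in> carrier G" "a \<oplus> b = c"
  shows "a = c \<ominus> b"
  using assms a_assoc[of a b "\<ominus> b"] by (auto simp: a_minus_def r_neg)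

lemma module_hom_minus:
  assumes "module R M" "module R N" "f \<in> module_hom R M N" "x \<in> carrier M" "y \<in> carrier M"
  shows "f (x \<ominus>\<^bsub>M\<^esub> y) = f x \<ominus>\<^bsub>N\<^esub> f y"
proof -
  interpret M: module R M by fact
  interpret N: module R N by fact
  have "f (x \<ominus>\<^bsub>M\<^esub> y) \<oplus>\<^bsub>N\<^esub> f y = f ((x \<ominus>\<^bsub>M\<^esub> y) \<oplus>\<^bsub>M\<^esub> y)"
    using assms by (simp add: module_hom_add M.M.minus_closed)
  also have "(x \<ominus>\<^bsub>M\<^esub> y) \<oplus>\<^bsub>M\<^esub> y = x"
    using assms by (simp add: a_minus_def M.M.a_assoc M.M.l_neg)
  finally show ?thesis
    using assms by (intro N.M.minus_eqI) (auto intro: module_hom_closed M.M.minus_closed)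
qed

lemma module_hom_comp:
  "f \<in> module_hom R M N \<Longrightarrow> g \<in> module_hom R N L \<Longrightarrow> (\<lambda>x. g (f x)) \<in> module_hom R M L"
  by (auto simp: module_hom_def Pi_iff)

lemma module_hom_id: "(\<lambda>x. x) \<in> module_hom R M M"
  by (auto simp: module_hom_def)

lemma module_hom_diff:
  assumes "module R M" "module R N" "f \<in> module_hom R M N" "g \<in> module_hom R M N"
  shows "(\<lambda>x. f x \<ominus>\<^bsub>N\<^esub> g x) \<in> module_hom R M N"
proof -
  interpret M: module R M by fact
  interpret N: module R N by fact
  note cl = module_hom_closed[OF assms(3)] module_hom_closed[OF assms(4)]
  show ?thesis unfolding module_hom_def
  proof (intro CollectI conjI ballI Pi_I)
    fix x y assume xy: "x \<in> carrier M" "y \<in> carrier M"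
    show "f (x \<oplus>\<^bsub>M\<^esub> y) \<ominus>\<^bsub>N\<^esub> g (x \<oplus>\<^bsub>M\<^esub> y) = f x \<ominus>\<^bsub>N\<^esub> g x \<oplus>\<^bsub>N\<^esub> (f y \<ominus>\<^bsub>N\<^esub> g y)"
      using xy cl assms by (simp add: module_hom_add a_minus_def N.M.minus_add N.M.a_ac)
  next
    fix a x assume "a \<in> carrier R" "x \<in> carrier M"
    then show "f (a \<odot>\<^bsub>M\<^esub> x) \<ominus>\<^bsub>N\<^esub> g (a \<odot>\<^bsub>M\<^esub> x) = a \<odot>\<^bsub>N\<^esub> (f x \<ominus>\<^bsub>N\<^esub> g x)"
      using cl assms
      by (simp add: module_hom_smult a_minus_def N.smult_r_distr N.smult_r_minus)
  qed (use cl in \<open>auto intro: N.M.minus_closed\<close>)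
qed

section \<open>Free modules of finite rank and lifting from projective modules\<close>

lemma free_module_carrier:
  "carrier (free_module R r) = {v. (\<forall>s<r. v s \<in> carrier R) \<and> (\<forall>s\<ge>r. v s = \<zero>\<^bsub>R\<^esub>)}"
  by (simp add: free_module_def)

lemma free_module_ops [simp]:
  "\<zero>\<^bsub>free_module R r\<^esub> = (\<lambda>_. \<zero>\<^bsub>R\<^esub>)"
  "v \<oplus>\<^bsub>free_module R r\<^esub> w = (\<lambda>s. v s \<oplus>\<^bsub>R\<^esub> w s)"
  "a \<odot>\<^bsub>free_module R r\<^esub> v = (\<lambda>s. a \<otimes>\<^bsub>R\<^esub> v s)"
  by (simp_all add: free_module_def)

lemma free_module_entry:
  assumes "cring R" "v \<in> carrier (free_module R r)"
  shows "v s \<in> carrier R"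
proof -
  interpret cring R by fact
  show ?thesis using assms(2) by (cases "s < r") (auto simp: free_module_carrier)
qed

lemma free_module_module:
  assumes "cring R"
  shows "module R (free_module R r)"
proof -
  interpret R: cring R by fact
  note en = free_module_entry[OF assms]
  have "abelian_group (free_module R r)"
  proof (rule abelian_groupI)
    fix x assume x: "x \<in> carrier (free_module R r)"
    then show "\<exists>y\<in>carrier (free_module R r). y \<oplus>\<^bsub>free_module R r\<^esub> x = \<zero>\<^bsub>free_module R r\<^esub>"
      using en[OF x] by (intro bexI[of _ "\<lambda>s. \<ominus>\<^bsub>R\<^esub> x s"]) (auto simp: free_module_carrier R.l_neg)
  qed (auto simp: en R.a_ac fun_eq_iff, auto simp: free_module_carrier)
  then show ?thesis
    by (intro moduleI assms)
      (auto simp: en R.l_distr R.r_distr R.m_assoc fun_eq_iff, auto simp: free_module_carrier)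
qed

lemma unit_vector_carrier:
  "cring R \<Longrightarrow> s < r \<Longrightarrow> unit_vector R s \<in> carrier (free_module R r)"
  by (auto simp: free_module_carrier unit_vector_def cring.cring_simprules)

text \<open>Induction over the truncations of \<open>v\<close> to its first j coordinates: each step
  adds one multiple of a unit vector, so additivity and linearity suffice and \<open>v\<close> need
  not be written as a finite sum in the module.\<close>

lemma free_module_hom_eqI:
  assumes R: "cring R" and M: "module R M"
    and f: "f \<in> module_hom R (free_module R r) M" and g: "g \<in> module_hom R (free_module R r) M"
    and eq: "\<And>s. s < r \<Longrightarrow> f (unit_vector R s) = g (unit_vector R s)"
    and v: "v \<in> carrier (free_module R r)"
  shows "f v = g v"
proof -
  interpret R: cring R by fact
  interpret M: module R M by fact
  interpret F: module R "free_module R r" by (rule free_module_module[OF R])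
  define tr where "tr j = (\<lambda>s. if s < j then v s else \<zero>\<^bsub>R\<^esub>)" for j
  have tr: "tr j \<in> carrier (free_module R r)" for j
    using v by (auto simp: free_module_carrier tr_def)
  have "f (tr j) = g (tr j)" if "j \<le> r" for j
    using that
  proof (induction j)
    case 0
    have "tr 0 = \<zero>\<^bsub>free_module R r\<^esub>" by (simp add: tr_def)
    then show ?case
      using module_hom_zero[OF F.module_axioms M f] module_hom_zero[OF F.module_axioms M g] by metis
  next
    case (Suc j)
    let ?w = "v j \<odot>\<^bsub>free_module R r\<^esub> unit_vector R j"
    have e: "tr (Suc j) = tr j \<oplus>\<^bsub>free_module R r\<^esub> ?w"
      using free_module_entry[OF R v] by (auto simp: fun_eq_iff tr_def unit_vector_def less_Suc_eq)
    have u: "unit_vector R j \<in> carrier (free_module R r)"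
      using Suc unit_vector_carrier[OF R, of j r] by simp
    have c: "v j \<in> carrier R" using free_module_entry[OF R v] .
    have w: "?w \<in> carrier (free_module R r)" using c u F.smult_closed by blast
    have "f (tr (Suc j)) = f (tr j) \<oplus>\<^bsub>M\<^esub> v j \<odot>\<^bsub>M\<^esub> f (unit_vector R j)"
      unfolding e module_hom_add[OF f tr w] module_hom_smult[OF f c u] ..
    also have "\<dots> = g (tr j) \<oplus>\<^bsub>M\<^esub> v j \<odot>\<^bsub>M\<^esub> g (unit_vector R j)"
      using Suc eq[of j] by simp
    also have "\<dots> = g (tr (Suc j))"
      unfolding e module_hom_add[OF g tr w] module_hom_smult[OF g c u] ..
    finally show ?case .
  qed
  moreover have "tr r = v" using v by (auto simp: tr_def free_module_carrier fun_eq_iff)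
  ultimately show ?thesis by force
qed

lemma free_module_universal:
  assumes R: "cring R" and M: "module R M" and a: "\<And>s. s < r \<Longrightarrow> a s \<in> carrier M"
  shows "\<exists>f\<in>module_hom R (free_module R r) M. \<forall>s<r. f (unit_vector R s) = a s"
proof -
  interpret R: cring R by fact
  interpret M: module R M by fact
  let ?f = "\<lambda>v. finsum M (\<lambda>s. v s \<odot>\<^bsub>M\<^esub> a s) {..<r}"
  have "?f \<in> module_hom R (free_module R r) M"
    unfolding module_hom_def
  proof (intro CollectI conjI ballI Pi_I)
    fix x y assume xy: "x \<in> carrier (free_module R r)" "y \<in> carrier (free_module R r)"
    note c = free_module_entry[OF R xy(1)] free_module_entry[OF R xy(2)]
    have "?f (x \<oplus>\<^bsub>free_module R r\<^esub> y) = finsum M (\<lambda>s. x s \<odot>\<^bsub>M\<^esub> a s \<oplus>\<^bsub>M\<^esub> y s \<odot>\<^bsub>M\<^esub> a s) {..<r}"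
      using c a by (intro M.M.finsum_cong') (auto simp: M.smult_l_distr)
    also have "\<dots> = ?f x \<oplus>\<^bsub>M\<^esub> ?f y"
      using c a by (intro M.M.finsum_addf) auto
    finally show "?f (x \<oplus>\<^bsub>free_module R r\<^esub> y) = ?f x \<oplus>\<^bsub>M\<^esub> ?f y" .
  next
    fix b x assume bx: "b \<in> carrier R" "x \<in> carrier (free_module R r)"
    note c = free_module_entry[OF R bx(2)]
    have "?f (b \<odot>\<^bsub>free_module R r\<^esub> x) = finsum M (\<lambda>s. b \<odot>\<^bsub>M\<^esub> (x s \<odot>\<^bsub>M\<^esub> a s)) {..<r}"
      using c a bx by (intro M.M.finsum_cong') (auto simp: M.smult_assoc1)
    also have "\<dots> = b \<odot>\<^bsub>M\<^esub> ?f x"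
      using c a bx by (intro M.finsum_smult_ldistr[symmetric]) auto
    finally show "?f (b \<odot>\<^bsub>free_module R r\<^esub> x) = b \<odot>\<^bsub>M\<^esub> ?f x" .
  qed (use a free_module_entry[OF R] in \<open>auto intro!: M.M.finsum_closed\<close>)
  moreover have "?f (unit_vector R s) = a s" if s: "s < r" for s
  proof -
    have "?f (unit_vector R s) = finsum M (\<lambda>t. if s = t then a t else \<zero>\<^bsub>M\<^esub>) {..<r}"
      using a by (intro M.M.finsum_cong') (auto simp: unit_vector_def)
    also have "\<dots> = a s" using s a by (intro M.M.finsum_singleton) auto
    finally show ?thesis .
  qed
  ultimately show ?thesis by (intro bexI[of _ ?f]) simp
qed

lemma fg_projective_free: "cring R \<Longrightarrow> fg_projective R (free_module R r)"
  unfolding fg_projective_def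
  by (intro conjI free_module_module exI[of _ r] bexI[of _ "\<lambda>x. x"] module_hom_id) auto

text \<open>\<open>P\<close> is a retract of a free module, on which a lift of \<phi> after \<pi> is
  determined by choosing preimages on the basis; composing it with \<iota> lifts \<phi>. The
  hypothesis compares images instead of asking that \<alpha> be onto, because \<alpha> will be a
  differential, whose image is only a kernel.\<close>

lemma fg_projective_lift:
  assumes R: "cring R" and P: "fg_projective R P" and A: "module R A" and B: "module R B"
    and \<phi>: "\<phi> \<in> module_hom R P B" and \<alpha>: "\<alpha> \<in> module_hom R A B"
    and im: "\<And>x. x \<in> carrier P \<Longrightarrow> \<phi> x \<in> \<alpha> ` carrier A"
  shows "\<exists>\<psi>\<in>module_hom R P A. \<forall>x\<in>carrier P. \<alpha> (\<psi> x) = \<phi> x"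
proof -
  obtain r \<iota> \<pi> where i: "\<iota> \<in> module_hom R P (free_module R r)"
    and p: "\<pi> \<in> module_hom R (free_module R r) P" and ip: "\<And>x. x \<in> carrier P \<Longrightarrow> \<pi> (\<iota> x) = x"
    using P unfolding fg_projective_def by (elim conjE exE bexE) auto
  have "\<exists>a. a \<in> carrier A \<and> \<alpha> a = \<phi> (\<pi> (unit_vector R s))" if "s < r" for s
    using im[OF module_hom_closed[OF p unit_vector_carrier[OF R that]]] by (auto simp: image_iff)
  then obtain a where a: "\<And>s. s < r \<Longrightarrow> a s \<in> carrier A"
    "\<And>s. s < r \<Longrightarrow> \<alpha> (a s) = \<phi> (\<pi> (unit_vector R s))" by metis
  have "\<exists>f\<in>module_hom R (free_module R r) A. \<forall>s<r. f (unit_vector R s) = a s"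
    using R A a(1) by (rule free_module_universal)
  then obtain f where f: "f \<in> module_hom R (free_module R r) A" "\<forall>s<r. f (unit_vector R s) = a s"
    by (elim bexE) auto
  have "\<alpha> (f v) = \<phi> (\<pi> v)" if "v \<in> carrier (free_module R r)" for v
    using free_module_hom_eqI[OF R B module_hom_comp[OF f(1) \<alpha>] module_hom_comp[OF p \<phi>] _ that]
      a f by simp
  then show ?thesis
    using module_hom_comp[OF i f(1)] module_hom_closed[OF i] ip
    by (intro bexI[of _ "\<lambda>x. f (\<iota> x)"]) simp_all
qed

section \<open>Exactness, chain maps and homotopies\<close>

text \<open>Treats the augmentation as the differential out of degree 0, so that exactness takes the
  same form in every degree.\<close>

definition kernel_at where
  "kernel_at M P \<delta> \<epsilon> p = (case p of 0 \<Rightarrow> a_kernel (P 0) M \<epsilon> | Suc q \<Rightarrow> a_kernel (P (Suc q)) (P q) (\<delta> q))"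

lemma resolution_exact:
  "resolution R M P \<delta> \<epsilon> \<Longrightarrow> \<delta> p ` carrier (P (Suc p)) = kernel_at M P \<delta> \<epsilon> p"
  by (cases p) (auto simp: resolution_def kernel_at_def)

lemma resolution_hom:
  assumes "resolution R M P \<delta> \<epsilon>"
  shows "module R (P p)" "\<delta> p \<in> module_hom R (P (Suc p)) (P p)" "\<epsilon> \<in> module_hom R (P 0) M"
  using assms by (auto simp: resolution_def)

lemma resolution_onto: "resolution R M P \<delta> \<epsilon> \<Longrightarrow> \<epsilon> ` carrier (P 0) = carrier M"
  by (auto simp: resolution_def)

lemma resolution_dd:
  assumes "resolution R M P \<delta> \<epsilon>" "x \<in> carrier (P (Suc (Suc p)))"
  shows "\<delta> p (\<delta> (Suc p) x) = \<zero>\<^bsub>P p\<^esub>"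
  using assms(2) resolution_exact[OF assms(1), of "Suc p"]
  by (auto simp: kernel_at_def a_kernel_def')

lemma resolution_aug:
  assumes "resolution R M P \<delta> \<epsilon>" "x \<in> carrier (P (Suc 0))"
  shows "\<epsilon> (\<delta> 0 x) = \<zero>\<^bsub>M\<^esub>"
  using assms(2) resolution_exact[OF assms(1), of 0]
  by (auto simp: kernel_at_def a_kernel_def')

text \<open>Below \<open>H p\<close> and \<open>H' p\<close> are the admissible maps: all module homomorphisms in the ungraded
  setting, the degree-preserving ones in the graded setting.\<close>

lemma chain_map_exists:
  assumes Q: "resolution R N Q \<delta>' \<epsilon>'"
    and d: "\<And>p x. x \<in> carrier (P (Suc p)) \<Longrightarrow> \<delta> p x \<in> carrier (P p)"
    and dd: "\<And>p x. x \<in> carrier (P (Suc (Suc p))) \<Longrightarrow> \<delta> p (\<delta> (Suc p) x) = \<zero>\<^bsub>P p\<^esub>"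
    and mod: "\<And>p. module R (P p)"
    and a: "\<And>x. x \<in> carrier (P (Suc 0)) \<Longrightarrow> a (\<delta> 0 x) = \<zero>\<^bsub>N\<^esub>"
    and H: "\<And>p. H p \<subseteq> module_hom R (P p) (Q p)"
    and L0: "\<exists>f\<in>H 0. \<forall>x\<in>carrier (P 0). \<epsilon>' (f x) = a x"
    and LS: "\<And>p f. f \<in> H p \<Longrightarrow> (\<And>x. x \<in> carrier (P (Suc p)) \<Longrightarrow> f (\<delta> p x) \<in> \<delta>' p ` carrier (Q (Suc p)))
      \<Longrightarrow> \<exists>g\<in>H (Suc p). \<forall>x\<in>carrier (P (Suc p)). \<delta>' p (g x) = f (\<delta> p x)"
  shows "\<exists>f. (\<forall>p. f p \<in> H p) \<and> (\<forall>x\<in>carrier (P 0). \<epsilon>' (f 0 x) = a x) \<and>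
    (\<forall>p. \<forall>x\<in>carrier (P (Suc p)). \<delta>' p (f (Suc p) x) = f p (\<delta> p x))"
proof -
  \<comment> \<open>The last clause of the invariant keeps the recursion going: after
    \<open>\<delta> p\<close> the map lands in the image of \<open>\<delta>' p\<close>, hence can be
    lifted. It holds because \<open>P\<close> is a complex and \<open>Q\<close> is exact.\<close>
  let ?I = "\<lambda>p f. f \<in> H p \<and> (p = 0 \<longrightarrow> (\<forall>x\<in>carrier (P 0). \<epsilon>' (f x) = a x)) \<and>
    (\<forall>x\<in>carrier (P (Suc p)). f (\<delta> p x) \<in> \<delta>' p ` carrier (Q (Suc p)))"
  let ?S = "\<lambda>p f g. \<forall>x\<in>carrier (P (Suc p)). \<delta>' p (g x) = f (\<delta> p x)"
  have base: "\<exists>f. ?I 0 f"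
  proof -
    obtain f where f: "f \<in> H 0" "\<forall>x\<in>carrier (P 0). \<epsilon>' (f x) = a x" using L0 by (elim bexE) auto
    have "f (\<delta> 0 x) \<in> \<delta>' 0 ` carrier (Q (Suc 0))" if x: "x \<in> carrier (P (Suc 0))" for x
      unfolding resolution_exact[OF Q] kernel_at_def a_kernel_def'
      using bspec[OF f(2) d[OF x]] a[OF x] module_hom_closed[OF subsetD[OF H f(1)] d[OF x]] by simp
    with f show ?thesis by auto
  qed
  have step: "\<exists>g. ?I (Suc p) g \<and> ?S p f g"
    if "?I p f" for p f
  proof -
    have f: "f \<in> H p" "\<And>x. x \<in> carrier (P (Suc p)) \<Longrightarrow> f (\<delta> p x) \<in> \<delta>' p ` carrier (Q (Suc p))"
      using that by auto
    have "\<exists>g\<in>H (Suc p). \<forall>x\<in>carrier (P (Suc p)). \<delta>' p (g x) = f (\<delta> p x)"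
      using f by (rule LS)
    then obtain g where g: "g \<in> H (Suc p)" "\<forall>x\<in>carrier (P (Suc p)). \<delta>' p (g x) = f (\<delta> p x)"
      by (elim bexE) auto
    have "g (\<delta> (Suc p) x) \<in> \<delta>' (Suc p) ` carrier (Q (Suc (Suc p)))"
      if x: "x \<in> carrier (P (Suc (Suc p)))" for x
    proof -
      have "f \<zero>\<^bsub>P p\<^esub> = \<zero>\<^bsub>Q p\<^esub>"
        by (rule module_hom_zero[OF mod resolution_hom(1)[OF Q] subsetD[OF H f(1)]])
      then show ?thesis
        unfolding resolution_exact[OF Q] kernel_at_def a_kernel_def'
        using bspec[OF g(2) d[OF x]] dd[OF x] module_hom_closed[OF subsetD[OF H g(1)] d[OF x]] by simp
    qed
    with g show ?thesis by auto
  qed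
  from base step have "\<exists>f. \<forall>p. ?I p (f p) \<and> ?S p (f p) (f (Suc p))"
    by (rule dependent_nat_choice[where P = ?I and Q = ?S])
  then obtain f where f: "\<forall>p. ?I p (f p) \<and> ?S p (f p) (f (Suc p))" by (elim exE) (rule that)
  show ?thesis by (rule exI[of _ f]) (use f in simp)
qed

text \<open>A chain map \<open>u\<close> over the zero map is null-homotopic. The invariant
  \<delta>' h \<delta> = u \<delta> says that u - h \<delta> in the next degree has values in the
  kernel of \<delta>', which is an image by exactness. \<open>L\<close> is the lifting property, and
  \<open>C\<close> keeps u - h \<delta> among the admissible maps.\<close>

lemma chain_homotopy_exists:
  assumes Q: "resolution R N Q \<delta>' \<epsilon>'"
    and \<delta>: "\<And>p. \<delta> p \<in> module_hom R (P (Suc p)) (P p)"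
    and dd: "\<And>p x. x \<in> carrier (P (Suc (Suc p))) \<Longrightarrow> \<delta> p (\<delta> (Suc p) x) = \<zero>\<^bsub>P p\<^esub>"
    and mod: "\<And>p. module R (P p)"
    and u: "\<And>p. u p \<in> H p" "\<And>x. x \<in> carrier (P 0) \<Longrightarrow> \<epsilon>' (u 0 x) = \<zero>\<^bsub>N\<^esub>"
      "\<And>p x. x \<in> carrier (P (Suc p)) \<Longrightarrow> \<delta>' p (u (Suc p) x) = u p (\<delta> p x)"
    and H: "\<And>p. H p \<subseteq> module_hom R (P p) (Q p)"
    and H': "\<And>p. H' p \<subseteq> module_hom R (P p) (Q (Suc p))"
    and L: "\<And>p w. w \<in> H p \<Longrightarrow> (\<And>x. x \<in> carrier (P p) \<Longrightarrow> w x \<in> \<delta>' p ` carrier (Q (Suc p)))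
      \<Longrightarrow> \<exists>h\<in>H' p. \<forall>x\<in>carrier (P p). \<delta>' p (h x) = w x"
    and C: "\<And>p w h. w \<in> H (Suc p) \<Longrightarrow> h \<in> H' p \<Longrightarrow> (\<lambda>x. w x \<ominus>\<^bsub>Q (Suc p)\<^esub> h (\<delta> p x)) \<in> H (Suc p)"
  shows "\<exists>h. (\<forall>p. h p \<in> H' p) \<and> (\<forall>x\<in>carrier (P 0). \<delta>' 0 (h 0 x) = u 0 x) \<and>
    (\<forall>p. \<forall>x\<in>carrier (P (Suc p)). \<delta>' (Suc p) (h (Suc p) x) = u (Suc p) x \<ominus>\<^bsub>Q (Suc p)\<^esub> h p (\<delta> p x))"
proof -
  let ?J = "\<lambda>p h. h \<in> H' p \<and> (p = 0 \<longrightarrow> (\<forall>x\<in>carrier (P 0). \<delta>' 0 (h x) = u 0 x)) \<and>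
    (\<forall>x\<in>carrier (P (Suc p)). \<delta>' p (h (\<delta> p x)) = u p (\<delta> p x))"
  let ?K = "\<lambda>p h g. \<forall>x\<in>carrier (P (Suc p)). \<delta>' (Suc p) (g x) = u (Suc p) x \<ominus>\<^bsub>Q (Suc p)\<^esub> h (\<delta> p x)"
  note Qm = resolution_hom(1)[OF Q] note Qd = resolution_hom(2)[OF Q]
  have uh: "u p \<in> module_hom R (P p) (Q p)" for p by (rule subsetD[OF H u(1)])
  have base: "\<exists>h. ?J 0 h"
  proof -
    have "u 0 x \<in> \<delta>' 0 ` carrier (Q (Suc 0))" if "x \<in> carrier (P 0)" for x
      unfolding resolution_exact[OF Q] kernel_at_def a_kernel_def'
      using u(2)[OF that] module_hom_closed[OF uh that] by simp
    with u(1) have "\<exists>h\<in>H' 0. \<forall>x\<in>carrier (P 0). \<delta>' 0 (h x) = u 0 x" by (rule L)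
    then obtain h where "h \<in> H' 0" "\<forall>x\<in>carrier (P 0). \<delta>' 0 (h x) = u 0 x"
      by (elim bexE) auto
    then show ?thesis using module_hom_closed[OF \<delta>, of _ 0] by auto
  qed
  have step: "\<exists>g. ?J (Suc p) g \<and> ?K p h g" if J: "?J p h" for p h
  proof -
    interpret Qp: module R "Q p" by (rule Qm)
    interpret Qs: module R "Q (Suc p)" by (rule Qm)
    interpret Pp: module R "P p" by (rule mod)
    have hH: "h \<in> H' p" using J by simp
    have h: "h \<in> module_hom R (P p) (Q (Suc p))" by (rule subsetD[OF H' hH])
    let ?w = "\<lambda>x. u (Suc p) x \<ominus>\<^bsub>Q (Suc p)\<^esub> h (\<delta> p x)"
    have "?w x \<in> \<delta>' (Suc p) ` carrier (Q (Suc (Suc p)))" if x: "x \<in> carrier (P (Suc p))" for x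
    proof -
      have c: "u (Suc p) x \<in> carrier (Q (Suc p))" "h (\<delta> p x) \<in> carrier (Q (Suc p))"
        using module_hom_closed[OF uh x] module_hom_closed[OF h module_hom_closed[OF \<delta> x]] .
      have "\<delta>' p (?w x) = u p (\<delta> p x) \<ominus>\<^bsub>Q p\<^esub> u p (\<delta> p x)"
        using module_hom_minus[OF Qm Qm Qd c] u(3)[OF x] J x by simp
      also have "\<dots> = \<zero>\<^bsub>Q p\<^esub>"
        using module_hom_closed[OF uh module_hom_closed[OF \<delta> x]] by (simp add: a_minus_def Qp.M.r_neg)
      finally show ?thesis
        unfolding resolution_exact[OF Q] kernel_at_def a_kernel_def'
        using c by (simp add: Qs.M.minus_closed)
    qed
    with C[OF u(1) hH] have "\<exists>g\<in>H' (Suc p). ?K p h g" by (rule L)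
    then obtain g where g: "g \<in> H' (Suc p)" "?K p h g" by (elim bexE) auto
    \<comment> \<open>Composing with one more differential removes the term h \<delta> \<delta>,
      which re-establishes the invariant one degree higher.\<close>
    have "\<delta>' (Suc p) (g (\<delta> (Suc p) x)) = u (Suc p) (\<delta> (Suc p) x)"
      if x: "x \<in> carrier (P (Suc (Suc p)))" for x
    proof -
      have dx: "\<delta> (Suc p) x \<in> carrier (P (Suc p))" using module_hom_closed[OF \<delta> x] .
      then show ?thesis
        using g dd[OF x] module_hom_zero[OF mod Qm h] module_hom_closed[OF uh dx]
        by (simp add: a_minus_def)
    qed
    with g show ?thesis by auto
  qed
  from base step have "\<exists>h. \<forall>p. ?J p (h p) \<and> ?K p (h p) (h (Suc p))"
    by (rule dependent_nat_choice[where P = ?J and Q = ?K])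
  then obtain h where h: "\<forall>p. ?J p (h p) \<and> ?K p (h p) (h (Suc p))" by (elim exE) (rule that)
  show ?thesis by (rule exI[of _ h]) (use h in simp)
qed

text \<open>A self-map covering the identity of \<open>M\<close> differs from the identity by a
  chain map over zero, to which the null-homotopy applies.\<close>

lemma self_homotopy_exists:
  assumes P: "resolution R M P \<delta> \<epsilon>" and M: "module R M"
    and t: "\<And>p. t p \<in> H p" "\<And>x. x \<in> carrier (P 0) \<Longrightarrow> \<epsilon> (t 0 x) = \<epsilon> x"
      "\<And>p x. x \<in> carrier (P (Suc p)) \<Longrightarrow> \<delta> p (t (Suc p) x) = t p (\<delta> p x)"
    and H: "\<And>p. H p \<subseteq> module_hom R (P p) (P p)"
    and H': "\<And>p. H' p \<subseteq> module_hom R (P p) (P (Suc p))"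
    and id: "\<And>p. (\<lambda>x. x) \<in> H p"
    and D: "\<And>p v w. v \<in> H p \<Longrightarrow> w \<in> H p \<Longrightarrow> (\<lambda>x. v x \<ominus>\<^bsub>P p\<^esub> w x) \<in> H p"
    and C: "\<And>p h. h \<in> H' p \<Longrightarrow> (\<lambda>x. h (\<delta> p x)) \<in> H (Suc p)"
    and L: "\<And>p w. w \<in> H p \<Longrightarrow> (\<And>x. x \<in> carrier (P p) \<Longrightarrow> w x \<in> \<delta> p ` carrier (P (Suc p)))
      \<Longrightarrow> \<exists>h\<in>H' p. \<forall>x\<in>carrier (P p). \<delta> p (h x) = w x"
  shows "\<exists>h. (\<forall>p. h p \<in> H' p) \<and> (\<forall>x\<in>carrier (P 0). \<delta> 0 (h 0 x) = t 0 x \<ominus>\<^bsub>P 0\<^esub> x) \<and>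
    (\<forall>p. \<forall>x\<in>carrier (P (Suc p)).
      \<delta> (Suc p) (h (Suc p) x) = t (Suc p) x \<ominus>\<^bsub>P (Suc p)\<^esub> x \<ominus>\<^bsub>P (Suc p)\<^esub> h p (\<delta> p x))"
proof (rule chain_homotopy_exists[where H = H and u = "\<lambda>p x. t p x \<ominus>\<^bsub>P p\<^esub> x"])
  note hom = resolution_hom[OF P]
  have th: "t p \<in> module_hom R (P p) (P p)" for p by (rule subsetD[OF H t(1)])
  show "resolution R M P \<delta> \<epsilon>" by fact
  show "\<delta> p \<in> module_hom R (P (Suc p)) (P p)" "module R (P p)" for p by (rule hom)+
  show "\<delta> p (\<delta> (Suc p) x) = \<zero>\<^bsub>P p\<^esub>" if "x \<in> carrier (P (Suc (Suc p)))" for p x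
    by (rule resolution_dd[OF P that])
  show "(\<lambda>x. t p x \<ominus>\<^bsub>P p\<^esub> x) \<in> H p" for p by (rule D[OF t(1) id])
  show "\<epsilon> (t 0 x \<ominus>\<^bsub>P 0\<^esub> x) = \<zero>\<^bsub>M\<^esub>" if x: "x \<in> carrier (P 0)" for x
  proof -
    interpret M: module R M by fact
    show ?thesis
      using module_hom_minus[OF hom(1) M hom(3) module_hom_closed[OF th x] x] t(2)[OF x]
        module_hom_closed[OF hom(3) x] by (simp add: a_minus_def M.M.r_neg)
  qed
  show "\<delta> p (t (Suc p) x \<ominus>\<^bsub>P (Suc p)\<^esub> x) = t p (\<delta> p x) \<ominus>\<^bsub>P p\<^esub> \<delta> p x"
    if x: "x \<in> carrier (P (Suc p))" for p x
    using module_hom_minus[OF hom(1) hom(1) hom(2) module_hom_closed[OF th x] x] t(3)[OF x] by simp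
  show "H p \<subseteq> module_hom R (P p) (P p)" "H' p \<subseteq> module_hom R (P p) (P (Suc p))" for p
    by (rule H H')+
  show "\<exists>h\<in>H' p. \<forall>x\<in>carrier (P p). \<delta> p (h x) = w x"
    if "w \<in> H p" "\<And>x. x \<in> carrier (P p) \<Longrightarrow> w x \<in> \<delta> p ` carrier (P (Suc p))" for p w
    using that by (rule L)
  show "(\<lambda>x. w x \<ominus>\<^bsub>P (Suc p)\<^esub> h (\<delta> p x)) \<in> H (Suc p)" if "w \<in> H (Suc p)" "h \<in> H' p" for p w h
    using D[OF that(1) C[OF that(2)]] .
qed

section \<open>Free modules over the polynomial ring\<close>

lemma mpoly_ring_carrier:
  "carrier (mpoly_ring n) = {f. \<forall>m\<in>Poly_Mapping.keys f. Poly_Mapping.keys m \<subseteq> {1..n}}"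
  by (simp add: mpoly_ring_def)

lemma mpoly_ring_ops [simp]:
  "mult (mpoly_ring n) = (*)" "one (mpoly_ring n) = 1" "zero (mpoly_ring n) = 0" "add (mpoly_ring n) = (+)"
  by (simp_all add: mpoly_ring_def)

lemma ideal_module_simps [simp]:
  "carrier (ideal_module (mpoly_ring n) I) = I" "zero (ideal_module (mpoly_ring n) I) = 0"
  "add (ideal_module (mpoly_ring n) I) = (+)" "smult (ideal_module (mpoly_ring n) I) = (*)"
  by (simp_all add: ideal_module_def)

lemma mpoly_carrier_zero [simp]: "0 \<in> carrier (mpoly_ring n)"
  by (simp add: mpoly_ring_carrier)

lemma mpoly_carrier_one [simp]: "1 \<in> carrier (mpoly_ring n)"
  by (simp add: mpoly_ring_carrier)

lemma mpoly_carrier_add: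
  assumes "f \<in> carrier (mpoly_ring n)" "g \<in> carrier (mpoly_ring n)"
  shows "f + g \<in> carrier (mpoly_ring n)"
  using assms Poly_Mapping.keys_add[of f g] by (force simp: mpoly_ring_carrier)

lemma keys_uminus: "Poly_Mapping.keys (- f :: 'a \<Rightarrow>\<^sub>0 'b::ab_group_add) = Poly_Mapping.keys f"
  by (auto simp: in_keys_iff)

lemma mpoly_carrier_uminus:
  "(f :: 'k::field mpoly) \<in> carrier (mpoly_ring n) \<Longrightarrow> - f \<in> carrier (mpoly_ring n)"
  by (simp add: mpoly_ring_carrier keys_uminus)

lemma mpoly_carrier_diff:
  "(f :: 'k::field mpoly) \<in> carrier (mpoly_ring n) \<Longrightarrow> g \<in> carrier (mpoly_ring n) \<Longrightarrow> f - g \<in> carrier (mpoly_ring n)"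
  using mpoly_carrier_add[of f n "- g"] mpoly_carrier_uminus[of g n] by simp

lemma mpoly_carrier_mult:
  assumes "f \<in> carrier (mpoly_ring n)" "g \<in> carrier (mpoly_ring n)"
  shows "f * g \<in> carrier (mpoly_ring n)"
proof -
  have "Poly_Mapping.keys m \<subseteq> {1..n}" if "m \<in> Poly_Mapping.keys (f * g)" for m
  proof -
    obtain a b where ab: "m = a + b" "a \<in> Poly_Mapping.keys f" "b \<in> Poly_Mapping.keys g"
      using \<open>m \<in> _\<close> keys_mult[of f g] by blast
    show ?thesis using ab assms Poly_Mapping.keys_add[of a b] by (force simp: mpoly_ring_carrier)
  qed
  then show ?thesis by (simp add: mpoly_ring_carrier)
qed

lemma mpoly_carrier_sum:
  "(\<And>s. s \<in> A \<Longrightarrow> f s \<in> carrier (mpoly_ring n)) \<Longrightarrow> sum f A \<in> carrier (mpoly_ring n)"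
  by (induction A rule: infinite_finite_induct) (auto intro: mpoly_carrier_add)

lemma mpoly_carrier_single:
  "Poly_Mapping.keys m \<subseteq> {1..n} \<Longrightarrow> Poly_Mapping.single m c \<in> carrier (mpoly_ring n)"
  by (simp add: mpoly_ring_carrier)

lemma cring_mpoly_ring: "cring (mpoly_ring n :: ('k::field) mpoly ring)"
proof (rule cringI)
  show "abelian_group (mpoly_ring n :: 'k mpoly ring)"
  proof (rule abelian_groupI)
    fix x :: "'k mpoly" assume "x \<in> carrier (mpoly_ring n)"
    then show "\<exists>y\<in>carrier (mpoly_ring n). y \<oplus>\<^bsub>mpoly_ring n\<^esub> x = \<zero>\<^bsub>mpoly_ring n\<^esub>"
      by (intro bexI[of _ "- x"]) (auto intro: mpoly_carrier_uminus)
  qed (auto simp: algebra_simps mpoly_carrier_add)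
  show "Group.comm_monoid (mpoly_ring n :: 'k mpoly ring)"
    by (rule comm_monoidI) (auto simp: algebra_simps mpoly_carrier_mult)
qed (simp add: algebra_simps)

abbreviation "free_mod n r \<equiv> free_module (mpoly_ring n) r"
abbreviation "unit_vec n s \<equiv> unit_vector (mpoly_ring n) s"

lemmas free_mod_module = free_module_module[OF cring_mpoly_ring]
lemmas free_mod_entry = free_module_entry[OF cring_mpoly_ring]
lemmas unit_vec_carrier = unit_vector_carrier[OF cring_mpoly_ring]
lemmas fg_projective_free_mod = fg_projective_free[OF cring_mpoly_ring]

lemma free_modI:
  "(\<And>s. v s \<in> carrier (mpoly_ring n)) \<Longrightarrow> (\<And>s. s \<ge> r \<Longrightarrow> v s = 0) \<Longrightarrow> v \<in> carrier (free_mod n r)"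
  by (simp add: free_module_carrier)

lemma free_mod_outside: "v \<in> carrier (free_mod n r) \<Longrightarrow> s \<ge> r \<Longrightarrow> v s = 0"
  by (simp add: free_module_carrier)

lemma free_mod_zero [simp]: "(\<lambda>_. 0) \<in> carrier (free_mod n r)"
  by (simp add: free_module_carrier)

lemma free_mod_add:
  "v \<in> carrier (free_mod n r) \<Longrightarrow> w \<in> carrier (free_mod n r) \<Longrightarrow> (\<lambda>s. v s + w s) \<in> carrier (free_mod n r)"
  by (simp add: free_module_carrier mpoly_carrier_add)

lemma free_mod_diff:
  "(v :: nat \<Rightarrow> 'k::field mpoly) \<in> carrier (free_mod n r) \<Longrightarrow> w \<in> carrier (free_mod n r)
    \<Longrightarrow> (\<lambda>s. v s - w s) \<in> carrier (free_mod n r)"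
  by (simp add: free_module_carrier mpoly_carrier_diff)

lemma free_mod_smult:
  "a \<in> carrier (mpoly_ring n) \<Longrightarrow> v \<in> carrier (free_mod n r) \<Longrightarrow> (\<lambda>s. a * v s) \<in> carrier (free_mod n r)"
  by (simp add: free_module_carrier mpoly_carrier_mult)

text \<open>Subtraction in a module record goes through the abstract additive inverse; this turns it
  into pointwise subtraction of polynomials.\<close>

lemma free_mod_minus:
  assumes "(v :: nat \<Rightarrow> 'k::field mpoly) \<in> carrier (free_mod n r)" "w \<in> carrier (free_mod n r)"
  shows "v \<ominus>\<^bsub>free_mod n r\<^esub> w = (\<lambda>s. v s - w s)"
proof -
  interpret F: module "mpoly_ring n" "free_mod n r :: ('k mpoly, nat \<Rightarrow> 'k mpoly) module"
    by (rule free_mod_module)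
  show ?thesis
    using F.M.minus_eqI[OF free_mod_diff[OF assms] assms(2), of v] by simp
qed

lemma ideal_module_module:
  assumes "ideal I (mpoly_ring n)"
  shows "module (mpoly_ring n) (ideal_module (mpoly_ring n) (I :: 'k::field mpoly set))"
proof -
  interpret I: ideal I "mpoly_ring n" by fact
  have add: "f + g \<in> I" if "f \<in> I" "g \<in> I" for f g
    using additive_subgroup.a_closed[OF ideal.axioms(1)[OF assms] that] by simp
  have mult: "f * g \<in> I" if "g \<in> I" "f \<in> carrier (mpoly_ring n)" for f g
    using I.I_l_closed[OF that] by simp
  have um: "- f \<in> I" if "f \<in> I" for f
    using mult[OF that, of "- 1"] by (simp add: mpoly_carrier_uminus)
  have "0 \<in> I" using additive_subgroup.zero_closed[OF ideal.axioms(1)[OF assms]] by simp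
  then have "abelian_group (ideal_module (mpoly_ring n) I)"
    using um by (intro abelian_groupI) (auto simp: add algebra_simps intro: bexI[of _ "- _"])
  then show ?thesis
    by (intro moduleI cring_mpoly_ring) (auto simp: mult algebra_simps)
qed

text \<open>The matrix form of a functional. \<open>I\<close> is only a subset here, so both sides
  are compared as homomorphisms into the whole ring, where they agree on the basis.\<close>

lemma hom_ideal_expand:
  assumes f: "f \<in> module_hom (mpoly_ring n) (free_mod n r) (ideal_module (mpoly_ring n) I)"
    and I: "I \<subseteq> carrier (mpoly_ring n)" and v: "v \<in> carrier (free_mod n r)"
  shows "f v = (\<Sum>s<r. v s * f (unit_vec n s :: nat \<Rightarrow> 'k::field mpoly))"
proof -
  let ?C = "carrier (mpoly_ring n) :: 'k mpoly set"
  let ?g = "\<lambda>v. \<Sum>s<r. v s * f (unit_vec n s)"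
  have M: "module (mpoly_ring n) (ideal_module (mpoly_ring n) ?C)"
    using ideal_module_module ring.oneideal[OF cring.axioms(1)[OF cring_mpoly_ring]] by blast
  have f': "f \<in> module_hom (mpoly_ring n) (free_mod n r) (ideal_module (mpoly_ring n) ?C)"
    using f I by (auto simp: module_hom_def Pi_iff)
  have fu: "f (unit_vec n s) \<in> ?C" if "s < r" for s
    using module_hom_closed[OF f' unit_vec_carrier[OF that]] by simp
  have g: "?g \<in> module_hom (mpoly_ring n) (free_mod n r) (ideal_module (mpoly_ring n) ?C)"
    unfolding module_hom_def
    by (auto simp: sum.distrib sum_distrib_left algebra_simps fu free_mod_entry
        intro!: mpoly_carrier_sum mpoly_carrier_mult)
  show ?thesis
  proof (rule free_module_hom_eqI[OF cring_mpoly_ring M f' g _ v])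
    fix s assume "s < r"
    have "?g (unit_vec n s) = (\<Sum>t<r. if t = s then f (unit_vec n s) else 0)"
      by (intro sum.cong) (auto simp: unit_vector_def)
    then show "f (unit_vec n s) = ?g (unit_vec n s)" using \<open>s < r\<close> by simp
  qed
qed

text \<open>Reduces maps between free modules to functionals, so that facts about augmentations
  apply to differentials one coordinate at a time.\<close>

lemma hom_coordinate:
  assumes "f \<in> module_hom (mpoly_ring n) (free_mod n r) (free_mod n r')"
  shows "(\<lambda>v. f v t) \<in> module_hom (mpoly_ring n) (free_mod n r)
           (ideal_module (mpoly_ring n) (carrier (mpoly_ring n)))"
  using module_hom_closed[OF assms] module_hom_add[OF assms] module_hom_smult[OF assms]
  by (auto simp: module_hom_def intro: free_mod_entry[of _ n r'])

lemma hom_free_expand: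
  assumes f: "f \<in> module_hom (mpoly_ring n) (free_mod n r) (free_mod n r')"
    and v: "v \<in> carrier (free_mod n r)"
  shows "f v t = (\<Sum>s<r. v s * f (unit_vec n s :: nat \<Rightarrow> 'k::field mpoly) t)"
  using hom_ideal_expand[OF hom_coordinate[OF f] _ v] by simp

section \<open>Homogeneous polynomials and graded maps\<close>

definition mdeg :: "(nat \<Rightarrow>\<^sub>0 nat) \<Rightarrow> int" where
  "mdeg m = int (\<Sum>a\<in>Poly_Mapping.keys m. Poly_Mapping.lookup m a)"

lemma homogeneous_iff: "homogeneous d f \<longleftrightarrow> (\<forall>m\<in>Poly_Mapping.keys f. mdeg m = d)"
  by (simp add: homogeneous_def mdeg_def)

lemma mdeg_add: "mdeg (l + m) = mdeg l + mdeg m"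
  using setsum_keys_plus_distrib[of "\<lambda>_ x. x" l m] by (simp only: mdeg_def of_nat_add[symmetric])

lemma mdeg_zero [simp]: "mdeg 0 = 0"
  by (simp add: mdeg_def)

lemma mdeg_single [simp]: "mdeg (Poly_Mapping.single a c) = int c"
  by (simp add: mdeg_def)

lemma homogeneous_zero [simp]: "homogeneous d 0"
  by (simp add: homogeneous_iff)

lemma homogeneous_one [simp]: "homogeneous 0 1"
  by (simp add: homogeneous_iff)

lemma homogeneous_single: "mdeg m = d \<Longrightarrow> homogeneous d (Poly_Mapping.single m c)"
  by (simp add: homogeneous_iff)

lemma homogeneous_var [simp]: "homogeneous 1 (var a)"
  unfolding var_def by (rule homogeneous_single) simp

lemma homogeneous_add: "homogeneous d f \<Longrightarrow> homogeneous d g \<Longrightarrow> homogeneous d (f + g)"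
  using Poly_Mapping.keys_add[of f g] by (force simp: homogeneous_iff)

lemma homogeneous_uminus: "homogeneous d f \<Longrightarrow> homogeneous d (- f)"
  by (simp add: homogeneous_iff keys_uminus)

lemma homogeneous_diff: "homogeneous d f \<Longrightarrow> homogeneous d g \<Longrightarrow> homogeneous d (f - g)"
  using homogeneous_add[of d f "- g"] homogeneous_uminus[of d g] by simp

lemma homogeneous_mult:
  assumes "homogeneous d f" "homogeneous e g" "c = d + e"
  shows "homogeneous c (f * g)"
  unfolding homogeneous_iff
proof
  fix m assume "m \<in> Poly_Mapping.keys (f * g)"
  then obtain a b where "m = a + b" "a \<in> Poly_Mapping.keys f" "b \<in> Poly_Mapping.keys g"
    using keys_mult[of f g] by blast
  then show "mdeg m = c" using assms by (simp add: homogeneous_iff mdeg_add)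
qed

lemma poly_mapping_decompose:
  "f = (\<Sum>m\<in>Poly_Mapping.keys f. Poly_Mapping.single m (Poly_Mapping.lookup f m))"
proof (rule poly_mapping_eqI)
  fix k
  have "(\<Sum>m\<in>Poly_Mapping.keys f. Poly_Mapping.lookup (Poly_Mapping.single m (Poly_Mapping.lookup f m)) k)
    = (\<Sum>m\<in>Poly_Mapping.keys f. if m = k then Poly_Mapping.lookup f k else 0)"
    by (intro sum.cong) (auto simp: lookup_single when_def)
  also have "\<dots> = Poly_Mapping.lookup f k" by (simp add: in_keys_iff)
  finally show "Poly_Mapping.lookup f k =
    Poly_Mapping.lookup (\<Sum>m\<in>Poly_Mapping.keys f. Poly_Mapping.single m (Poly_Mapping.lookup f m)) k"
    by (simp add: lookup_sum)
qed

lemma lookup_single_mult: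
  fixes g :: "'k::field mpoly"
  shows "Poly_Mapping.lookup (Poly_Mapping.single k a * g) (k + m) = a * Poly_Mapping.lookup g m"
proof -
  have "Poly_Mapping.single k a * g =
    (\<Sum>l\<in>Poly_Mapping.keys g. Poly_Mapping.single (k + l) (a * Poly_Mapping.lookup g l))"
    by (subst (1) poly_mapping_decompose[of g]) (simp add: sum_distrib_left mult_single)
  then have "Poly_Mapping.lookup (Poly_Mapping.single k a * g) (k + m) =
    (\<Sum>l\<in>Poly_Mapping.keys g. if l = m then a * Poly_Mapping.lookup g m else 0)"
    by (simp only: lookup_sum) (intro sum.cong, auto simp: lookup_single when_def)
  then show ?thesis by (simp add: in_keys_iff)
qed

lemma const_coeff_simps [simp]:
  "const_coeff 0 = 0" "const_coeff 1 = 1" "const_coeff (var a) = 0"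
  "const_coeff (Poly_Mapping.single 0 c) = c"
proof -
  have "Poly_Mapping.single a (1 :: nat) \<noteq> 0"
    using keys_single[of a "1 :: nat"] by (metis insert_not_empty keys_zero one_neq_zero)
  then show "const_coeff (var a) = 0" by (simp add: const_coeff_def var_def lookup_single when_def)
qed (auto simp: const_coeff_def lookup_one)

lemma const_coeff_add: "const_coeff (f + g) = const_coeff f + const_coeff g"
  by (simp add: const_coeff_def lookup_add)

lemma const_coeff_diff: "const_coeff (f - g) = const_coeff f - const_coeff g"
  by (simp add: const_coeff_def lookup_minus)

lemma const_coeff_sum: "const_coeff (sum f A) = (\<Sum>s\<in>A. const_coeff (f s))"
  by (simp add: const_coeff_def lookup_sum)

text \<open>Split off the constant term of \<open>f\<close>. A product of monomials is 1 only if
  both are, so the remaining part of \<open>f\<close> contributes nothing in exponent 0. Evaluation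
  at the origin is thus multiplicative, which is what tensoring with K relies on.\<close>

lemma const_coeff_mult: "const_coeff (f * g) = const_coeff f * const_coeff g"
proof -
  let ?h = "f - Poly_Mapping.single 0 (const_coeff f)"
  have "0 \<notin> Poly_Mapping.keys ?h"
    by (simp add: in_keys_iff lookup_minus const_coeff_def)
  moreover have "a + b = 0 \<Longrightarrow> a = 0" for a b :: "nat \<Rightarrow>\<^sub>0 nat"
    by (auto simp: poly_mapping_eq_iff lookup_add fun_eq_iff)
  ultimately have "0 \<notin> Poly_Mapping.keys (?h * g)"
    using keys_mult[of ?h g] by fastforce
  moreover have "f * g = Poly_Mapping.single 0 (const_coeff f) * g + ?h * g"
    by (simp add: algebra_simps)
  ultimately show ?thesis
    using lookup_single_mult[of 0 "const_coeff f" g 0]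
    by (simp add: const_coeff_def lookup_add in_keys_iff)
qed

lemma homogeneous_const_coeff: "homogeneous d f \<Longrightarrow> const_coeff f \<noteq> 0 \<Longrightarrow> d = 0"
  by (force simp: homogeneous_iff const_coeff_def in_keys_iff)

section \<open>Homogeneous components and degree-preserving maps\<close>

text \<open>The homogeneous component of degree d, not a composition of maps. Passing to it makes an
  arbitrary preimage homogeneous.\<close>

definition hom_comp :: "int \<Rightarrow> 'k::field mpoly \<Rightarrow> 'k mpoly" where
  "hom_comp d f = Poly_Mapping.mapp (\<lambda>m c. if mdeg m = d then c else 0) f"

lemma lookup_hom_comp:
  "Poly_Mapping.lookup (hom_comp d f) m = (if mdeg m = d then Poly_Mapping.lookup f m else 0)"
  by (auto simp: hom_comp_def lookup_mapp in_keys_iff when_def)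

lemma homogeneous_hom_comp: "homogeneous d (hom_comp d f)"
  by (auto simp: homogeneous_iff in_keys_iff lookup_hom_comp split: if_splits)

lemma hom_comp_carrier: "f \<in> carrier (mpoly_ring n) \<Longrightarrow> hom_comp d f \<in> carrier (mpoly_ring n)"
  by (auto simp: mpoly_ring_carrier in_keys_iff lookup_hom_comp split: if_splits)

lemma hom_comp_add: "hom_comp d (f + g) = hom_comp d f + hom_comp d g"
  by (intro poly_mapping_eqI) (simp add: lookup_hom_comp lookup_add)

lemma hom_comp_zero [simp]: "hom_comp d 0 = 0"
  by (intro poly_mapping_eqI) (simp add: lookup_hom_comp)

lemma hom_comp_sum: "hom_comp d (sum f A) = (\<Sum>s\<in>A. hom_comp d (f s))"
  by (induction A rule: infinite_finite_induct) (auto simp: hom_comp_add)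

lemma hom_comp_homogeneous: "homogeneous d f \<Longrightarrow> hom_comp d f = f"
  by (intro poly_mapping_eqI) (auto simp: lookup_hom_comp homogeneous_iff in_keys_iff)

text \<open>What remains of \<open>f\<close> without its component of degree d - e has no monomial
  of that degree, so multiplying it by \<open>h\<close> produces nothing in degree d.\<close>

lemma hom_comp_mult:
  assumes h: "homogeneous e h"
  shows "hom_comp d (f * h) = hom_comp (d - e) f * h"
proof -
  let ?g = "f - hom_comp (d - e) f"
  have "mdeg m \<noteq> d" if "m \<in> Poly_Mapping.keys (?g * h)" for m
  proof -
    obtain a b where ab: "m = a + b" "a \<in> Poly_Mapping.keys ?g" "b \<in> Poly_Mapping.keys h"
      using \<open>m \<in> _\<close> keys_mult[of ?g h] by blast
    have "mdeg a \<noteq> d - e" using ab(2) by (auto simp: in_keys_iff lookup_minus lookup_hom_comp)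
    moreover have "mdeg b = e" using ab(3) h by (simp add: homogeneous_iff)
    ultimately show ?thesis by (simp add: ab(1) mdeg_add)
  qed
  then have "hom_comp d (?g * h) = 0"
    by (intro poly_mapping_eqI) (auto simp: lookup_hom_comp in_keys_iff)
  moreover have "f * h = hom_comp (d - e) f * h + ?g * h" by (simp add: algebra_simps)
  moreover have "hom_comp d (hom_comp (d - e) f * h) = hom_comp (d - e) f * h"
    by (intro hom_comp_homogeneous homogeneous_mult[OF homogeneous_hom_comp h]) simp
  ultimately show ?thesis by (simp add: hom_comp_add)
qed

text \<open>\<open>hom_vec r dg d v\<close>: the vector \<open>v\<close> is homogeneous of degree \<open>d\<close> in \<open>\<Oplus>\<^sub>s S(- dg s)\<close>.\<close>

definition hom_vec :: "nat \<Rightarrow> (nat \<Rightarrow> int) \<Rightarrow> int \<Rightarrow> (nat \<Rightarrow> 'k::field mpoly) \<Rightarrow> bool" where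
  "hom_vec r dg d v \<longleftrightarrow> (\<forall>t<r. homogeneous (d - dg t) (v t))"

definition vec_comp :: "nat \<Rightarrow> (nat \<Rightarrow> int) \<Rightarrow> int \<Rightarrow> (nat \<Rightarrow> 'k::field mpoly) \<Rightarrow> nat \<Rightarrow> 'k mpoly" where
  "vec_comp r dg d v = (\<lambda>t. if t < r then hom_comp (d - dg t) (v t) else 0)"

definition graded_hom ::
  "nat \<Rightarrow> nat \<Rightarrow> (nat \<Rightarrow> int) \<Rightarrow> nat \<Rightarrow> (nat \<Rightarrow> int) \<Rightarrow> ((nat \<Rightarrow> 'k::field mpoly) \<Rightarrow> nat \<Rightarrow> 'k mpoly) set" where
  "graded_hom n r dg r' dg' = {f \<in> module_hom (mpoly_ring n) (free_mod n r) (free_mod n r').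
     \<forall>s<r. hom_vec r' dg' (dg s) (f (unit_vec n s))}"

lemma graded_homD: "f \<in> graded_hom n r dg r' dg' \<Longrightarrow> f \<in> module_hom (mpoly_ring n) (free_mod n r) (free_mod n r')"
  by (simp add: graded_hom_def)

lemma hom_vec_comp: "hom_vec r dg d (vec_comp r dg d v)"
  by (simp add: hom_vec_def vec_comp_def homogeneous_hom_comp)

lemma vec_comp_carrier: "v \<in> carrier (free_mod n r) \<Longrightarrow> vec_comp r dg d v \<in> carrier (free_mod n r)"
  by (auto simp: free_module_carrier vec_comp_def intro: hom_comp_carrier)

lemma vec_comp_hom_vec: "v \<in> carrier (free_mod n r) \<Longrightarrow> hom_vec r dg d v \<Longrightarrow> vec_comp r dg d v = v"
  by (auto simp: free_module_carrier vec_comp_def hom_vec_def fun_eq_iff hom_comp_homogeneous)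

lemma hom_vec_unit: "s < r \<Longrightarrow> hom_vec r dg (dg s) (unit_vec n s)"
  by (auto simp: hom_vec_def unit_vector_def)

text \<open>The parameter \<open>e\<close> covers two uses: it is 0 for an augmentation, and
  \<open>dg' t\<close> for the t-th coordinate of a graded map.\<close>

lemma graded_functional_comp:
  assumes f: "f \<in> module_hom (mpoly_ring n) (free_mod n r) (ideal_module (mpoly_ring n) I)"
    and I: "I \<subseteq> carrier (mpoly_ring n)" and v: "v \<in> carrier (free_mod n r)"
    and hom: "\<And>s. s < r \<Longrightarrow> homogeneous (dg s - e) (f (unit_vec n s))"
  shows "f (vec_comp r dg d v) = hom_comp (d - e) (f v)"
proof -
  have "hom_comp (d - e) (f v) = (\<Sum>s<r. hom_comp (d - e) (v s * f (unit_vec n s)))"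
    by (simp add: hom_ideal_expand[OF f I v] hom_comp_sum)
  also have "\<dots> = (\<Sum>s<r. vec_comp r dg d v s * f (unit_vec n s))"
    by (intro sum.cong) (simp_all add: hom_comp_mult[OF hom] vec_comp_def)
  finally show ?thesis
    by (simp add: hom_ideal_expand[OF f I vec_comp_carrier[OF v]])
qed

lemma graded_hom_comp:
  assumes f: "f \<in> graded_hom n r dg r' dg'" and v: "v \<in> carrier (free_mod n r)"
  shows "f (vec_comp r dg d v) = vec_comp r' dg' d (f v)"
proof
  fix t
  note h = graded_homD[OF f]
  show "f (vec_comp r dg d v) t = vec_comp r' dg' d (f v) t"
  proof (cases "t < r'")
    case True
    then have "homogeneous (dg s - dg' t) (f (unit_vec n s) t)" if "s < r" for s
      using that f by (auto simp: graded_hom_def hom_vec_def)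
    then show ?thesis
      using graded_functional_comp[OF hom_coordinate[OF h] _ v] True by (simp add: vec_comp_def)
  next
    case False
    then show ?thesis
      using free_mod_outside[OF module_hom_closed[OF h vec_comp_carrier[OF v]]] by (simp add: vec_comp_def)
  qed
qed

lemma graded_hom_vec:
  assumes f: "f \<in> graded_hom n r dg r' dg'" and v: "v \<in> carrier (free_mod n r)" "hom_vec r dg d v"
  shows "hom_vec r' dg' d (f v)"
  using graded_hom_comp[OF f v(1), of d] hom_vec_comp[of r' dg' d "f v"]
  by (simp add: vec_comp_hom_vec[OF v])

lemma graded_hom_compose:
  assumes "f \<in> graded_hom n r dg r' dg'" "g \<in> graded_hom n r' dg' r'' dg''"
  shows "(\<lambda>x. g (f x)) \<in> graded_hom n r dg r'' dg''"
  using module_hom_comp[OF graded_homD[OF assms(1)] graded_homD[OF assms(2)]]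
    graded_hom_vec[OF assms(2) module_hom_closed[OF graded_homD[OF assms(1)] unit_vec_carrier]] assms(1)
  by (auto simp: graded_hom_def)

lemma graded_hom_id: "(\<lambda>x. x) \<in> graded_hom n r dg r dg"
  by (auto simp: graded_hom_def module_hom_id hom_vec_unit)

lemma graded_hom_diff:
  assumes "f \<in> graded_hom n r dg r' dg'" "g \<in> graded_hom n r dg r' dg'"
  shows "(\<lambda>x. f x \<ominus>\<^bsub>free_mod n r'\<^esub> g x) \<in> graded_hom n r dg r' dg'"
proof -
  note h = assms[THEN graded_homD]
  have "hom_vec r' dg' (dg s) (f (unit_vec n s) \<ominus>\<^bsub>free_mod n r'\<^esub> g (unit_vec n s))" if "s < r" for s
    using assms that
    by (simp add: free_mod_minus module_hom_closed[OF h(1)] module_hom_closed[OF h(2)] unit_vec_carrier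
        graded_hom_def hom_vec_def homogeneous_diff)
  then show ?thesis
    using module_hom_diff[OF free_mod_module free_mod_module h] by (simp add: graded_hom_def)
qed

lemma graded_hom_universal:
  assumes "\<And>s. s < r \<Longrightarrow> a s \<in> carrier (free_mod n r')" "\<And>s. s < r \<Longrightarrow> hom_vec r' dg' (dg s) (a s)"
  shows "\<exists>f\<in>graded_hom n r dg r' dg'. \<forall>s<r. f (unit_vec n s) = a s"
proof -
  have "\<exists>f\<in>module_hom (mpoly_ring n) (free_mod n r) (free_mod n r'). \<forall>s<r. f (unit_vec n s) = a s"
    by (rule free_module_universal[OF cring_mpoly_ring free_mod_module assms(1)])
  then obtain f where f: "f \<in> module_hom (mpoly_ring n) (free_mod n r) (free_mod n r')"
    "\<forall>s<r. f (unit_vec n s) = a s" by (elim bexE) (rule that)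
  then show ?thesis using assms(2) by (intro bexI[of _ f]) (auto simp: graded_hom_def)
qed

text \<open>Choose preimages of the images of the basis vectors and replace each by its component of
  the required degree. It is still a preimage because \<alpha> commutes with taking
  components.\<close>

lemma graded_hom_lift:
  assumes w: "w \<in> graded_hom n r dg r'' dg''" and \<alpha>: "\<alpha> \<in> graded_hom n r' dg' r'' dg''"
    and im: "\<And>x. x \<in> carrier (free_mod n r) \<Longrightarrow> w x \<in> \<alpha> ` carrier (free_mod n r')"
  shows "\<exists>\<psi>\<in>graded_hom n r dg r' dg'. \<forall>x\<in>carrier (free_mod n r). \<alpha> (\<psi> x) = w x"
proof -
  have "\<exists>a. a \<in> carrier (free_mod n r') \<and> hom_vec r' dg' (dg s) a \<and> \<alpha> a = w (unit_vec n s)"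
    if s: "s < r" for s
  proof -
    obtain b where b: "b \<in> carrier (free_mod n r')" "\<alpha> b = w (unit_vec n s)"
      using im[OF unit_vec_carrier[OF s]] by (metis imageE)
    have "\<alpha> (vec_comp r' dg' (dg s) b) = w (unit_vec n s)"
      using graded_hom_comp[OF \<alpha> b(1)] b(2) w s
      by (simp add: vec_comp_hom_vec[OF module_hom_closed[OF graded_homD[OF w] unit_vec_carrier[OF s]]]
          graded_hom_def)
    then show ?thesis using vec_comp_carrier[OF b(1)] hom_vec_comp by metis
  qed
  then obtain a where a: "\<And>s. s < r \<Longrightarrow> a s \<in> carrier (free_mod n r')"
    "\<And>s. s < r \<Longrightarrow> hom_vec r' dg' (dg s) (a s)" "\<And>s. s < r \<Longrightarrow> \<alpha> (a s) = w (unit_vec n s)" by metis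
  have "\<exists>f\<in>graded_hom n r dg r' dg'. \<forall>s<r. f (unit_vec n s) = a s"
    using a(1,2) by (rule graded_hom_universal)
  then obtain f where f: "f \<in> graded_hom n r dg r' dg'" "\<forall>s<r. f (unit_vec n s) = a s"
    by (elim bexE) (rule that)
  have "\<alpha> (f x) = w x" if "x \<in> carrier (free_mod n r)" for x
    using free_module_hom_eqI[OF cring_mpoly_ring free_mod_module
        graded_homD[OF graded_hom_compose[OF f(1) \<alpha>]] graded_homD[OF w] _ that] f(2) a(3) by simp
  then show ?thesis using f(1) by (intro bexI[of _ f]) simp_all
qed

text \<open>The same replacement of preimages by components, now for a target that is an ideal and
  not a free module with shifts; surjectivity of \<alpha> supplies the preimages.\<close>

lemma graded_aug_lift:
  assumes I: "ideal I (mpoly_ring n)"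
    and w: "w \<in> module_hom (mpoly_ring n) (free_mod n r) (ideal_module (mpoly_ring n) I)"
      "\<And>s. s < r \<Longrightarrow> homogeneous (dg s) (w (unit_vec n s))"
    and \<alpha>: "\<alpha> \<in> module_hom (mpoly_ring n) (free_mod n r') (ideal_module (mpoly_ring n) I)"
      "\<And>s. s < r' \<Longrightarrow> homogeneous (dg' s) (\<alpha> (unit_vec n s))"
    and im: "\<alpha> ` carrier (free_mod n r') = I"
  shows "\<exists>\<psi>\<in>graded_hom n r dg r' dg'. \<forall>x\<in>carrier (free_mod n r). \<alpha> (\<psi> x) = w x"
proof -
  have IC: "I \<subseteq> carrier (mpoly_ring n)"
    using additive_subgroup.a_subset[OF ideal.axioms(1)[OF I]] .
  have "\<exists>a. a \<in> carrier (free_mod n r') \<and> hom_vec r' dg' (dg s) a \<and> \<alpha> a = w (unit_vec n s)"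
    if s: "s < r" for s
  proof -
    have "w (unit_vec n s) \<in> I" using module_hom_closed[OF w(1) unit_vec_carrier[OF s]] by simp
    then obtain b where b: "b \<in> carrier (free_mod n r')" "\<alpha> b = w (unit_vec n s)"
      using im by (metis imageE)
    have "\<alpha> (vec_comp r' dg' (dg s) b) = w (unit_vec n s)"
      using graded_functional_comp[OF \<alpha>(1) IC b(1), of dg' 0 "dg s"] \<alpha>(2) b(2) w(2)[OF s]
      by (simp add: hom_comp_homogeneous)
    then show ?thesis using vec_comp_carrier[OF b(1)] hom_vec_comp by metis
  qed
  then obtain a where a: "\<And>s. s < r \<Longrightarrow> a s \<in> carrier (free_mod n r')"
    "\<And>s. s < r \<Longrightarrow> hom_vec r' dg' (dg s) (a s)" "\<And>s. s < r \<Longrightarrow> \<alpha> (a s) = w (unit_vec n s)" by metis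
  have "\<exists>f\<in>graded_hom n r dg r' dg'. \<forall>s<r. f (unit_vec n s) = a s"
    using a(1,2) by (rule graded_hom_universal)
  then obtain f where f: "f \<in> graded_hom n r dg r' dg'" "\<forall>s<r. f (unit_vec n s) = a s"
    by (elim bexE) (rule that)
  have "\<alpha> (f x) = w x" if "x \<in> carrier (free_mod n r)" for x
    using free_module_hom_eqI[OF cring_mpoly_ring ideal_module_module[OF I]
        module_hom_comp[OF graded_homD[OF f(1)] \<alpha>(1)] w(1) _ that] f(2) a(3) by simp
  then show ?thesis using f(1) by (intro bexI[of _ f]) simp_all
qed

lemma ideal_mpoly_subset: "ideal I (mpoly_ring n) \<Longrightarrow> I \<subseteq> carrier (mpoly_ring n)"
  using additive_subgroup.a_subset[OF ideal.axioms(1)] .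

lemma graded_resD:
  assumes "graded_free_resolution n I r dg \<delta> \<epsilon>"
  shows "resolution (mpoly_ring n) (ideal_module (mpoly_ring n) I) (\<lambda>p. free_mod n (r p)) \<delta> \<epsilon>"
    and "\<delta> p \<in> graded_hom n (r (Suc p)) (dg (Suc p)) (r p) (dg p)"
    and "\<epsilon> \<in> module_hom (mpoly_ring n) (free_mod n (r 0)) (ideal_module (mpoly_ring n) I)"
    and "s < r 0 \<Longrightarrow> homogeneous (dg 0 s) (\<epsilon> (unit_vec n s))"
    and "\<epsilon> ` carrier (free_mod n (r 0)) = I"
proof -
  show R: "resolution (mpoly_ring n) (ideal_module (mpoly_ring n) I) (\<lambda>p. free_mod n (r p)) \<delta> \<epsilon>"
    using assms by (simp add: graded_free_resolution_def)
  show "\<delta> p \<in> graded_hom n (r (Suc p)) (dg (Suc p)) (r p) (dg p)"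
    using assms resolution_hom(2)[OF R, of p]
    by (simp add: graded_free_resolution_def graded_hom_def hom_vec_def)
  show "\<epsilon> \<in> module_hom (mpoly_ring n) (free_mod n (r 0)) (ideal_module (mpoly_ring n) I)"
    by (rule resolution_hom(3)[OF R])
  show "homogeneous (dg 0 s) (\<epsilon> (unit_vec n s))" if "s < r 0"
    using assms that by (simp add: graded_free_resolution_def)
  show "\<epsilon> ` carrier (free_mod n (r 0)) = I"
    using resolution_onto[OF R] by simp
qed

section \<open>Comparison maps and homotopies over the polynomial ring\<close>

text \<open>The source is a complex with an augmentation \<open>a\<close> that may fail to be onto.
  Besides comparing two resolutions of one ideal, this form allows lifting a multiplication map from
  a resolution of one ideal to a resolution of another.\<close>

lemma graded_chain_map_exists:
  assumes I: "ideal I (mpoly_ring n)" and Q: "graded_free_resolution n I r' dg' \<delta>' \<epsilon>'"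
    and \<delta>: "\<And>p. \<delta> p \<in> graded_hom n (r (Suc p)) (dg (Suc p)) (r p) (dg p)"
    and dd: "\<And>p x. x \<in> carrier (free_mod n (r (Suc (Suc p)))) \<Longrightarrow> \<delta> p (\<delta> (Suc p) x) = (\<lambda>_. 0)"
    and a: "a \<in> module_hom (mpoly_ring n) (free_mod n (r 0)) (ideal_module (mpoly_ring n) I)"
      "\<And>s. s < r 0 \<Longrightarrow> homogeneous (dg 0 s) (a (unit_vec n s))"
      "\<And>x. x \<in> carrier (free_mod n (r (Suc 0))) \<Longrightarrow> a (\<delta> 0 x) = 0"
  shows "\<exists>f. (\<forall>p. f p \<in> graded_hom n (r p) (dg p) (r' p) (dg' p)) \<and>
    (\<forall>x\<in>carrier (free_mod n (r 0)). \<epsilon>' (f 0 x) = a x) \<and>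
    (\<forall>p. \<forall>x\<in>carrier (free_mod n (r (Suc p))). \<delta>' p (f (Suc p) x) = f p (\<delta> p x))"
proof (rule chain_map_exists[where P = "\<lambda>p. free_mod n (r p)" and Q = "\<lambda>p. free_mod n (r' p)"
      and R = "mpoly_ring n" and N = "ideal_module (mpoly_ring n) I"])
  show "resolution (mpoly_ring n) (ideal_module (mpoly_ring n) I) (\<lambda>p. free_mod n (r' p)) \<delta>' \<epsilon>'"
    by (rule graded_resD[OF Q])
  show "\<delta> p x \<in> carrier (free_mod n (r p))" if "x \<in> carrier (free_mod n (r (Suc p)))" for p x
    by (rule module_hom_closed[OF graded_homD[OF \<delta>] that])
  show "\<exists>f\<in>graded_hom n (r 0) (dg 0) (r' 0) (dg' 0). \<forall>x\<in>carrier (free_mod n (r 0)). \<epsilon>' (f x) = a x"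
    by (rule graded_aug_lift[OF I a(1,2) graded_resD(3,4,5)[OF Q]])
  show "\<exists>g\<in>graded_hom n (r (Suc p)) (dg (Suc p)) (r' (Suc p)) (dg' (Suc p)).
      \<forall>x\<in>carrier (free_mod n (r (Suc p))). \<delta>' p (g x) = f (\<delta> p x)"
    if f: "f \<in> graded_hom n (r p) (dg p) (r' p) (dg' p)" and
      im: "\<And>x. x \<in> carrier (free_mod n (r (Suc p))) \<Longrightarrow> f (\<delta> p x) \<in> \<delta>' p ` carrier (free_mod n (r' (Suc p)))"
    for p f
    using graded_hom_compose[OF \<delta> f] graded_resD(2)[OF Q] im by (rule graded_hom_lift)
qed (auto simp: dd a(3) free_mod_module graded_homD)

lemma graded_self_homotopy_exists:
  assumes I: "ideal I (mpoly_ring n)" and P: "graded_free_resolution n I r dg \<delta> \<epsilon>"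
    and t: "\<And>p. t p \<in> graded_hom n (r p) (dg p) (r p) (dg p)"
      "\<And>x. x \<in> carrier (free_mod n (r 0)) \<Longrightarrow> \<epsilon> (t 0 x) = \<epsilon> x"
      "\<And>p x. x \<in> carrier (free_mod n (r (Suc p))) \<Longrightarrow> \<delta> p (t (Suc p) x) = t p (\<delta> p x)"
  shows "\<exists>h. (\<forall>p. h p \<in> graded_hom n (r p) (dg p) (r (Suc p)) (dg (Suc p))) \<and>
    (\<forall>x\<in>carrier (free_mod n (r 0)). \<delta> 0 (h 0 x) = t 0 x \<ominus>\<^bsub>free_mod n (r 0)\<^esub> x) \<and>
    (\<forall>p. \<forall>x\<in>carrier (free_mod n (r (Suc p))). \<delta> (Suc p) (h (Suc p) x) =
       t (Suc p) x \<ominus>\<^bsub>free_mod n (r (Suc p))\<^esub> x \<ominus>\<^bsub>free_mod n (r (Suc p))\<^esub> h p (\<delta> p x))"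
proof (rule self_homotopy_exists[OF graded_resD(1)[OF P] ideal_module_module[OF I] t])
  show "\<exists>h\<in>graded_hom n (r p) (dg p) (r (Suc p)) (dg (Suc p)). \<forall>x\<in>carrier (free_mod n (r p)). \<delta> p (h x) = w x"
    if w: "w \<in> graded_hom n (r p) (dg p) (r p) (dg p)" and
      im: "\<And>x. x \<in> carrier (free_mod n (r p)) \<Longrightarrow> w x \<in> \<delta> p ` carrier (free_mod n (r (Suc p)))"
    for p w
    using w graded_resD(2)[OF P] im by (rule graded_hom_lift)
qed (auto simp: graded_hom_id graded_homD graded_hom_diff graded_hom_compose[OF graded_resD(2)[OF P]])

text \<open>Homotopies without degrees, for self-maps that factor through an ungraded projective
  resolution.\<close>

lemma free_self_homotopy_exists:
  assumes I: "ideal I (mpoly_ring n)"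
    and P: "resolution (mpoly_ring n) (ideal_module (mpoly_ring n) I) (\<lambda>p. free_mod n (r p)) \<delta> \<epsilon>"
    and t: "\<And>p. t p \<in> module_hom (mpoly_ring n) (free_mod n (r p)) (free_mod n (r p))"
      "\<And>x. x \<in> carrier (free_mod n (r 0)) \<Longrightarrow> \<epsilon> (t 0 x) = \<epsilon> x"
      "\<And>p x. x \<in> carrier (free_mod n (r (Suc p))) \<Longrightarrow> \<delta> p (t (Suc p) x) = t p (\<delta> p x)"
  shows "\<exists>h. (\<forall>p. h p \<in> module_hom (mpoly_ring n) (free_mod n (r p)) (free_mod n (r (Suc p)))) \<and>
    (\<forall>x\<in>carrier (free_mod n (r 0)). \<delta> 0 (h 0 x) = t 0 x \<ominus>\<^bsub>free_mod n (r 0)\<^esub> x) \<and>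
    (\<forall>p. \<forall>x\<in>carrier (free_mod n (r (Suc p))). \<delta> (Suc p) (h (Suc p) x) =
       t (Suc p) x \<ominus>\<^bsub>free_mod n (r (Suc p))\<^esub> x \<ominus>\<^bsub>free_mod n (r (Suc p))\<^esub> h p (\<delta> p x))"
proof (rule self_homotopy_exists[OF P ideal_module_module[OF I] t])
  show "\<exists>h\<in>module_hom (mpoly_ring n) (free_mod n (r p)) (free_mod n (r (Suc p))).
      \<forall>x\<in>carrier (free_mod n (r p)). \<delta> p (h x) = w x"
    if w: "w \<in> module_hom (mpoly_ring n) (free_mod n (r p)) (free_mod n (r p))" and
      im: "\<And>x. x \<in> carrier (free_mod n (r p)) \<Longrightarrow> w x \<in> \<delta> p ` carrier (free_mod n (r (Suc p)))"
    for p w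
    using cring_mpoly_ring fg_projective_free_mod free_mod_module free_mod_module w
      resolution_hom(2)[OF P] im by (rule fg_projective_lift)
qed (auto simp: module_hom_id intro: module_hom_diff[OF free_mod_module free_mod_module]
    module_hom_comp[OF resolution_hom(2)[OF P]])

section \<open>Minimal graded free resolutions\<close>

text \<open>Reduction modulo the maximal ideal generated by the variables, that is, tensoring with
  K; \<open>lift_vec\<close> below is its section by constant polynomials.\<close>

definition const_vec :: "(nat \<Rightarrow> 'k::field mpoly) \<Rightarrow> nat \<Rightarrow> 'k" where
  "const_vec v = (\<lambda>t. const_coeff (v t))"

definition lift_vec :: "(nat \<Rightarrow> 'k::field) \<Rightarrow> nat \<Rightarrow> 'k mpoly" where
  "lift_vec c = (\<lambda>t. Poly_Mapping.single 0 (c t))"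

lemma const_lift_vec [simp]: "const_vec (lift_vec c) = c"
  by (simp add: const_vec_def lift_vec_def)

lemma lift_vec_carrier: "(\<And>s. s \<ge> r \<Longrightarrow> c s = 0) \<Longrightarrow> lift_vec c \<in> carrier (free_mod n r)"
  by (auto simp: free_module_carrier lift_vec_def mpoly_carrier_single)

lemma hom_const_vec:
  assumes "f \<in> module_hom (mpoly_ring n) (free_mod n r) (free_mod n r')" "v \<in> carrier (free_mod n r)"
  shows "const_vec (f v) = (\<lambda>t. \<Sum>s<r. const_coeff (f (unit_vec n s) t) * const_vec v s)"
  by (simp add: const_vec_def hom_free_expand[OF assms] const_coeff_sum const_coeff_mult mult.commute)

lemma hom_const_vec_zero:
  assumes "f \<in> module_hom (mpoly_ring n) (free_mod n r) (free_mod n r')" "v \<in> carrier (free_mod n r)"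
    "const_vec v = (\<lambda>_. 0)"
  shows "const_vec (f v) = (\<lambda>_. 0)"
  by (simp add: hom_const_vec[OF assms(1,2)] assms(3))

lemma tensor_diff_const_vec:
  assumes "\<delta> p \<in> module_hom (mpoly_ring n) (free_mod n (r (Suc p))) (free_mod n (r p))"
    "v \<in> carrier (free_mod n (r (Suc p)))"
  shows "tensor_diff n r \<delta> p (const_vec v) = const_vec (\<delta> p v)"
  by (simp add: tensor_diff_def hom_const_vec[OF assms])

lemma tensor_component_lift_vec:
  assumes "c \<in> tensor_component r dg p q"
  shows "lift_vec c \<in> carrier (free_mod n (r p))" "hom_vec (r p) (dg p) q (lift_vec c)"
proof -
  show "lift_vec c \<in> carrier (free_mod n (r p))"
    using assms by (intro lift_vec_carrier) (auto simp: tensor_component_def)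
  show "hom_vec (r p) (dg p) q (lift_vec c)"
    using assms by (auto simp: hom_vec_def lift_vec_def homogeneous_iff tensor_component_def)
qed

text \<open>Coordinate s of a vector of degree q is homogeneous of degree q - \<open>dg p s\<close>,
  so a nonzero constant coefficient forces \<open>dg p s\<close> to equal q.\<close>

lemma tensor_component_const_vec:
  assumes "v \<in> carrier (free_mod n (r p))" "hom_vec (r p) (dg p) q v"
  shows "const_vec v \<in> tensor_component r dg p q"
proof -
  have "s < r p" if "const_coeff (v s) \<noteq> 0" for s
    using that free_mod_outside[OF assms(1), of s] by (cases "s < r p") auto
  moreover have "q - dg p s = 0" if "const_coeff (v s) \<noteq> 0" "s < r p" for s
    using that assms(2) homogeneous_const_coeff[of "q - dg p s" "v s"] by (auto simp: hom_vec_def)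
  ultimately show ?thesis by (auto simp: tensor_component_def const_vec_def)
qed

text \<open>Minimality in the form that all differentials vanish after tensoring with K,
  equivalently that all matrix entries have constant coefficient 0.\<close>

definition minimal_resolution where
  "minimal_resolution n I r dg \<delta> \<epsilon> \<longleftrightarrow> graded_free_resolution n I r dg \<delta> \<epsilon> \<and>
     (\<forall>p. \<forall>v\<in>carrier (free_mod n (r (Suc p))). const_vec (\<delta> p v) = (\<lambda>_. 0))"

interpretation fun_space: vector_space "\<lambda>(a::'k::field) c s. a * c (s::nat)"
  by unfold_locales (auto simp: fun_eq_iff algebra_simps)

text \<open>The subspace \<open>W s\<close> contains \<open>B\<close> and every \<phi> t with t
  \<noteq> s, but not \<phi> s. Hence no \<phi> s lies in the span of \<open>B\<close> and the other
  ones, and a basis of \<open>B\<close> extends by the \<phi> s to a basis of \<open>V\<close>. The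
  finite set \<open>E\<close> guarantees that \<open>B\<close> has finite dimension.\<close>

lemma (in vector_space) dim_complement:
  assumes T: "finite T" and E: "finite E" "B \<subseteq> span E" and BV: "B \<subseteq> V" and \<phi>V: "\<phi> ` T \<subseteq> V"
    and V: "V \<subseteq> span (B \<union> \<phi> ` T)"
    and sub: "\<And>s. s \<in> T \<Longrightarrow> subspace (W s)"
    and W: "\<And>s. s \<in> T \<Longrightarrow> B \<subseteq> W s" "\<And>s t. s \<in> T \<Longrightarrow> t \<in> T \<Longrightarrow> \<phi> t \<in> W s \<longleftrightarrow> s \<noteq> t"
  shows "dim V = dim B + card T"
proof -
  obtain C where C: "C \<subseteq> B" "independent C" "B \<subseteq> span C" "card C = dim B"
    using basis_exists by blast
  have fC: "finite C" using independent_span_bound[OF E(1) C(2)] C(1) E(2) by blast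
  have "independent (C \<union> \<phi> ` T') \<and> card (C \<union> \<phi> ` T') = card C + card T'" if "T' \<subseteq> T" for T'
    using finite_subset[OF that T] that
  proof (induction T' rule: finite_induct)
    case empty
    then show ?case using C(2) by simp
  next
    case (insert s T')
    have "C \<union> \<phi> ` T' \<subseteq> W s" using insert W C(1) by blast
    then have "span (C \<union> \<phi> ` T') \<subseteq> W s" using span_minimal sub insert by simp
    then have s: "\<phi> s \<notin> span (C \<union> \<phi> ` T')" using W(2) insert by blast
    then have "\<phi> s \<notin> C \<union> \<phi> ` T'" using span_base[of "\<phi> s" "C \<union> \<phi> ` T'"] by blast
    then show ?case using insert fC independent_insertI[OF s] by simp
  qed
  from this[of T] have ind: "independent (C \<union> \<phi> ` T)" and card: "card (C \<union> \<phi> ` T) = card C + card T"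
    by auto
  have "B \<union> \<phi> ` T \<subseteq> span (C \<union> \<phi> ` T)"
    using C(3) span_mono[of C "C \<union> \<phi> ` T"] span_base[of _ "C \<union> \<phi> ` T"] by blast
  then have "V \<subseteq> span (C \<union> \<phi> ` T)" using V span_minimal[OF _ subspace_span] by (meson order_trans)
  moreover have "C \<union> \<phi> ` T \<subseteq> V" using C(1) BV \<phi>V by blast
  ultimately have "card (C \<union> \<phi> ` T) = dim V" using ind by (intro basis_card_eq_dim)
  then show ?thesis using card C(4) by simp
qed

lemma sum_apply: "(\<Sum>s\<in>A. f s) t = (\<Sum>s\<in>A. f s t)"
  by (induction A rule: infinite_finite_induct) auto

text \<open>The tensored comparison map from the minimal to the given resolution identifies the former
  with a complement of the boundaries in the cycles.\<close>

lemma tor_dim: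
  assumes I: "ideal I (mpoly_ring n)" and F: "minimal_resolution n I r dg \<delta> \<epsilon>"
    and G: "graded_free_resolution n (I :: 'k::field mpoly set) r' dg' \<delta>' \<epsilon>'"
  shows "K_dim (tor_cycles n r' dg' \<delta>' p q) =
    K_dim (tor_boundaries n r' dg' \<delta>' p q) + card {s. s < r p \<and> dg p s = q}"
proof -
  have F': "graded_free_resolution n I r dg \<delta> \<epsilon>" using F by (simp add: minimal_resolution_def)
  have min: "const_vec (\<delta> p v) = (\<lambda>_. 0)" if "v \<in> carrier (free_mod n (r (Suc p)))" for p v
    using F that by (simp add: minimal_resolution_def)
  note \<delta> = graded_resD(2)[OF F'] note \<delta>' = graded_resD(2)[OF G]
  note ddF = resolution_dd[OF graded_resD(1)[OF F'], simplified]
  note ddG = resolution_dd[OF graded_resD(1)[OF G], simplified]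
  note augF = resolution_aug[OF graded_resD(1)[OF F'], simplified]
  note augG = resolution_aug[OF graded_resD(1)[OF G], simplified]
  have "\<exists>f. (\<forall>p. f p \<in> graded_hom n (r p) (dg p) (r' p) (dg' p)) \<and>
    (\<forall>x\<in>carrier (free_mod n (r 0)). \<epsilon>' (f 0 x) = \<epsilon> x) \<and>
    (\<forall>p. \<forall>x\<in>carrier (free_mod n (r (Suc p))). \<delta>' p (f (Suc p) x) = f p (\<delta> p x))"
    using I G \<delta> ddF graded_resD(3,4)[OF F'] augF by (rule graded_chain_map_exists)
  then obtain f where f: "\<And>p. f p \<in> graded_hom n (r p) (dg p) (r' p) (dg' p)"
      "\<And>x. x \<in> carrier (free_mod n (r 0)) \<Longrightarrow> \<epsilon>' (f 0 x) = \<epsilon> x"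
      "\<And>p x. x \<in> carrier (free_mod n (r (Suc p))) \<Longrightarrow> \<delta>' p (f (Suc p) x) = f p (\<delta> p x)" by metis
  have "\<exists>g. (\<forall>p. g p \<in> graded_hom n (r' p) (dg' p) (r p) (dg p)) \<and>
    (\<forall>x\<in>carrier (free_mod n (r' 0)). \<epsilon> (g 0 x) = \<epsilon>' x) \<and>
    (\<forall>p. \<forall>x\<in>carrier (free_mod n (r' (Suc p))). \<delta> p (g (Suc p) x) = g p (\<delta>' p x))"
    using I F' \<delta>' ddG graded_resD(3,4)[OF G] augG by (rule graded_chain_map_exists)
  then obtain g where g: "\<And>p. g p \<in> graded_hom n (r' p) (dg' p) (r p) (dg p)"
      "\<And>x. x \<in> carrier (free_mod n (r' 0)) \<Longrightarrow> \<epsilon> (g 0 x) = \<epsilon>' x"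
      "\<And>p x. x \<in> carrier (free_mod n (r' (Suc p))) \<Longrightarrow> \<delta> p (g (Suc p) x) = g p (\<delta>' p x)" by metis
  note fh = graded_homD[OF f(1)] note gh = graded_homD[OF g(1)]
  note \<delta>h = graded_homD[OF \<delta>] note \<delta>h' = graded_homD[OF \<delta>']
  note fc = module_hom_closed[OF fh] note gc = module_hom_closed[OF gh]
  note \<delta>c = module_hom_closed[OF \<delta>h] note \<delta>c' = module_hom_closed[OF \<delta>h']
  have "\<exists>h. (\<forall>p. h p \<in> graded_hom n (r p) (dg p) (r (Suc p)) (dg (Suc p))) \<and>
    (\<forall>x\<in>carrier (free_mod n (r 0)). \<delta> 0 (h 0 x) = g 0 (f 0 x) \<ominus>\<^bsub>free_mod n (r 0)\<^esub> x) \<and>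
    (\<forall>p. \<forall>x\<in>carrier (free_mod n (r (Suc p))). \<delta> (Suc p) (h (Suc p) x) =
       g (Suc p) (f (Suc p) x) \<ominus>\<^bsub>free_mod n (r (Suc p))\<^esub> x \<ominus>\<^bsub>free_mod n (r (Suc p))\<^esub> h p (\<delta> p x))"
    by (rule graded_self_homotopy_exists[OF I F', where t = "\<lambda>p x. g p (f p x)"])
      (auto simp: f(2,3) g(2,3) fc graded_hom_compose[OF f(1) g(1)])
  then obtain h where h: "\<And>p. h p \<in> graded_hom n (r p) (dg p) (r (Suc p)) (dg (Suc p))"
    and h0: "\<And>x. x \<in> carrier (free_mod n (r 0)) \<Longrightarrow>
        \<delta> 0 (h 0 x) = g 0 (f 0 x) \<ominus>\<^bsub>free_mod n (r 0)\<^esub> x"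
    and hS: "\<And>p x. x \<in> carrier (free_mod n (r (Suc p))) \<Longrightarrow> \<delta> (Suc p) (h (Suc p) x) =
       g (Suc p) (f (Suc p) x) \<ominus>\<^bsub>free_mod n (r (Suc p))\<^esub> x \<ominus>\<^bsub>free_mod n (r (Suc p))\<^esub> h p (\<delta> p x)"
    by metis
  have "\<exists>h. (\<forall>p. h p \<in> graded_hom n (r' p) (dg' p) (r' (Suc p)) (dg' (Suc p))) \<and>
    (\<forall>x\<in>carrier (free_mod n (r' 0)). \<delta>' 0 (h 0 x) = f 0 (g 0 x) \<ominus>\<^bsub>free_mod n (r' 0)\<^esub> x) \<and>
    (\<forall>p. \<forall>x\<in>carrier (free_mod n (r' (Suc p))). \<delta>' (Suc p) (h (Suc p) x) =
       f (Suc p) (g (Suc p) x) \<ominus>\<^bsub>free_mod n (r' (Suc p))\<^esub> x \<ominus>\<^bsub>free_mod n (r' (Suc p))\<^esub> h p (\<delta>' p x))"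
    by (rule graded_self_homotopy_exists[OF I G, where t = "\<lambda>p x. f p (g p x)"])
      (auto simp: f(2,3) g(2,3) gc graded_hom_compose[OF g(1) f(1)])
  then obtain k where k: "\<And>p. k p \<in> graded_hom n (r' p) (dg' p) (r' (Suc p)) (dg' (Suc p))"
    and k0: "\<And>x. x \<in> carrier (free_mod n (r' 0)) \<Longrightarrow>
        \<delta>' 0 (k 0 x) = f 0 (g 0 x) \<ominus>\<^bsub>free_mod n (r' 0)\<^esub> x"
    and kS: "\<And>p x. x \<in> carrier (free_mod n (r' (Suc p))) \<Longrightarrow> \<delta>' (Suc p) (k (Suc p) x) =
       f (Suc p) (g (Suc p) x) \<ominus>\<^bsub>free_mod n (r' (Suc p))\<^esub> x \<ominus>\<^bsub>free_mod n (r' (Suc p))\<^esub> k p (\<delta>' p x)"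
    by metis
  note kc = module_hom_closed[OF graded_homD[OF k]]
  note hc = module_hom_closed[OF graded_homD[OF h]]
  define T where "T = {s. s < r p \<and> dg p s = q}"
  \<comment> \<open>\<open>\<phi>\<close> lists the columns of \<open>f p\<close> tensored with K
    that belong to degree q, and \<open>\<gamma>\<close> is \<open>g p\<close> tensored with
    K.\<close>
  define \<phi> where "\<phi> s = const_vec (f p (unit_vec n s))" for s
  define \<gamma> where "\<gamma> c t = (\<Sum>s<r' p. const_coeff (g p (unit_vec n s) t) * c s)" for c t
  let ?Z = "tor_cycles n r' dg' \<delta>' p q" and ?B = "tor_boundaries n r' dg' \<delta>' p q"
  note compG = tensor_component_const_vec[where r = r' and dg = dg' and p = p]
  note compF = tensor_component_const_vec[where r = r and dg = dg and p = p]
  have \<gamma>: "\<gamma> (const_vec v) = const_vec (g p v)" if "v \<in> carrier (free_mod n (r' p))" for v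
    by (simp add: \<gamma>_def fun_eq_iff hom_const_vec[OF gh that])
  \<comment> \<open>Only \<open>F\<close> is minimal, so only this composite becomes the identity:
    both homotopy terms involve a differential of \<open>F\<close> and die modulo the maximal
    ideal.\<close>
  have gf: "const_vec (g p (f p v)) = const_vec v" if v: "v \<in> carrier (free_mod n (r p))" for v
  proof (cases p)
    case 0
    then show ?thesis
      using min[OF hc, of v 0] h0[of v] v
      by (simp add: free_mod_minus fc gc const_vec_def fun_eq_iff const_coeff_diff)
  next
    case (Suc p')
    have 1: "const_vec (h p' (\<delta> p' v)) = (\<lambda>_. 0)"
      using hom_const_vec_zero[OF graded_homD[OF h] \<delta>c min] v Suc by simp
    show ?thesis
      using min[OF hc, of v p] hS[of v p'] v Suc 1 \<delta>c[of v p'] hc[of "\<delta> p' v" p']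
      by (simp add: free_mod_minus free_mod_diff fc gc const_vec_def fun_eq_iff const_coeff_diff)
  qed
  \<comment> \<open>\<open>g\<close> carries a boundary of the other resolution to a boundary of
    \<open>F\<close>, which is zero after reduction.\<close>
  have B0: "\<gamma> b = (\<lambda>_. 0)" if b: "b \<in> ?B" for b
  proof -
    obtain c where c: "c \<in> tensor_component r' dg' (Suc p) q" "b = tensor_diff n r' \<delta>' p c"
      using b by (auto simp: tor_boundaries_def)
    note l = tensor_component_lift_vec(1)[OF c(1), of n]
    have "b = const_vec (\<delta>' p (lift_vec c))"
      using tensor_diff_const_vec[where r = r' and p = p and \<delta> = \<delta>', OF \<delta>h' l] c(2) by simp
    then show ?thesis using \<gamma>[OF \<delta>c'[OF l]] g(3)[OF l] min[OF gc[OF l]] by simp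
  qed
  have BV: "?B \<subseteq> ?Z"
  proof
    fix b assume "b \<in> ?B"
    then obtain c where c: "c \<in> tensor_component r' dg' (Suc p) q" "b = tensor_diff n r' \<delta>' p c"
      by (auto simp: tor_boundaries_def)
    note l = tensor_component_lift_vec[OF c(1)]
    have b: "b = const_vec (\<delta>' p (lift_vec c))"
      using tensor_diff_const_vec[where r = r' and p = p and \<delta> = \<delta>', OF \<delta>h' l(1)] c(2) by simp
    have "b \<in> tensor_component r' dg' p q"
      unfolding b by (rule compG[OF \<delta>c'[OF l(1)] graded_hom_vec[OF \<delta>' l]])
    moreover have "tensor_diff n r' \<delta>' p' b = 0" if "p = Suc p'" for p'
      using tensor_diff_const_vec[where r = r' and p = p' and \<delta> = \<delta>', OF \<delta>h', of "\<delta>' p (lift_vec c)"]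
        \<delta>c'[OF l(1)] ddG[of "lift_vec c" p'] l(1) that
      by (simp add: b const_vec_def fun_eq_iff)
    ultimately show "b \<in> ?Z" by (simp add: tor_cycles_def)
  qed
  have \<phi>V: "\<phi> ` T \<subseteq> ?Z"
  proof (rule image_subsetI)
    fix s assume "s \<in> T"
    then have s: "s < r p" "dg p s = q" by (auto simp: T_def)
    note u = unit_vec_carrier[OF s(1), of n]
    have "hom_vec (r' p) (dg' p) q (f p (unit_vec n s))"
      using f(1)[of p] s by (auto simp: graded_hom_def)
    then have "\<phi> s \<in> tensor_component r' dg' p q"
      unfolding \<phi>_def by (rule compG[OF fc[OF u]])
    moreover have "tensor_diff n r' \<delta>' p' (\<phi> s) = 0" if p: "p = Suc p'" for p'
    proof -
      have "tensor_diff n r' \<delta>' p' (\<phi> s) = const_vec (f p' (\<delta> p' (unit_vec n s)))"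
        using tensor_diff_const_vec[where r = r' and p = p' and \<delta> = \<delta>', OF \<delta>h' fc[of _ "Suc p'"]]
          f(3)[of _ p'] u p by (simp add: \<phi>_def)
      also have "\<dots> = (\<lambda>_. 0)"
        using hom_const_vec_zero[OF fh \<delta>c min] u p by simp
      finally show ?thesis by (simp add: fun_eq_iff)
    qed
    ultimately show "\<phi> s \<in> ?Z" by (simp add: tor_cycles_def)
  qed
  have subB: "fun_space.subspace ?B"
  proof -
    have add: "tensor_diff n r' \<delta>' p c + tensor_diff n r' \<delta>' p d = tensor_diff n r' \<delta>' p (c + d)" for c d
      by (simp add: tensor_diff_def fun_eq_iff sum.distrib algebra_simps)
    have sc: "(\<lambda>s. a * tensor_diff n r' \<delta>' p c s) = tensor_diff n r' \<delta>' p (\<lambda>s. a * c s)" for a c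
      by (simp add: tensor_diff_def fun_eq_iff sum_distrib_left algebra_simps)
    have zero: "0 = tensor_diff n r' \<delta>' p 0"
      by (simp add: tensor_diff_def fun_eq_iff)
    show ?thesis
      unfolding fun_space.subspace_def tor_boundaries_def
      by (auto simp: add sc intro!: image_eqI[where f = "tensor_diff n r' \<delta>' p" and x = 0, OF zero] imageI)
        (auto simp: tensor_component_def, (metis add_0)+)
  qed
  have V: "?Z \<subseteq> fun_space.span (?B \<union> \<phi> ` T)"
  proof
    fix z assume z: "z \<in> ?Z"
    then have zt: "z \<in> tensor_component r' dg' p q" by (simp add: tor_cycles_def)
    define v where "v = lift_vec z"
    have v: "v \<in> carrier (free_mod n (r' p))" "hom_vec (r' p) (dg' p) q v" "const_vec v = z"
      unfolding v_def using tensor_component_lift_vec[OF zt] by simp_all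
    \<comment> \<open>For a cycle the homotopy term that starts with \<delta>' vanishes after
      reduction, so \<open>z\<close> and its image under f g differ by a boundary only.\<close>
    have "const_vec (\<delta>' p (k p v)) = const_vec (f p (g p v)) - z"
    proof (cases p)
      case 0
      then have v0: "v \<in> carrier (free_mod n (r' 0))" using v(1) by simp
      have "\<delta>' 0 (k 0 v) = (\<lambda>s. f 0 (g 0 v) s - v s)"
        unfolding k0[OF v0] by (rule free_mod_minus[OF fc[OF gc[OF v0]] v0])
      then show ?thesis unfolding v(3)[symmetric] 0 by (simp add: const_vec_def fun_eq_iff const_coeff_diff)
    next
      case (Suc p')
      have vS: "v \<in> carrier (free_mod n (r' (Suc p')))" using v(1) Suc by simp
      have "const_vec (\<delta>' p' v) = (\<lambda>_. 0)"
        using tensor_diff_const_vec[where r = r' and p = p' and \<delta> = \<delta>', OF \<delta>h' vS] z v(3) Suc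
        by (simp add: tor_cycles_def fun_eq_iff)
      then have 1: "const_vec (k p' (\<delta>' p' v)) = (\<lambda>_. 0)"
        using hom_const_vec_zero[OF graded_homD[OF k] \<delta>c'] vS by simp
      have "\<delta>' (Suc p') (k (Suc p') v) = (\<lambda>s. f (Suc p') (g (Suc p') v) s - v s - k p' (\<delta>' p' v) s)"
        unfolding kS[OF vS] free_mod_minus[OF fc[OF gc[OF vS]] vS]
        by (rule free_mod_minus[OF free_mod_diff[OF fc[OF gc[OF vS]] vS] kc[OF \<delta>c'[OF vS]]])
      with 1 show ?thesis
        unfolding v(3)[symmetric] Suc by (simp add: const_vec_def fun_eq_iff const_coeff_diff)
    qed
    then have z_eq: "z = const_vec (f p (g p v)) - const_vec (\<delta>' p (k p v))" by simp
    have B: "const_vec (\<delta>' p (k p v)) \<in> ?B"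
      using tensor_diff_const_vec[where r = r' and p = p and \<delta> = \<delta>', OF \<delta>h' kc[OF v(1)]]
        tensor_component_const_vec[where r = r' and dg = dg' and p = "Suc p", OF kc[OF v(1)] graded_hom_vec[OF k v(1,2)]]
      unfolding tor_boundaries_def by (metis imageI)
    \<comment> \<open>\<open>\<gamma> z\<close> is again homogeneous of degree q, so its
      coefficients are supported on \<open>T\<close>.\<close>
    have S: "const_vec (f p (g p v)) = (\<Sum>s\<in>T. (\<lambda>t. \<gamma> z s * \<phi> s t))"
    proof -
      have gz: "\<gamma> z = const_vec (g p v)" using \<gamma>[OF v(1)] v(3) by simp
      have "\<gamma> z \<in> tensor_component r dg p q"
        unfolding gz by (rule compF[OF gc[OF v(1)] graded_hom_vec[OF g(1) v(1,2)]])
      then have *: "\<gamma> z s = 0" if "s \<notin> T" for s using that by (auto simp: tensor_component_def T_def)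
      have "const_vec (f p (g p v)) = (\<lambda>t. \<Sum>s<r p. \<gamma> z s * \<phi> s t)"
        using hom_const_vec[OF fh gc[OF v(1)]] by (simp add: gz \<phi>_def const_vec_def mult.commute)
      also have "\<dots> = (\<lambda>t. \<Sum>s\<in>T. \<gamma> z s * \<phi> s t)"
        by (intro ext sum.mono_neutral_right) (auto simp: T_def *)
      also have "\<dots> = (\<Sum>s\<in>T. (\<lambda>t. \<gamma> z s * \<phi> s t))"
        by (simp add: fun_eq_iff sum_apply)
      finally show ?thesis .
    qed
    have "(\<Sum>s\<in>T. (\<lambda>t. \<gamma> z s * \<phi> s t)) \<in> fun_space.span (?B \<union> \<phi> ` T)"
      by (intro fun_space.span_sum fun_space.span_scale fun_space.span_base) auto
    then have "const_vec (f p (g p v)) \<in> fun_space.span (?B \<union> \<phi> ` T)" unfolding S .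
    moreover have "const_vec (\<delta>' p (k p v)) \<in> fun_space.span (?B \<union> \<phi> ` T)"
      using B by (intro fun_space.span_base) simp
    ultimately show "z \<in> fun_space.span (?B \<union> \<phi> ` T)"
      by (subst z_eq) (rule fun_space.span_diff)
  qed
  \<comment> \<open>The coordinate functionals of \<open>\<gamma>\<close> separate the columns
    \<open>\<phi> t\<close>, because \<open>\<gamma>\<close> is a left inverse to them, and they
    vanish on boundaries.\<close>
  let ?W = "\<lambda>s. {c. \<gamma> c s = 0}"
  have subW: "fun_space.subspace (?W s)" for s
  proof -
    have "\<gamma> (c + d) s = \<gamma> c s + \<gamma> d s" for c d
      by (simp add: \<gamma>_def sum.distrib algebra_simps)
    moreover have "\<gamma> (\<lambda>t. a * c t) s = a * \<gamma> c s" for a c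
      by (simp add: \<gamma>_def sum_distrib_left algebra_simps)
    ultimately show ?thesis by (simp add: fun_space.subspace_def) (simp add: \<gamma>_def)
  qed
  have W: "\<phi> t \<in> ?W s \<longleftrightarrow> s \<noteq> t" if "s \<in> T" "t \<in> T" for s t
  proof -
    have u: "unit_vec n t \<in> carrier (free_mod n (r p))" using that by (intro unit_vec_carrier) (simp add: T_def)
    have "\<gamma> (\<phi> t) = const_vec (unit_vec n t)"
      unfolding \<phi>_def using \<gamma>[OF fc[OF u]] gf[OF u] by simp
    then show ?thesis by (simp add: const_vec_def unit_vector_def)
  qed
  let ?E = "(\<lambda>s t. if t = s then 1 else 0 :: 'k) ` {..<r' p}"
  have E: "?B \<subseteq> fun_space.span ?E"
  proof
    fix b assume "b \<in> ?B"
    then have b: "b s = 0" if "s \<ge> r' p" for s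
      using BV that by (force simp: tor_cycles_def tensor_component_def)
    have "b = (\<Sum>s<r' p. (\<lambda>t. b s * (if t = s then 1 else 0)))"
    proof
      fix t
      have "(\<Sum>s<r' p. b s * (if t = s then 1 else 0)) = (\<Sum>s<r' p. if t = s then b t else 0)"
        by (intro sum.cong) auto
      then show "b t = (\<Sum>s<r' p. (\<lambda>t. b s * (if t = s then 1 else 0))) t"
        using b[of t] by (simp add: sum_apply)
    qed
    also have "\<dots> \<in> fun_space.span ?E"
      by (intro fun_space.span_sum fun_space.span_scale fun_space.span_base) auto
    finally show "b \<in> fun_space.span ?E" .
  qed
  have "fun_space.dim ?Z = fun_space.dim ?B + card T"
    by (rule fun_space.dim_complement[where E = ?E and \<phi> = \<phi> and W = ?W])
      (use E BV \<phi>V V subW W in \<open>auto simp: T_def B0\<close>)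
  then show ?thesis by (simp add: K_dim_def T_def)
qed

section \<open>Betti numbers and projective dimension from a minimal resolution\<close>

text \<open>The choice operator does return a graded free resolution, since the minimal one is a
  witness. The dimension of the boundaries then cancels in \<open>tor_dim\<close>.\<close>

lemma graded_betti_minimal:
  assumes I: "ideal I (mpoly_ring n)" and F: "minimal_resolution n (I :: 'k::field mpoly set) r dg \<delta> \<epsilon>"
  shows "graded_betti n I p q = card {s. s < r p \<and> dg p s = q}"
proof -
  let ?P = "\<lambda>(r, dg, \<delta>, \<epsilon>). graded_free_resolution n I r dg \<delta> \<epsilon>"
  obtain r' dg' \<delta>' \<epsilon>' where x: "Eps ?P = (r', dg', \<delta>', \<epsilon>')" by (rule prod_cases4)
  have "?P (r, dg, \<delta>, \<epsilon>)" using F by (simp add: minimal_resolution_def)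
  then have "?P (Eps ?P)" by (rule someI)
  then have "graded_free_resolution n I r' dg' \<delta>' \<epsilon>'" unfolding x by simp
  from tor_dim[OF I F this] show ?thesis unfolding graded_betti_def x by simp
qed

text \<open>The minimal resolution itself gives the upper bound. If some projective resolution had
  length e < d, the self-map of the minimal resolution passing through it would be 0 in degree d. Up
  to sign, the identity there would be a sum of homotopy terms, all of which reduce to 0 modulo the
  maximal ideal, although the module in degree d has positive rank.\<close>

lemma proj_dim_minimal:
  assumes I: "ideal I (mpoly_ring n)" and F: "minimal_resolution n (I :: 'k::field mpoly set) r dg \<delta> \<epsilon>"
    and top: "r d > 0" "\<And>p. p > d \<Longrightarrow> r p = 0"
  shows "proj_dim (mpoly_ring n) (ideal_module (mpoly_ring n) I) = enat d"
proof -
  let ?R = "mpoly_ring n :: 'k mpoly ring" and ?M = "ideal_module (mpoly_ring n) I"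
  let ?F = "\<lambda>p. free_mod n (r p) :: ('k mpoly, nat \<Rightarrow> 'k mpoly) module"
  have resF: "resolution ?R ?M ?F \<delta> \<epsilon>"
    using F graded_resD(1) unfolding minimal_resolution_def by blast
  have min: "const_vec (\<delta> p v) = (\<lambda>_. 0)" if "v \<in> carrier (?F (Suc p))" for p v
    using F that by (simp add: minimal_resolution_def)
  have zeroF: "carrier (?F p) = {\<zero>\<^bsub>?F p\<^esub>}" if "p > d" for p
    using top(2)[OF that] by (auto simp: free_module_carrier)
  have "\<exists>(P :: nat \<Rightarrow> ('k mpoly, nat \<Rightarrow> 'k mpoly) module) \<delta> \<epsilon>. resolution ?R ?M P \<delta> \<epsilon> \<and>
      (\<forall>p. fg_projective ?R (P p)) \<and> (\<forall>p>d. carrier (P p) = {\<zero>\<^bsub>P p\<^esub>})"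
    by (rule exI[of _ ?F], rule exI[of _ \<delta>], rule exI[of _ \<epsilon>])
      (intro conjI allI impI resF fg_projective_free_mod zeroF)
  then have upper: "proj_dim ?R ?M \<le> enat d"
    unfolding proj_dim_def by (intro Inf_lower CollectI exI[of _ d] conjI refl)
  have "d \<le> e" if P: "resolution ?R ?M P \<delta>' \<epsilon>'" and proj: "\<And>p. fg_projective ?R (P p)"
    and zero: "\<And>p. p > e \<Longrightarrow> carrier (P p) = {\<zero>\<^bsub>P p\<^esub>}"
    for P :: "nat \<Rightarrow> ('k mpoly, nat \<Rightarrow> 'k mpoly) module" and \<delta>' \<epsilon>' e
  proof (rule ccontr)
    assume "\<not> d \<le> e"
    then have de: "d > e" by simp
    note hF = resolution_hom[OF resF] note hP = resolution_hom[OF P]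
    have "\<exists>f. (\<forall>p. f p \<in> module_hom ?R (?F p) (P p)) \<and> (\<forall>x\<in>carrier (?F 0). \<epsilon>' (f 0 x) = \<epsilon> x) \<and>
      (\<forall>p. \<forall>x\<in>carrier (?F (Suc p)). \<delta>' p (f (Suc p) x) = f p (\<delta> p x))"
    proof (rule chain_map_exists[OF P])
      show "\<exists>f\<in>module_hom ?R (?F 0) (P 0). \<forall>x\<in>carrier (?F 0). \<epsilon>' (f x) = \<epsilon> x"
        by (rule fg_projective_lift[OF cring_mpoly_ring fg_projective_free_mod hP(1)
              ideal_module_module[OF I] hF(3) hP(3)])
          (use resolution_onto[OF P] module_hom_closed[OF hF(3)] in auto)
      show "\<exists>g\<in>module_hom ?R (?F (Suc p)) (P (Suc p)). \<forall>x\<in>carrier (?F (Suc p)). \<delta>' p (g x) = f (\<delta> p x)"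
        if f: "f \<in> module_hom ?R (?F p) (P p)"
          and im: "\<And>x. x \<in> carrier (?F (Suc p)) \<Longrightarrow> f (\<delta> p x) \<in> \<delta>' p ` carrier (P (Suc p))" for p f
        using cring_mpoly_ring fg_projective_free_mod hP(1) hP(1) module_hom_comp[OF hF(2) f] hP(2) im
        by (rule fg_projective_lift)
    qed (auto simp: hF(1) module_hom_closed[OF hF(2)] resolution_dd[OF resF, simplified]
        resolution_aug[OF resF, simplified])
    then obtain f where f: "\<And>p. f p \<in> module_hom ?R (?F p) (P p)"
        "\<And>x. x \<in> carrier (?F 0) \<Longrightarrow> \<epsilon>' (f 0 x) = \<epsilon> x"
        "\<And>p x. x \<in> carrier (?F (Suc p)) \<Longrightarrow> \<delta>' p (f (Suc p) x) = f p (\<delta> p x)" by metis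
    have "\<exists>g. (\<forall>p. g p \<in> module_hom ?R (P p) (?F p)) \<and> (\<forall>x\<in>carrier (P 0). \<epsilon> (g 0 x) = \<epsilon>' x) \<and>
      (\<forall>p. \<forall>x\<in>carrier (P (Suc p)). \<delta> p (g (Suc p) x) = g p (\<delta>' p x))"
    proof (rule chain_map_exists[OF resF])
      show "\<exists>f\<in>module_hom ?R (P 0) (?F 0). \<forall>x\<in>carrier (P 0). \<epsilon> (f x) = \<epsilon>' x"
        by (rule fg_projective_lift[OF cring_mpoly_ring proj hF(1)
              ideal_module_module[OF I] hP(3) hF(3)])
          (use resolution_onto[OF resF] module_hom_closed[OF hP(3)] in auto)
      show "\<exists>g\<in>module_hom ?R (P (Suc p)) (?F (Suc p)). \<forall>x\<in>carrier (P (Suc p)). \<delta> p (g x) = f (\<delta>' p x)"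
        if f: "f \<in> module_hom ?R (P p) (?F p)"
          and im: "\<And>x. x \<in> carrier (P (Suc p)) \<Longrightarrow> f (\<delta>' p x) \<in> \<delta> p ` carrier (?F (Suc p))" for p f
        using cring_mpoly_ring proj hF(1) hF(1) module_hom_comp[OF hP(2) f] hF(2) im
        by (rule fg_projective_lift)
    qed (auto simp: hP(1) module_hom_closed[OF hP(2)] resolution_dd[OF P]
        resolution_aug[OF P, simplified])
    then obtain g where g: "\<And>p. g p \<in> module_hom ?R (P p) (?F p)"
        "\<And>x. x \<in> carrier (P 0) \<Longrightarrow> \<epsilon> (g 0 x) = \<epsilon>' x"
        "\<And>p x. x \<in> carrier (P (Suc p)) \<Longrightarrow> \<delta> p (g (Suc p) x) = g p (\<delta>' p x)" by metis
    note fc = module_hom_closed[OF f(1)] note gc = module_hom_closed[OF g(1)]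
    have "\<exists>h. (\<forall>p. h p \<in> module_hom ?R (?F p) (?F (Suc p))) \<and>
      (\<forall>x\<in>carrier (?F 0). \<delta> 0 (h 0 x) = g 0 (f 0 x) \<ominus>\<^bsub>?F 0\<^esub> x) \<and>
      (\<forall>p. \<forall>x\<in>carrier (?F (Suc p)). \<delta> (Suc p) (h (Suc p) x) =
         g (Suc p) (f (Suc p) x) \<ominus>\<^bsub>?F (Suc p)\<^esub> x \<ominus>\<^bsub>?F (Suc p)\<^esub> h p (\<delta> p x))"
      by (rule free_self_homotopy_exists[OF I resF, where t = "\<lambda>p x. g p (f p x)"])
        (auto simp: f(2,3) g(2,3) fc module_hom_comp[OF f(1) g(1)])
    then obtain h where h: "\<And>p. h p \<in> module_hom ?R (?F p) (?F (Suc p))"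
      and hS: "\<And>p x. x \<in> carrier (?F (Suc p)) \<Longrightarrow> \<delta> (Suc p) (h (Suc p) x) =
         g (Suc p) (f (Suc p) x) \<ominus>\<^bsub>?F (Suc p)\<^esub> x \<ominus>\<^bsub>?F (Suc p)\<^esub> h p (\<delta> p x)" by metis
    note hc = module_hom_closed[OF h]
    obtain d' where d': "d = Suc d'" using de by (cases d) auto
    let ?u = "unit_vec n 0 :: nat \<Rightarrow> 'k mpoly"
    have u: "?u \<in> carrier (?F (Suc d'))" using unit_vec_carrier[of 0 "r d"] top(1) d' by simp
    \<comment> \<open>The comparison map passes through the zero module here, as d exceeds the
      length e.\<close>
    have "f (Suc d') ?u = \<zero>\<^bsub>P (Suc d')\<^esub>" using fc[OF u] zero[of "Suc d'"] de d' by auto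
    then have gfz: "g (Suc d') (f (Suc d') ?u) = (\<lambda>_. 0)"
      using module_hom_zero[OF hP(1) hF(1) g(1)] by simp
    have du: "\<delta> d' ?u \<in> carrier (?F d')" by (rule module_hom_closed[OF hF(2) u])
    have "const_vec (h d' (\<delta> d' ?u)) = (\<lambda>_. 0)"
      by (rule hom_const_vec_zero[OF h du min[OF u]])
    moreover have "const_vec (\<delta> (Suc d') (h (Suc d') ?u)) = (\<lambda>_. 0)"
      by (rule min[OF hc[OF u]])
    moreover have "\<delta> (Suc d') (h (Suc d') ?u) = (\<lambda>s. 0 - ?u s - h d' (\<delta> d' ?u) s)"
    proof -
      have "(\<lambda>_. 0) \<ominus>\<^bsub>?F (Suc d')\<^esub> ?u = (\<lambda>s. 0 - ?u s)" by (rule free_mod_minus[OF free_mod_zero u])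
      then show ?thesis
        using hS[OF u] free_mod_minus[OF free_mod_diff[OF free_mod_zero u] hc[OF du]] gfz by simp
    qed
    \<comment> \<open>Both homotopy terms are gone, and what is left is minus a unit vector, whose
      coordinate 0 has constant coefficient -1.\<close>
    ultimately have "const_coeff (0 - ?u 0) = 0"
      by (simp add: const_vec_def fun_eq_iff const_coeff_diff)
    then show False using const_coeff_diff[of 0 "1 :: 'k mpoly"] by (simp add: unit_vector_def)
  qed
  then have "enat d \<le> proj_dim ?R ?M"
    unfolding proj_dim_def by (intro Inf_greatest) auto
  with upper show ?thesis by simp
qed

section \<open>The mapping cone\<close>

lemma free_hom_add:
  "f \<in> module_hom (mpoly_ring n) (free_mod n r) (free_mod n r') \<Longrightarrow> v \<in> carrier (free_mod n r)
    \<Longrightarrow> w \<in> carrier (free_mod n r) \<Longrightarrow> f (\<lambda>s. v s + w s) = (\<lambda>s. f v s + f w s)"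
  using module_hom_add[of f "mpoly_ring n" "free_mod n r" "free_mod n r'" v w] by simp

lemma free_hom_smult:
  "f \<in> module_hom (mpoly_ring n) (free_mod n r) (free_mod n r') \<Longrightarrow> a \<in> carrier (mpoly_ring n)
    \<Longrightarrow> v \<in> carrier (free_mod n r) \<Longrightarrow> f (\<lambda>s. a * v s) = (\<lambda>s. a * f v s)"
  using module_hom_smult[of f "mpoly_ring n" "free_mod n r" "free_mod n r'" a v] by simp

lemma free_hom_uminus:
  assumes "f \<in> module_hom (mpoly_ring n) (free_mod n r) (free_mod n r')"
    "(v :: nat \<Rightarrow> 'k::field mpoly) \<in> carrier (free_mod n r)"
  shows "f (\<lambda>s. - v s) = (\<lambda>s. - f v s)"
  using free_hom_smult[OF assms(1) mpoly_carrier_uminus[OF mpoly_carrier_one] assms(2)] by simp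

lemma free_hom_diff:
  assumes "f \<in> module_hom (mpoly_ring n) (free_mod n r) (free_mod n r')"
    "(v :: nat \<Rightarrow> 'k::field mpoly) \<in> carrier (free_mod n r)" "w \<in> carrier (free_mod n r)"
  shows "f (\<lambda>s. v s - w s) = (\<lambda>s. f v s - f w s)"
  using module_hom_minus[OF free_mod_module free_mod_module assms] assms
  by (simp add: free_mod_minus module_hom_closed[OF assms(1)])

lemma free_mod_uminus:
  "(v :: nat \<Rightarrow> 'k::field mpoly) \<in> carrier (free_mod n r) \<Longrightarrow> (\<lambda>s. - v s) \<in> carrier (free_mod n r)"
  by (simp add: free_module_carrier mpoly_carrier_uminus)

text \<open>Direct sums are encoded as consecutive blocks of coordinates. Outside its block the
  result is 0, so that it lies in the free module of rank r.\<close>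

definition vec_part :: "nat \<Rightarrow> nat \<Rightarrow> (nat \<Rightarrow> 'k::field mpoly) \<Rightarrow> nat \<Rightarrow> 'k mpoly" where
  "vec_part k r v = (\<lambda>s. if s < r then v (k + s) else 0)"

text \<open>Polymorphic because it joins degree functions as well as vectors. The last block runs on
  without a bound; for vectors of a free module \<open>c\<close> is 0 from its rank on.\<close>

definition vec_join :: "nat \<Rightarrow> nat \<Rightarrow> (nat \<Rightarrow> 'a) \<Rightarrow> (nat \<Rightarrow> 'a) \<Rightarrow> (nat \<Rightarrow> 'a) \<Rightarrow> nat \<Rightarrow> 'a" where
  "vec_join r1 r2 a b c = (\<lambda>s. if s < r1 then a s else if s < r1 + r2 then b (s - r1) else c (s - r1 - r2))"

lemma vec_part_carrier:
  "v \<in> carrier (free_mod n r') \<Longrightarrow> vec_part k r v \<in> carrier (free_mod n r)"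
  by (auto simp: vec_part_def free_mod_entry intro!: free_modI)

lemma vec_join_carrier:
  "a \<in> carrier (free_mod n r1) \<Longrightarrow> b \<in> carrier (free_mod n r2) \<Longrightarrow> c \<in> carrier (free_mod n r3)
    \<Longrightarrow> vec_join r1 r2 a b c \<in> carrier (free_mod n (r1 + r2 + r3))"
  by (rule free_modI) (auto simp: vec_join_def free_mod_entry free_mod_outside)

lemma vec_part_linear:
  "vec_part k r (\<lambda>s. v s + w s) = (\<lambda>s. vec_part k r v s + vec_part k r w s)"
  "vec_part k r (\<lambda>s. a * v s) = (\<lambda>s. a * vec_part k r v s)"
  by (auto simp: vec_part_def)

lemma vec_part_join:
  "a \<in> carrier (free_mod n r1) \<Longrightarrow> vec_part 0 r1 (vec_join r1 r2 a b c) = a"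
  "b \<in> carrier (free_mod n r2) \<Longrightarrow> vec_part r1 r2 (vec_join r1 r2 a b c) = b"
  "c \<in> carrier (free_mod n r3) \<Longrightarrow> vec_part (r1 + r2) r3 (vec_join r1 r2 a b c) = c"
  by (auto simp: vec_part_def vec_join_def fun_eq_iff free_mod_outside)

lemma vec_join_part:
  assumes "v \<in> carrier (free_mod n (r1 + r2 + r3))"
  shows "vec_join r1 r2 (vec_part 0 r1 v) (vec_part r1 r2 v) (vec_part (r1 + r2) r3 v) = v"
  using free_mod_outside[OF assms] by (auto simp: vec_part_def vec_join_def fun_eq_iff)

lemma vec_join_zero: "vec_join r1 r2 (\<lambda>_. 0) (\<lambda>_. 0) (\<lambda>_. 0) = (\<lambda>_. 0)"
  by (simp add: vec_join_def fun_eq_iff)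

lemma vec_join_eq_zero:
  assumes "vec_join r1 r2 a b c = (\<lambda>_. 0)" "a \<in> carrier (free_mod n r1)" "b \<in> carrier (free_mod n r2)"
    "c \<in> carrier (free_mod n r3)"
  shows "a = (\<lambda>_. 0)" "b = (\<lambda>_. 0)" "c = (\<lambda>_. 0)"
  using vec_part_join(1)[OF assms(2), of r2 b c] vec_part_join(2)[OF assms(3), of r1 a c]
    vec_part_join(3)[OF assms(4), of r1 r2 a b] assms(1) by (auto simp: vec_part_def fun_eq_iff)

lemma hom_vec_part:
  assumes "hom_vec (r1 + r2 + r3) (vec_join r1 r2 d1 d2 d3) d v"
  shows "hom_vec r1 d1 d (vec_part 0 r1 v)" "hom_vec r2 d2 d (vec_part r1 r2 v)"
    "hom_vec r3 d3 d (vec_part (r1 + r2) r3 v)"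
proof -
  have h: "homogeneous (d - vec_join r1 r2 d1 d2 d3 t) (v t)" if "t < r1 + r2 + r3" for t
    using assms that by (simp add: hom_vec_def)
  have "homogeneous (d - d1 t) (v t)" if "t < r1" for t
    using h[of t] that by (simp add: vec_join_def)
  then show "hom_vec r1 d1 d (vec_part 0 r1 v)" by (simp add: hom_vec_def vec_part_def)
  have "homogeneous (d - d2 t) (v (r1 + t))" if "t < r2" for t
    using h[of "r1 + t"] that by (simp add: vec_join_def)
  then show "hom_vec r2 d2 d (vec_part r1 r2 v)" by (simp add: hom_vec_def vec_part_def)
  have "homogeneous (d - d3 t) (v (r1 + r2 + t))" if "t < r3" for t
    using h[of "r1 + r2 + t"] that by (simp add: vec_join_def)
  then show "hom_vec r3 d3 d (vec_part (r1 + r2) r3 v)" by (simp add: hom_vec_def vec_part_def)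
qed

lemma hom_vec_join:
  assumes "hom_vec r1 d1 d a" "hom_vec r2 d2 d b" "hom_vec r3 d3 d c"
  shows "hom_vec (r1 + r2 + r3) (vec_join r1 r2 d1 d2 d3) d (vec_join r1 r2 a b c)"
  using assms by (auto simp: hom_vec_def vec_join_def)

lemma const_vec_join:
  "const_vec a = (\<lambda>_. 0) \<Longrightarrow> const_vec b = (\<lambda>_. 0) \<Longrightarrow> const_vec c = (\<lambda>_. 0)
    \<Longrightarrow> const_vec (vec_join r1 r2 a b c) = (\<lambda>_. 0)"
  by (simp add: const_vec_def vec_join_def fun_eq_iff)

lemma card_degree_add:
  "card {s. s < r1 + r2 \<and> (d :: nat \<Rightarrow> int) s = q} = card {s. s < r1 \<and> d s = q} + card {s. s < r2 \<and> d (r1 + s) = q}"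
proof -
  have "{s. s < r1 + r2 \<and> d s = q} = {s. s < r1 \<and> d s = q} \<union> (+) r1 ` {s. s < r2 \<and> d (r1 + s) = q}"
    by (auto simp: image_iff) (metis le_add_diff_inverse nat_add_left_cancel_less not_less)
  also have "card \<dots> = card {s. s < r1 \<and> d s = q} + card ((+) r1 ` {s. s < r2 \<and> d (r1 + s) = q})"
    by (rule card_Un_disjoint) auto
  finally show ?thesis by (simp add: card_image)
qed

lemma card_degree_join:
  "card {s. s < r1 + r2 + r3 \<and> vec_join r1 r2 d1 d2 d3 s = (q :: int)} =
    card {s. s < r1 \<and> d1 s = q} + card {s. s < r2 \<and> d2 s = q} + card {s. s < r3 \<and> d3 s = q}"
proof -
  have "{s. s < r1 \<and> vec_join r1 r2 d1 d2 d3 s = q} = {s. s < r1 \<and> d1 s = q}"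
    "{s. s < r2 \<and> vec_join r1 r2 d1 d2 d3 (r1 + s) = q} = {s. s < r2 \<and> d2 s = q}"
    "{s. s < r3 \<and> vec_join r1 r2 d1 d2 d3 (r1 + r2 + s) = q} = {s. s < r3 \<and> d3 s = q}"
    by (auto simp: vec_join_def)
  then show ?thesis by (simp add: card_degree_add)
qed

text \<open>The ideal \<open>J = x A + y z B\<close> sits in an exact sequence \<open>0 \<rightarrow> B \<rightarrow> A \<oplus> B \<rightarrow> J \<rightarrow> 0\<close> whose first map
  is \<open>c \<mapsto> (y z c, - x c)\<close>.  Lifting multiplication by \<open>z\<close> to a chain map \<open>\<phi>\<close> between minimal
  resolutions and keeping the factor \<open>y\<close> outside makes the cone minimal.\<close>

locale ideal_cone =
  fixes n :: nat and A B J :: "'k::field mpoly set"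
    and rF dF \<delta>F \<epsilon>F rG dG \<delta>G \<epsilon>G and x y z :: "'k mpoly" and e :: int
    and \<phi> :: "nat \<Rightarrow> (nat \<Rightarrow> 'k mpoly) \<Rightarrow> nat \<Rightarrow> 'k mpoly"
  assumes A: "ideal A (mpoly_ring n)" and B: "ideal B (mpoly_ring n)" and J: "ideal J (mpoly_ring n)"
    and F: "minimal_resolution n A rF dF \<delta>F \<epsilon>F" and G: "minimal_resolution n B rG dG \<delta>G \<epsilon>G"
    and carr: "x \<in> carrier (mpoly_ring n)" "y \<in> carrier (mpoly_ring n)" "z \<in> carrier (mpoly_ring n)"
    and deg: "homogeneous 1 x" "homogeneous 1 y" "homogeneous e z" and x0: "x \<noteq> 0"
    and zB: "\<And>b. b \<in> B \<Longrightarrow> z * b \<in> A"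
    and colon: "\<And>a b. a \<in> A \<Longrightarrow> b \<in> B \<Longrightarrow> x * a + y * z * b = 0 \<Longrightarrow> \<exists>g\<in>B. b = x * g"
    and J_eq: "J = {x * a + y * z * b | a b. a \<in> A \<and> b \<in> B}"
    and \<phi>: "\<And>p. \<phi> p \<in> graded_hom n (rG p) (\<lambda>s. dG p s + e) (rF p) (dF p)"
    and \<phi>0: "\<And>v. v \<in> carrier (free_mod n (rG 0)) \<Longrightarrow> \<epsilon>F (\<phi> 0 v) = z * \<epsilon>G v"
    and \<phi>S: "\<And>p v. v \<in> carrier (free_mod n (rG (Suc p))) \<Longrightarrow> \<delta>F p (\<phi> (Suc p) v) = \<phi> p (\<delta>G p v)"
begin

lemma F': "graded_free_resolution n A rF dF \<delta>F \<epsilon>F" and G': "graded_free_resolution n B rG dG \<delta>G \<epsilon>G"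
  using F G by (auto simp: minimal_resolution_def)

lemmas resF = graded_resD(1)[OF F'] and resG = graded_resD(1)[OF G']
lemmas homF = graded_homD[OF graded_resD(2)[OF F']] and homG = graded_homD[OF graded_resD(2)[OF G']]
lemmas augF = graded_resD(3)[OF F'] and augG = graded_resD(3)[OF G']
lemmas hom\<phi> = graded_homD[OF \<phi>]
lemmas cF = module_hom_closed[OF homF] and cG = module_hom_closed[OF homG] and c\<phi> = module_hom_closed[OF hom\<phi>]
lemmas ddF = resolution_dd[OF resF, simplified] and ddG = resolution_dd[OF resG, simplified]
lemmas augF0 = resolution_aug[OF resF, simplified] and augG0 = resolution_aug[OF resG, simplified]
lemmas eF = module_hom_closed[OF augF, simplified] and eG = module_hom_closed[OF augG, simplified]

lemma const_xy: "const_coeff x = 0" "const_coeff y = 0"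
  using homogeneous_const_coeff deg by force+

text \<open>Rank of the third block, the resolution of \<open>B\<close> moved up by one homological
  degree and hence absent in degree 0.\<close>

definition r3 where "r3 p = (case p of 0 \<Rightarrow> 0 | Suc p' \<Rightarrow> rG p')"

text \<open>The shift 2 + e is the degree of the product x y z: this block records the relations x
  (y z b) = y z (x b) between the two summands of \<open>J\<close>.\<close>

definition d3 where "d3 p s = (case p of 0 \<Rightarrow> 0 | Suc p' \<Rightarrow> dG p' s + 2 + e)"

definition shift where "shift p c = (case p of 0 \<Rightarrow> (\<lambda>_. 0) | Suc p' \<Rightarrow> (\<lambda>s. - \<delta>G p' c s))"

definition rC where "rC p = rF p + rG p + r3 p"

definition dC where "dC p = vec_join (rF p) (rG p) (\<lambda>s. dF p s + 1) (\<lambda>s. dG p s + 1 + e) (d3 p)"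

text \<open>On blocks (a, b, c) this is (\<delta>F a + y \<phi> c, \<delta>G b - x c, - \<delta>G
  c), the cone of the chain map sending c to (y \<phi> c, - x c). The minus sign in the third block
  makes the mixed terms cancel in the square.\<close>

definition \<delta>C where
  "\<delta>C p v = (let a = vec_part 0 (rF (Suc p)) v; b = vec_part (rF (Suc p)) (rG (Suc p)) v;
      c = vec_part (rF (Suc p) + rG (Suc p)) (rG p) v in
    vec_join (rF p) (rG p) (\<lambda>s. \<delta>F p a s + y * \<phi> p c s) (\<lambda>s. \<delta>G p b s - x * c s) (shift p c))"

definition \<epsilon>C where
  "\<epsilon>C v = x * \<epsilon>F (vec_part 0 (rF 0) v) + y * z * \<epsilon>G (vec_part (rF 0) (rG 0) v)"

lemma rC_Suc: "rC (Suc p) = rF (Suc p) + rG (Suc p) + rG p"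
  by (simp add: rC_def r3_def)

lemma rC_0: "rC 0 = rF 0 + rG 0 + 0"
  by (simp add: rC_def r3_def)

lemma shift_carrier: "c \<in> carrier (free_mod n (rG p)) \<Longrightarrow> shift p c \<in> carrier (free_mod n (r3 p))"
  by (cases p) (auto simp: shift_def r3_def cG free_mod_uminus)

lemma \<delta>C_join:
  assumes "a \<in> carrier (free_mod n (rF (Suc p)))" "b \<in> carrier (free_mod n (rG (Suc p)))"
    "c \<in> carrier (free_mod n (rG p))"
  shows "\<delta>C p (vec_join (rF (Suc p)) (rG (Suc p)) a b c) =
    vec_join (rF p) (rG p) (\<lambda>s. \<delta>F p a s + y * \<phi> p c s) (\<lambda>s. \<delta>G p b s - x * c s) (shift p c)"
  unfolding \<delta>C_def Let_def
  by (simp add: vec_part_join(1)[OF assms(1)] vec_part_join(2)[OF assms(2)] vec_part_join(3)[OF assms(3)])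

lemma split_Suc:
  assumes "v \<in> carrier (free_mod n (rC (Suc p)))"
  obtains a b c where "v = vec_join (rF (Suc p)) (rG (Suc p)) a b c"
    "a \<in> carrier (free_mod n (rF (Suc p)))" "b \<in> carrier (free_mod n (rG (Suc p)))"
    "c \<in> carrier (free_mod n (rG p))"
  using vec_join_part[OF assms[unfolded rC_Suc]] vec_part_carrier[OF assms] by metis

lemma comp_carrier:
  assumes "a \<in> carrier (free_mod n (rF (Suc p)))" "b \<in> carrier (free_mod n (rG (Suc p)))"
    "c \<in> carrier (free_mod n (rG p))"
  shows "(\<lambda>s. \<delta>F p a s + y * \<phi> p c s) \<in> carrier (free_mod n (rF p))"
    "(\<lambda>s. \<delta>G p b s - x * c s) \<in> carrier (free_mod n (rG p))"
  using assms carr by (auto intro!: free_mod_add free_mod_diff free_mod_smult cF cG c\<phi>)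

lemma \<delta>C_carrier:
  assumes "v \<in> carrier (free_mod n (rC (Suc p)))"
  shows "\<delta>C p v \<in> carrier (free_mod n (rC p))"
  unfolding \<delta>C_def Let_def rC_def
  by (intro vec_join_carrier comp_carrier[where b = "vec_part (rF (Suc p)) (rG (Suc p)) v"
        and a = "vec_part 0 (rF (Suc p)) v"] shift_carrier vec_part_carrier[OF assms])

lemma \<delta>C_hom: "\<delta>C p \<in> module_hom (mpoly_ring n) (free_mod n (rC (Suc p))) (free_mod n (rC p))"
proof -
  have add: "shift p (\<lambda>s. v s + w s) = (\<lambda>s. shift p v s + shift p w s)"
    if "v \<in> carrier (free_mod n (rG p))" "w \<in> carrier (free_mod n (rG p))" for v w
    using that by (cases p) (auto simp: shift_def free_hom_add[OF homG])
  have smult: "shift p (\<lambda>s. a * v s) = (\<lambda>s. a * shift p v s)"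
    if "a \<in> carrier (mpoly_ring n)" "v \<in> carrier (free_mod n (rG p))" for a v
    using that by (cases p) (auto simp: shift_def free_hom_smult[OF homG])
  note part = vec_part_carrier[of _ n "rC (Suc p)"]
  show ?thesis
    unfolding module_hom_def
  proof (intro CollectI conjI ballI Pi_I)
    fix v w :: "nat \<Rightarrow> 'k mpoly"
    assume v: "v \<in> carrier (free_mod n (rC (Suc p)))" and w: "w \<in> carrier (free_mod n (rC (Suc p)))"
    show "\<delta>C p (v \<oplus>\<^bsub>free_mod n (rC (Suc p))\<^esub> w) = \<delta>C p v \<oplus>\<^bsub>free_mod n (rC p)\<^esub> \<delta>C p w"
      unfolding \<delta>C_def Let_def
      by (simp add: vec_part_linear add part[OF v] part[OF w] free_hom_add[OF homF] free_hom_add[OF homG]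
          free_hom_add[OF hom\<phi>]) (auto simp: vec_join_def algebra_simps)
  next
    fix a :: "'k mpoly" and v :: "nat \<Rightarrow> 'k mpoly"
    assume a: "a \<in> carrier (mpoly_ring n)" and v: "v \<in> carrier (free_mod n (rC (Suc p)))"
    show "\<delta>C p (a \<odot>\<^bsub>free_mod n (rC (Suc p))\<^esub> v) = a \<odot>\<^bsub>free_mod n (rC p)\<^esub> \<delta>C p v"
      unfolding \<delta>C_def Let_def
      by (simp add: vec_part_linear smult[OF a] part[OF v] free_hom_smult[OF homF a] free_hom_smult[OF homG a]
          free_hom_smult[OF hom\<phi> a]) (auto simp: vec_join_def algebra_simps)
  qed (rule \<delta>C_carrier)
qed

lemma \<epsilon>C_hom: "\<epsilon>C \<in> module_hom (mpoly_ring n) (free_mod n (rC 0)) (ideal_module (mpoly_ring n) J)"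
proof -
  note part = vec_part_carrier[of _ n "rC 0"]
  note add = module_hom_add[OF augF, simplified] module_hom_add[OF augG, simplified]
  note smult = module_hom_smult[OF augF, simplified] module_hom_smult[OF augG, simplified]
  show ?thesis
    unfolding module_hom_def
  proof (intro CollectI conjI ballI Pi_I)
    fix v :: "nat \<Rightarrow> 'k mpoly"
    assume v: "v \<in> carrier (free_mod n (rC 0))"
    show "\<epsilon>C v \<in> carrier (ideal_module (mpoly_ring n) J)"
      unfolding \<epsilon>C_def J_eq using eF[OF part[OF v]] eG[OF part[OF v]] by auto
  next
    fix v w :: "nat \<Rightarrow> 'k mpoly"
    assume v: "v \<in> carrier (free_mod n (rC 0))" and w: "w \<in> carrier (free_mod n (rC 0))"
    show "\<epsilon>C (v \<oplus>\<^bsub>free_mod n (rC 0)\<^esub> w) = \<epsilon>C v \<oplus>\<^bsub>ideal_module (mpoly_ring n) J\<^esub> \<epsilon>C w"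
      unfolding \<epsilon>C_def by (simp add: vec_part_linear add part[OF v] part[OF w] algebra_simps)
  next
    fix a :: "'k mpoly" and v :: "nat \<Rightarrow> 'k mpoly"
    assume a: "a \<in> carrier (mpoly_ring n)" and v: "v \<in> carrier (free_mod n (rC 0))"
    show "\<epsilon>C (a \<odot>\<^bsub>free_mod n (rC 0)\<^esub> v) = a \<odot>\<^bsub>ideal_module (mpoly_ring n) J\<^esub> \<epsilon>C v"
      unfolding \<epsilon>C_def by (simp add: vec_part_linear smult a part[OF v] algebra_simps)
  qed
qed

lemma \<epsilon>C_join:
  assumes "a \<in> carrier (free_mod n (rF 0))" "b \<in> carrier (free_mod n (rG 0))"
  shows "\<epsilon>C (vec_join (rF 0) (rG 0) a b c) = x * \<epsilon>F a + y * z * \<epsilon>G b"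
  unfolding \<epsilon>C_def by (simp add: vec_part_join(1)[OF assms(1)] vec_part_join(2)[OF assms(2)])

lemma \<epsilon>C_onto: "\<epsilon>C ` carrier (free_mod n (rC 0)) = J"
proof
  show "\<epsilon>C ` carrier (free_mod n (rC 0)) \<subseteq> J"
    using module_hom_closed[OF \<epsilon>C_hom] by auto
  show "J \<subseteq> \<epsilon>C ` carrier (free_mod n (rC 0))"
  proof
    fix f assume "f \<in> J"
    then obtain a b where f: "f = x * a + y * z * b" "a \<in> A" "b \<in> B" unfolding J_eq by blast
    obtain a' where a': "a' \<in> carrier (free_mod n (rF 0))" "a = \<epsilon>F a'"
      using f(2) graded_resD(5)[OF F'] by (metis imageE)
    obtain b' where b': "b' \<in> carrier (free_mod n (rG 0))" "b = \<epsilon>G b'"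
      using f(3) graded_resD(5)[OF G'] by (metis imageE)
    have "vec_join (rF 0) (rG 0) a' b' (\<lambda>_. 0) \<in> carrier (free_mod n (rC 0))"
      unfolding rC_0 by (intro vec_join_carrier a' b' free_mod_zero)
    then show "f \<in> \<epsilon>C ` carrier (free_mod n (rC 0))"
      using \<epsilon>C_join[OF a'(1) b'(1), of "\<lambda>_. 0"] f(1) a'(2) b'(2) by (metis imageI)
  qed
qed

lemma exactF: "v \<in> carrier (free_mod n (rF (Suc p))) \<Longrightarrow> \<delta>F p v = (\<lambda>_. 0)
    \<Longrightarrow> \<exists>w\<in>carrier (free_mod n (rF (Suc (Suc p)))). v = \<delta>F (Suc p) w"
  using resolution_exact[OF resF, of "Suc p"] by (auto simp: kernel_at_def a_kernel_def')

lemma exactG: "v \<in> carrier (free_mod n (rG (Suc p))) \<Longrightarrow> \<delta>G p v = (\<lambda>_. 0)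
    \<Longrightarrow> \<exists>w\<in>carrier (free_mod n (rG (Suc (Suc p)))). v = \<delta>G (Suc p) w"
  using resolution_exact[OF resG, of "Suc p"] by (auto simp: kernel_at_def a_kernel_def')

lemma exactF0: "v \<in> carrier (free_mod n (rF 0)) \<Longrightarrow> \<epsilon>F v = 0
    \<Longrightarrow> \<exists>w\<in>carrier (free_mod n (rF (Suc 0))). v = \<delta>F 0 w"
  using resolution_exact[OF resF, of 0] by (auto simp: kernel_at_def a_kernel_def')

lemma exactG0: "v \<in> carrier (free_mod n (rG 0)) \<Longrightarrow> \<epsilon>G v = 0
    \<Longrightarrow> \<exists>w\<in>carrier (free_mod n (rG (Suc 0))). v = \<delta>G 0 w"
  using resolution_exact[OF resG, of 0] by (auto simp: kernel_at_def a_kernel_def')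

lemma aug_linear:
  "v \<in> carrier (free_mod n (rF 0)) \<Longrightarrow> w \<in> carrier (free_mod n (rF 0)) \<Longrightarrow> \<epsilon>F (\<lambda>s. v s + w s) = \<epsilon>F v + \<epsilon>F w"
  "v \<in> carrier (free_mod n (rG 0)) \<Longrightarrow> w \<in> carrier (free_mod n (rG 0)) \<Longrightarrow> \<epsilon>G (\<lambda>s. v s + w s) = \<epsilon>G v + \<epsilon>G w"
  "v \<in> carrier (free_mod n (rG 0)) \<Longrightarrow> w \<in> carrier (free_mod n (rG 0)) \<Longrightarrow> \<epsilon>G (\<lambda>s. v s - w s) = \<epsilon>G v - \<epsilon>G w"
  "u \<in> carrier (mpoly_ring n) \<Longrightarrow> v \<in> carrier (free_mod n (rF 0)) \<Longrightarrow> \<epsilon>F (\<lambda>s. u * v s) = u * \<epsilon>F v"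
  "u \<in> carrier (mpoly_ring n) \<Longrightarrow> v \<in> carrier (free_mod n (rG 0)) \<Longrightarrow> \<epsilon>G (\<lambda>s. u * v s) = u * \<epsilon>G v"
proof -
  note add = module_hom_add[OF augF, simplified] module_hom_add[OF augG, simplified]
  note smult = module_hom_smult[OF augF, simplified] module_hom_smult[OF augG, simplified]
  show "v \<in> carrier (free_mod n (rF 0)) \<Longrightarrow> w \<in> carrier (free_mod n (rF 0)) \<Longrightarrow> \<epsilon>F (\<lambda>s. v s + w s) = \<epsilon>F v + \<epsilon>F w"
    "v \<in> carrier (free_mod n (rG 0)) \<Longrightarrow> w \<in> carrier (free_mod n (rG 0)) \<Longrightarrow> \<epsilon>G (\<lambda>s. v s + w s) = \<epsilon>G v + \<epsilon>G w"
    "u \<in> carrier (mpoly_ring n) \<Longrightarrow> v \<in> carrier (free_mod n (rF 0)) \<Longrightarrow> \<epsilon>F (\<lambda>s. u * v s) = u * \<epsilon>F v"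
    "u \<in> carrier (mpoly_ring n) \<Longrightarrow> v \<in> carrier (free_mod n (rG 0)) \<Longrightarrow> \<epsilon>G (\<lambda>s. u * v s) = u * \<epsilon>G v"
    by (simp_all add: add smult)
  show "\<epsilon>G (\<lambda>s. v s - w s) = \<epsilon>G v - \<epsilon>G w"
    if "v \<in> carrier (free_mod n (rG 0))" "w \<in> carrier (free_mod n (rG 0))"
    using add(2)[OF free_mod_diff[OF that] that(2)] by simp
qed

text \<open>In the first block y \<delta>F \<phi> c cancels against - y \<phi> \<delta>G c since
  \<phi> is a chain map; in the second, - x \<delta>G c cancels against x \<delta>G c.\<close>

lemma \<delta>C_\<delta>C:
  assumes "v \<in> carrier (free_mod n (rC (Suc (Suc p))))"
  shows "\<delta>C p (\<delta>C (Suc p) v) = (\<lambda>_. 0)"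
proof -
  obtain a b c where v: "v = vec_join (rF (Suc (Suc p))) (rG (Suc (Suc p))) a b c"
    "a \<in> carrier (free_mod n (rF (Suc (Suc p))))" "b \<in> carrier (free_mod n (rG (Suc (Suc p))))"
    "c \<in> carrier (free_mod n (rG (Suc p)))"
    using assms by (rule split_Suc)
  note [simp] = free_mod_smult carr c\<phi> cF cG v
  have "shift (Suc p) c = (\<lambda>s. - \<delta>G p c s)" by (simp add: shift_def)
  moreover have "shift p (\<lambda>s. - \<delta>G p c s) = (\<lambda>_. 0)"
  proof (cases p)
    case (Suc p')
    then show ?thesis
      using ddG[of c p'] cG[of c p] v(4) by (simp add: shift_def free_hom_uminus[OF homG])
  qed (simp add: shift_def)
  ultimately have "\<delta>C p (\<delta>C (Suc p) v) = vec_join (rF p) (rG p)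
     (\<lambda>s. \<delta>F p (\<lambda>s. \<delta>F (Suc p) a s + y * \<phi> (Suc p) c s) s + y * \<phi> p (\<lambda>s. - \<delta>G p c s) s)
     (\<lambda>s. \<delta>G p (\<lambda>s. \<delta>G (Suc p) b s - x * c s) s - x * - \<delta>G p c s) (\<lambda>_. 0)"
    using \<delta>C_join[OF comp_carrier[OF v(2-4)] free_mod_uminus[OF cG[OF v(4)]]]
    by (simp add: \<delta>C_join[OF v(2-4)])
  also have "\<dots> = vec_join (rF p) (rG p) (\<lambda>_. 0) (\<lambda>_. 0) (\<lambda>_. 0)"
    by (simp add: free_hom_add[OF homF] free_hom_diff[OF homG] free_hom_smult[OF homF]
        free_hom_smult[OF homG] free_hom_uminus[OF hom\<phi>] ddF ddG \<phi>S)
  finally show ?thesis by (simp add: vec_join_zero)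
qed

lemma \<epsilon>C_\<delta>C:
  assumes "v \<in> carrier (free_mod n (rC (Suc 0)))"
  shows "\<epsilon>C (\<delta>C 0 v) = 0"
proof -
  obtain a b c where v: "v = vec_join (rF (Suc 0)) (rG (Suc 0)) a b c"
    "a \<in> carrier (free_mod n (rF (Suc 0)))" "b \<in> carrier (free_mod n (rG (Suc 0)))"
    "c \<in> carrier (free_mod n (rG 0))"
    using assms by (rule split_Suc)
  have "\<epsilon>C (\<delta>C 0 v) = x * \<epsilon>F (\<lambda>s. \<delta>F 0 a s + y * \<phi> 0 c s) + y * z * \<epsilon>G (\<lambda>s. \<delta>G 0 b s - x * c s)"
    using v comp_carrier[OF v(2-4)] by (simp add: \<delta>C_join \<epsilon>C_join)
  also have "\<dots> = 0"
    using v carr by (simp add: aug_linear free_mod_smult cF cG c\<phi> augF0 augG0 \<phi>0)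
  finally show ?thesis .
qed

text \<open>For a cycle (a, b, c), the entry c is a boundary \<delta>G c'. Adding the image of (0,
  0, c') clears the third block, after which the first two blocks are cycles, hence boundaries, of
  the given resolutions. This gives the preimage (a', b', - c').\<close>

lemma \<delta>C_exact:
  assumes v: "v \<in> carrier (free_mod n (rC (Suc p)))" and k: "\<delta>C p v = (\<lambda>_. 0)"
  shows "v \<in> \<delta>C (Suc p) ` carrier (free_mod n (rC (Suc (Suc p))))"
proof -
  obtain a b c where abc: "v = vec_join (rF (Suc p)) (rG (Suc p)) a b c"
    "a \<in> carrier (free_mod n (rF (Suc p)))" "b \<in> carrier (free_mod n (rG (Suc p)))"
    "c \<in> carrier (free_mod n (rG p))"
    using v by (rule split_Suc)
  have join: "vec_join (rF p) (rG p) (\<lambda>s. \<delta>F p a s + y * \<phi> p c s) (\<lambda>s. \<delta>G p b s - x * c s) (shift p c) = (\<lambda>_. 0)"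
    using k \<delta>C_join[OF abc(2-4)] abc(1) by simp
  note zero = vec_join_eq_zero[OF join comp_carrier[OF abc(2-4)] shift_carrier[OF abc(4)]]
  have xc: "\<delta>G p b = (\<lambda>s. x * c s)" and ya: "\<delta>F p a = (\<lambda>s. - (y * \<phi> p c s))"
    using zero(1,2) by (simp_all add: fun_eq_iff eq_neg_iff_add_eq_0)
  have "\<exists>c'\<in>carrier (free_mod n (rG (Suc p))). c = \<delta>G p c'"
  proof (cases p)
    \<comment> \<open>In the lowest degree there is no third block to show that c is a cycle.
      Instead x times its augmentation equals the augmentation of \<delta>G b, which is 0, and the
      nonzero x cancels.\<close>
    case 0
    have c0: "c \<in> carrier (free_mod n (rG 0))" and b0: "b \<in> carrier (free_mod n (rG (Suc 0)))"
      using abc 0 by simp_all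
    have "x * \<epsilon>G c = \<epsilon>G (\<delta>G 0 b)" using aug_linear(5)[OF carr(1) c0] xc 0 by simp
    then have "\<epsilon>G c = 0" using augG0[OF b0] x0 by simp
    then show ?thesis using exactG0[OF c0] 0 by simp
  next
    case (Suc p')
    have "\<delta>G p' c = (\<lambda>_. 0)" using zero(3) Suc by (simp add: shift_def fun_eq_iff)
    then show ?thesis using exactG[of c p'] abc(4) Suc by simp
  qed
  then obtain c' where c': "c' \<in> carrier (free_mod n (rG (Suc p)))" "c = \<delta>G p c'" by (elim bexE) (rule that)
  have ker: "\<delta>G p (\<lambda>s. b s - x * c' s) = (\<lambda>_. 0)"
    by (simp add: free_hom_diff[OF homG abc(3) free_mod_smult[OF carr(1) c'(1)]]
        free_hom_smult[OF homG carr(1) c'(1)] xc c'(2))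
  then obtain b' where b': "b' \<in> carrier (free_mod n (rG (Suc (Suc p))))" "(\<lambda>s. b s - x * c' s) = \<delta>G (Suc p) b'"
    using exactG[OF free_mod_diff[OF abc(3) free_mod_smult[OF carr(1) c'(1)]] ker] by (elim bexE) (rule that)
  have yc: "(\<lambda>s. y * \<phi> (Suc p) c' s) \<in> carrier (free_mod n (rF (Suc p)))"
    by (rule free_mod_smult[OF carr(2) c\<phi>[OF c'(1)]])
  have ker: "\<delta>F p (\<lambda>s. a s + y * \<phi> (Suc p) c' s) = (\<lambda>_. 0)"
    by (simp add: free_hom_add[OF homF abc(2) yc] free_hom_smult[OF homF carr(2) c\<phi>[OF c'(1)]] ya c'(2) \<phi>S[OF c'(1)])
  then obtain a' where a': "a' \<in> carrier (free_mod n (rF (Suc (Suc p))))" "(\<lambda>s. a s + y * \<phi> (Suc p) c' s) = \<delta>F (Suc p) a'"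
    using exactF[OF free_mod_add[OF abc(2) yc] ker] by (elim bexE) (rule that)
  note um = free_mod_uminus[OF c'(1)]
  let ?w = "vec_join (rF (Suc (Suc p))) (rG (Suc (Suc p))) a' b' (\<lambda>s. - c' s)"
  have "?w \<in> carrier (free_mod n (rC (Suc (Suc p))))"
    unfolding rC_Suc by (intro vec_join_carrier a' b' um)
  moreover have "\<delta>C (Suc p) ?w = v"
    by (simp add: \<delta>C_join[OF a'(1) b'(1) um] a'(2)[symmetric] b'(2)[symmetric] abc(1) shift_def
        free_hom_uminus[OF homG c'(1)] free_hom_uminus[OF hom\<phi> c'(1)] c'(2)[symmetric])
  ultimately show ?thesis by (metis imageI)
qed

text \<open>By \<open>colon\<close> the augmentation of b is x g with g in \<open>B\<close>. If c
  lifts g, adding the image of (0, 0, c) makes the augmentations of both blocks vanish, where the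
  first one requires cancelling x; exactness of the given resolutions then applies.\<close>

lemma \<epsilon>C_exact:
  assumes v: "v \<in> carrier (free_mod n (rC 0))" and k: "\<epsilon>C v = 0"
  shows "v \<in> \<delta>C 0 ` carrier (free_mod n (rC (Suc 0)))"
proof -
  define a where "a = vec_part 0 (rF 0) v"
  define b where "b = vec_part (rF 0) (rG 0) v"
  have a: "a \<in> carrier (free_mod n (rF 0))" and b: "b \<in> carrier (free_mod n (rG 0))"
    unfolding a_def b_def by (rule vec_part_carrier[OF v])+
  have v_eq: "v = vec_join (rF 0) (rG 0) a b (\<lambda>_. 0)"
    using vec_join_part[OF v[unfolded rC_0]] by (simp add: a_def b_def vec_part_def)
  have k': "x * \<epsilon>F a + y * z * \<epsilon>G b = 0" using k by (simp add: \<epsilon>C_def a_def b_def)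
  obtain g where g: "g \<in> B" "\<epsilon>G b = x * g" using colon[OF eF[OF a] eG[OF b] k'] by (elim bexE) (rule that)
  obtain c where c: "c \<in> carrier (free_mod n (rG 0))" "g = \<epsilon>G c"
    using g(1) graded_resD(5)[OF G'] by (metis imageE)
  have ker: "\<epsilon>G (\<lambda>s. b s - x * c s) = 0"
    using a b c g carr by (simp add: aug_linear free_mod_smult)
  then obtain b' where b': "b' \<in> carrier (free_mod n (rG (Suc 0)))" "(\<lambda>s. b s - x * c s) = \<delta>G 0 b'"
    using exactG0[OF free_mod_diff[OF b free_mod_smult[OF carr(1) c(1)]] ker] by (elim bexE) (rule that)
  have yc: "(\<lambda>s. y * \<phi> 0 c s) \<in> carrier (free_mod n (rF 0))"
    by (rule free_mod_smult[OF carr(2) c\<phi>[OF c(1)]])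
  have "x * (\<epsilon>F a + y * z * \<epsilon>G c) = 0" using k' g c(2) by (simp add: algebra_simps)
  then have "\<epsilon>F a + y * z * \<epsilon>G c = 0" using x0 by simp
  then have ker: "\<epsilon>F (\<lambda>s. a s + y * \<phi> 0 c s) = 0"
    using a c carr yc by (simp add: aug_linear c\<phi> \<phi>0 mult.assoc)
  then obtain a' where a': "a' \<in> carrier (free_mod n (rF (Suc 0)))" "(\<lambda>s. a s + y * \<phi> 0 c s) = \<delta>F 0 a'"
    using exactF0[OF free_mod_add[OF a yc] ker] by (elim bexE) (rule that)
  note um = free_mod_uminus[OF c(1)]
  let ?w = "vec_join (rF (Suc 0)) (rG (Suc 0)) a' b' (\<lambda>s. - c s)"
  have "?w \<in> carrier (free_mod n (rC (Suc 0)))"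
    unfolding rC_Suc by (intro vec_join_carrier a' b' um)
  moreover have "\<delta>C 0 ?w = v"
    by (simp add: \<delta>C_join[OF a'(1) b'(1) um] a'(2)[symmetric] b'(2)[symmetric] v_eq shift_def
        free_hom_uminus[OF hom\<phi> c(1)])
  ultimately show ?thesis by (metis imageI)
qed

lemma cone_resolution:
  "resolution (mpoly_ring n) (ideal_module (mpoly_ring n) J) (\<lambda>p. free_mod n (rC p)) \<delta>C \<epsilon>C"
proof -
  have "\<delta>C 0 ` carrier (free_mod n (rC 1)) =
      a_kernel (free_mod n (rC 0)) (ideal_module (mpoly_ring n) J) \<epsilon>C"
    using \<epsilon>C_exact \<epsilon>C_\<delta>C \<delta>C_carrier[of _ 0] by (auto simp: a_kernel_def')
  moreover have "\<delta>C (Suc p) ` carrier (free_mod n (rC (Suc (Suc p)))) =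
      a_kernel (free_mod n (rC (Suc p))) (free_mod n (rC p)) (\<delta>C p)" for p
    using \<delta>C_exact[of _ p] \<delta>C_\<delta>C[of _ p] \<delta>C_carrier[of _ "Suc p"] by (auto simp: a_kernel_def')
  ultimately show ?thesis
    by (simp add: resolution_def free_mod_module \<delta>C_hom \<epsilon>C_hom \<epsilon>C_onto)
qed

lemma hom_vec_smult:
  assumes "homogeneous k u" "hom_vec r d (j - k) v"
  shows "hom_vec r d j (\<lambda>s. u * v s)"
  using assms by (auto simp: hom_vec_def intro!: homogeneous_mult[OF assms(1)])

lemma hom_vec_shift: "hom_vec r (\<lambda>s. d s + k) j v \<longleftrightarrow> hom_vec r d (j - k) v"
  by (simp add: hom_vec_def diff_diff_eq add.commute)

lemma cone_graded: "graded_free_resolution n J rC dC \<delta>C \<epsilon>C"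
proof -
  have "hom_vec (rC p) (dC p) d (\<delta>C p v)"
    if v: "v \<in> carrier (free_mod n (rC (Suc p)))" "hom_vec (rC (Suc p)) (dC (Suc p)) d v" for p d v
  proof -
    define a where "a = vec_part 0 (rF (Suc p)) v"
    define b where "b = vec_part (rF (Suc p)) (rG (Suc p)) v"
    define c where "c = vec_part (rF (Suc p) + rG (Suc p)) (rG p) v"
    have abc: "a \<in> carrier (free_mod n (rF (Suc p)))" "b \<in> carrier (free_mod n (rG (Suc p)))"
      "c \<in> carrier (free_mod n (rG p))"
      unfolding a_def b_def c_def by (rule vec_part_carrier[OF v(1)])+
    have d3: "d3 (Suc p) = (\<lambda>s. dG p s + (2 + e))" by (simp add: d3_def fun_eq_iff)
    note parts = hom_vec_part[OF v(2)[unfolded rC_Suc dC_def], folded a_def b_def c_def]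
    have ha: "hom_vec (rF (Suc p)) (dF (Suc p)) (d - 1) a" using parts(1) by (simp add: hom_vec_shift)
    have hb: "hom_vec (rG (Suc p)) (dG (Suc p)) (d - 1 - e) b"
      using parts(2) by (simp add: hom_vec_def algebra_simps)
    have hc: "hom_vec (rG p) (dG p) (d - 2 - e) c"
      using parts(3) unfolding d3 hom_vec_shift by (simp add: diff_diff_eq)
    have hc': "hom_vec (rG p) (\<lambda>s. dG p s + e) (d - 1 - 1) c" using hc by (simp add: hom_vec_shift)
    have 1: "hom_vec (rF p) (\<lambda>s. dF p s + 1) d (\<lambda>s. \<delta>F p a s + y * \<phi> p c s)"
      using graded_hom_vec[OF graded_resD(2)[OF F'] abc(1) ha]
        hom_vec_smult[OF deg(2) graded_hom_vec[OF \<phi> abc(3) hc']]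
      by (simp add: hom_vec_shift) (simp add: hom_vec_def homogeneous_add)
    have hc'': "hom_vec (rG p) (dG p) (d - 1 - e - 1) c" using hc by (simp add: algebra_simps)
    have 2: "hom_vec (rG p) (\<lambda>s. dG p s + 1 + e) d (\<lambda>s. \<delta>G p b s - x * c s)"
      using graded_hom_vec[OF graded_resD(2)[OF G'] abc(2) hb] hom_vec_smult[OF deg(1) hc'']
      by (simp add: hom_vec_def homogeneous_diff algebra_simps)
    have 3: "hom_vec (r3 p) (d3 p) d (shift p c)"
    proof (cases p)
      case 0
      then show ?thesis by (simp add: hom_vec_def r3_def)
    next
      case (Suc p')
      then have "hom_vec (rG p') (dG p') (d - 2 - e) (\<delta>G p' c)"
        using graded_hom_vec[OF graded_resD(2)[OF G', of p'], of c] abc(3) hc by simp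
      then show ?thesis
        using Suc by (simp add: hom_vec_def r3_def d3_def shift_def homogeneous_uminus algebra_simps)
    qed
    show ?thesis
      unfolding rC_def dC_def \<delta>C_def Let_def a_def[symmetric] b_def[symmetric] c_def[symmetric]
      by (rule hom_vec_join[OF 1 2 3])
  qed
  from this[OF unit_vec_carrier hom_vec_unit]
  have "homogeneous (dC (Suc p) s - dC p t) (\<delta>C p (unit_vec n s) t)" if "s < rC (Suc p)" "t < rC p" for p s t
    using that by (simp add: hom_vec_def)
  moreover have "homogeneous (dC 0 s) (\<epsilon>C (unit_vec n s))" if s: "s < rC 0" for s
  proof -
    note parts = hom_vec_part[OF hom_vec_unit[OF s, where dg = "dC 0" and n = n, unfolded rC_def dC_def]]
    let ?a = "vec_part 0 (rF 0) (unit_vec n s) :: nat \<Rightarrow> 'k mpoly"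
    let ?b = "vec_part (rF 0) (rG 0) (unit_vec n s) :: nat \<Rightarrow> 'k mpoly"
    have ab: "?a \<in> carrier (free_mod n (rF 0))" "?b \<in> carrier (free_mod n (rG 0))"
      by (rule vec_part_carrier[OF unit_vec_carrier[OF s]])+
    have aug: "homogeneous d (f v)"
      if f: "f \<in> module_hom (mpoly_ring n) (free_mod n r) (ideal_module (mpoly_ring n) I)"
        and I: "ideal I (mpoly_ring n)" and v: "v \<in> carrier (free_mod n r)" "hom_vec r dg d v"
        and h: "\<And>s. s < r \<Longrightarrow> homogeneous (dg s) (f (unit_vec n s))" for f r I v dg d
      using graded_functional_comp[OF f ideal_mpoly_subset[OF I] v(1), of dg 0 d] h
        homogeneous_hom_comp[of d "f v"] by (simp add: vec_comp_hom_vec[OF v])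
    have a: "hom_vec (rF 0) (dF 0) (dC 0 s - 1) ?a"
      using parts(1) unfolding dC_def[symmetric] by (simp add: hom_vec_shift)
    have b: "hom_vec (rG 0) (dG 0) (dC 0 s - 1 - e) ?b"
      using parts(2) unfolding dC_def[symmetric] by (simp add: hom_vec_def algebra_simps)
    have ea: "homogeneous (dC 0 s - 1) (\<epsilon>F ?a)"
      by (rule aug[OF augF A ab(1) a graded_resD(4)[OF F']])
    have eb: "homogeneous (dC 0 s - 1 - e) (\<epsilon>G ?b)"
      by (rule aug[OF augG B ab(2) b graded_resD(4)[OF G']])
    show ?thesis
      unfolding \<epsilon>C_def
      by (intro homogeneous_add homogeneous_mult[OF deg(1) ea]
          homogeneous_mult[OF homogeneous_mult[OF deg(2,3) refl] eb]) simp_all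
  qed
  ultimately show ?thesis
    using cone_resolution by (simp add: graded_free_resolution_def)
qed

text \<open>The chain map \<phi> may have constant entries, for example when z is 1 and the two
  ideals agree; the factors x and y outside it have constant coefficient 0 and keep the new matrix
  entries in the maximal ideal.\<close>

lemma cone_minimal: "minimal_resolution n J rC dC \<delta>C \<epsilon>C"
proof -
  have minF: "const_vec (\<delta>F p v) = (\<lambda>_. 0)" if "v \<in> carrier (free_mod n (rF (Suc p)))" for p v
    using F that by (simp add: minimal_resolution_def)
  have minG: "const_vec (\<delta>G p v) = (\<lambda>_. 0)" if "v \<in> carrier (free_mod n (rG (Suc p)))" for p v
    using G that by (simp add: minimal_resolution_def)
  have "const_vec (\<delta>C p v) = (\<lambda>_. 0)" if v: "v \<in> carrier (free_mod n (rC (Suc p)))" for p v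
  proof -
    note part = vec_part_carrier[OF v]
    have neg: "const_coeff (- f) = - const_coeff f" for f :: "'k mpoly"
      using const_coeff_diff[of 0 f] by simp
    have "const_vec (shift p c) = (\<lambda>_. 0)" if c: "c \<in> carrier (free_mod n (rG p))" for c
    proof (cases p)
      case (Suc p')
      then show ?thesis
        using minG[of c p'] c by (simp add: shift_def const_vec_def fun_eq_iff neg)
    qed (simp add: shift_def const_vec_def)
    then show ?thesis
      unfolding \<delta>C_def Let_def using minF[OF part] minG[OF part] part
      by (intro const_vec_join)
        (simp_all add: const_vec_def fun_eq_iff const_coeff_add const_coeff_diff const_coeff_mult const_xy)
  qed
  then show ?thesis using cone_graded by (simp add: minimal_resolution_def)
qed

lemma cone_card:
  "card {s. s < rC p \<and> dC p s = q} = card {s. s < rF p \<and> dF p s = q - 1} +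
    card {s. s < rG p \<and> dG p s = q - 1 - e} +
    (case p of 0 \<Rightarrow> 0 | Suc p' \<Rightarrow> card {s. s < rG p' \<and> dG p' s = q - 2 - e})"
proof -
  have "{s. s < rF p \<and> dF p s + 1 = q} = {s. s < rF p \<and> dF p s = q - 1}"
    "{s. s < rG p \<and> dG p s + 1 + e = q} = {s. s < rG p \<and> dG p s = q - 1 - e}" by auto
  moreover have "card {s. s < r3 p \<and> d3 p s = q} =
      (case p of 0 \<Rightarrow> 0 | Suc p' \<Rightarrow> card {s. s < rG p' \<and> dG p' s = q - 2 - e})"
    by (cases p) (auto simp: r3_def d3_def intro!: arg_cong[where f = card])
  ultimately show ?thesis by (simp add: rC_def dC_def card_degree_join)
qed

end

text \<open>Supplies the chain map \<phi> that the locale takes as given, by lifting multiplication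
  by z, and forgets the explicit cone except for its count of generators by degree.\<close>

lemma minimal_resolution_cone:
  fixes x y z :: "'k::field mpoly"
  assumes A: "ideal A (mpoly_ring n)" and B: "ideal B (mpoly_ring n)" and J: "ideal J (mpoly_ring n)"
    and F: "minimal_resolution n A rF dF \<delta>F \<epsilon>F" and G: "minimal_resolution n B rG dG \<delta>G \<epsilon>G"
    and carr: "x \<in> carrier (mpoly_ring n)" "y \<in> carrier (mpoly_ring n)" "z \<in> carrier (mpoly_ring n)"
    and deg: "homogeneous 1 x" "homogeneous 1 y" "homogeneous e z" and x0: "x \<noteq> 0"
    and zB: "\<And>b. b \<in> B \<Longrightarrow> z * b \<in> A"
    and colon: "\<And>a b. a \<in> A \<Longrightarrow> b \<in> B \<Longrightarrow> x * a + y * z * b = 0 \<Longrightarrow> \<exists>g\<in>B. b = x * g"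
    and J_eq: "J = {x * a + y * z * b | a b. a \<in> A \<and> b \<in> B}"
  shows "\<exists>r dg \<delta> \<epsilon>. minimal_resolution n J r dg \<delta> \<epsilon> \<and>
    (\<forall>p q. card {s. s < r p \<and> dg p s = q} = card {s. s < rF p \<and> dF p s = q - 1} +
      card {s. s < rG p \<and> dG p s = q - 1 - e} +
      (case p of 0 \<Rightarrow> 0 | Suc p' \<Rightarrow> card {s. s < rG p' \<and> dG p' s = q - 2 - e}))"
proof -
  have F': "graded_free_resolution n A rF dF \<delta>F \<epsilon>F" and G': "graded_free_resolution n B rG dG \<delta>G \<epsilon>G"
    using F G by (auto simp: minimal_resolution_def)
  \<comment> \<open>Raising all degrees of the resolution of \<open>B\<close> by e keeps its
    differentials graded and makes multiplication by z, which has degree e, preserve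
    degrees.\<close>
  have \<delta>: "\<delta>G p \<in> graded_hom n (rG (Suc p)) (\<lambda>s. dG (Suc p) s + e) (rG p) (\<lambda>s. dG p s + e)" for p
    using graded_resD(2)[OF G', of p] by (simp add: graded_hom_def hom_vec_def)
  note hG = graded_resD(3)[OF G']
  have a: "(\<lambda>v. z * \<epsilon>G v) \<in> module_hom (mpoly_ring n) (free_mod n (rG 0)) (ideal_module (mpoly_ring n) A)"
    using module_hom_closed[OF hG] module_hom_add[OF hG] module_hom_smult[OF hG] zB
    by (auto simp: module_hom_def distrib_left mult.left_commute)
  have "\<exists>\<phi>. (\<forall>p. \<phi> p \<in> graded_hom n (rG p) (\<lambda>s. dG p s + e) (rF p) (dF p)) \<and>
    (\<forall>x\<in>carrier (free_mod n (rG 0)). \<epsilon>F (\<phi> 0 x) = z * \<epsilon>G x) \<and>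
    (\<forall>p. \<forall>x\<in>carrier (free_mod n (rG (Suc p))). \<delta>F p (\<phi> (Suc p) x) = \<phi> p (\<delta>G p x))"
  proof (rule graded_chain_map_exists[OF A F' \<delta> _ a])
    show "\<delta>G p (\<delta>G (Suc p) x) = (\<lambda>_. 0)" if "x \<in> carrier (free_mod n (rG (Suc (Suc p))))" for p x
      using resolution_dd[OF graded_resD(1)[OF G'] that] by simp
    show "homogeneous (dG 0 s + e) (z * \<epsilon>G (unit_vec n s))" if "s < rG 0" for s
      using homogeneous_mult[OF deg(3) graded_resD(4)[OF G' that], of "dG 0 s + e"] by simp
    show "z * \<epsilon>G (\<delta>G 0 x) = 0" if "x \<in> carrier (free_mod n (rG (Suc 0)))" for x
      using resolution_aug[OF graded_resD(1)[OF G'] that] by simp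
  qed
  then obtain \<phi> where \<phi>: "\<forall>p. \<phi> p \<in> graded_hom n (rG p) (\<lambda>s. dG p s + e) (rF p) (dF p)"
    "\<forall>x\<in>carrier (free_mod n (rG 0)). \<epsilon>F (\<phi> 0 x) = z * \<epsilon>G x"
    "\<forall>p. \<forall>x\<in>carrier (free_mod n (rG (Suc p))). \<delta>F p (\<phi> (Suc p) x) = \<phi> p (\<delta>G p x)"
    by (elim exE conjE) (rule that)
  interpret ideal_cone n A B J rF dF \<delta>F \<epsilon>F rG dG \<delta>G \<epsilon>G x y z e \<phi>
    by (rule ideal_cone.intro; (fact assms | simp add: \<phi>))
  show ?thesis using cone_minimal cone_card by blast
qed

section \<open>Vertex cover ideals of paths\<close>

lemma mpoly_idealI:
  assumes "I \<subseteq> carrier (mpoly_ring n)" "0 \<in> I" "\<And>f g. f \<in> I \<Longrightarrow> g \<in> I \<Longrightarrow> f + g \<in> I"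
    "\<And>f g. f \<in> carrier (mpoly_ring n) \<Longrightarrow> g \<in> I \<Longrightarrow> f * g \<in> I"
  shows "ideal I (mpoly_ring n :: 'k::field mpoly ring)"
proof (rule idealI)
  interpret R: cring "mpoly_ring n :: 'k mpoly ring" by (rule cring_mpoly_ring)
  show "ring (mpoly_ring n :: 'k mpoly ring)" by (rule R.ring_axioms)
  have "\<ominus>\<^bsub>mpoly_ring n\<^esub> f \<in> I" if "f \<in> I" for f
  proof -
    have "- f \<in> I" using assms(4)[OF mpoly_carrier_uminus[OF mpoly_carrier_one] that] by simp
    moreover have "\<ominus>\<^bsub>mpoly_ring n\<^esub> f = - f"
      using assms(1) that by (intro R.minus_equality) (auto intro: mpoly_carrier_uminus)
    ultimately show ?thesis by simp
  qed
  then show "subgroup I (add_monoid (mpoly_ring n))"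
    using assms(1-3) by (intro R.add.subgroupI) (auto simp: a_inv_def)
  show "x \<otimes>\<^bsub>mpoly_ring n\<^esub> a \<in> I" "a \<otimes>\<^bsub>mpoly_ring n\<^esub> x \<in> I"
    if "a \<in> I" "x \<in> carrier (mpoly_ring n)" for a x
    using assms(4)[OF that(2,1)] by (simp_all add: mult.commute)
qed

definition covers_path :: "nat \<Rightarrow> (nat \<Rightarrow>\<^sub>0 nat) \<Rightarrow> bool" where
  "covers_path m k \<longleftrightarrow>
    (\<forall>a. 1 \<le> a \<and> a < m \<longrightarrow> Poly_Mapping.lookup k a \<noteq> 0 \<or> Poly_Mapping.lookup k (Suc a) \<noteq> 0)"

text \<open>The vertex cover ideal of the path on m vertices inside the ring in n variables,
  described by the exponent vectors allowed in its elements. Membership can thus be tested term by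
  term, and for m \<le> 1 the condition is empty.\<close>

definition path_ideal :: "nat \<Rightarrow> nat \<Rightarrow> 'k::field mpoly set" where
  "path_ideal n m = {f \<in> carrier (mpoly_ring n). \<forall>k\<in>Poly_Mapping.keys f. covers_path m k}"

lemma path_ideal_add: "f \<in> path_ideal n m \<Longrightarrow> g \<in> path_ideal n m \<Longrightarrow> f + g \<in> path_ideal n m"
  using Poly_Mapping.keys_add[of f g] by (auto simp: path_ideal_def mpoly_carrier_add)

lemma covers_path_add: "covers_path m k \<Longrightarrow> covers_path m (l + k)"
  by (auto simp: covers_path_def lookup_add)

lemma sum_memI:
  fixes f :: "'a \<Rightarrow> 'b::comm_monoid_add"
  assumes "0 \<in> A" "\<And>x y. x \<in> A \<Longrightarrow> y \<in> A \<Longrightarrow> x + y \<in> A" "\<And>s. s \<in> X \<Longrightarrow> f s \<in> A"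
  shows "sum f X \<in> A"
  using assms by (induction X rule: infinite_finite_induct) auto

lemma path_ideal_mult:
  assumes "f \<in> carrier (mpoly_ring n)" "g \<in> path_ideal n m"
  shows "f * g \<in> path_ideal n m"
proof -
  have "covers_path m k" if k: "k \<in> Poly_Mapping.keys (f * g)" for k
    using keys_mult[of f g] k assms(2) covers_path_add by (force simp: path_ideal_def)
  then show ?thesis using assms by (simp add: path_ideal_def mpoly_carrier_mult)
qed

lemma ideal_path_ideal: "ideal (path_ideal n m) (mpoly_ring n)"
  by (rule mpoly_idealI) (auto simp: path_ideal_add path_ideal_mult, auto simp: path_ideal_def)

lemma path_ideal_single:
  "Poly_Mapping.keys k \<subseteq> {1..n} \<Longrightarrow> covers_path m k \<Longrightarrow> Poly_Mapping.single k c \<in> path_ideal n m"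
  by (simp add: path_ideal_def mpoly_carrier_single)

lemma single_shift:
  assumes "\<And>a. Poly_Mapping.lookup l a \<le> Poly_Mapping.lookup k a"
  shows "Poly_Mapping.single (k :: nat \<Rightarrow>\<^sub>0 nat) c =
    Poly_Mapping.single l 1 * Poly_Mapping.single (k - l) (c :: 'k::field)"
proof -
  have "l + (k - l) = k"
    using assms by (intro poly_mapping_eqI) (simp add: lookup_add lookup_minus)
  then show ?thesis by (simp add: mult_single)
qed

lemma keys_minus_subset: "Poly_Mapping.keys (k - l :: nat \<Rightarrow>\<^sub>0 nat) \<subseteq> Poly_Mapping.keys k"
  by (auto simp: in_keys_iff lookup_minus)

lemma var_carrier: "a \<in> {1..n} \<Longrightarrow> var a \<in> carrier (mpoly_ring n)"
  by (simp add: var_def mpoly_carrier_single)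

lemma var_nonzero: "var a \<noteq> (0 :: 'k::field mpoly)"
  using keys_single[of "Poly_Mapping.single a (1 :: nat)" "1 :: 'k"] unfolding var_def by fastforce

lemma var_mult_key:
  "k \<in> Poly_Mapping.keys (var j * f :: 'k::field mpoly) \<Longrightarrow> Poly_Mapping.lookup k j \<noteq> 0"
  using keys_mult[of "var j" f] by (force simp: var_def lookup_add)

text \<open>Dividing by the variable j > m does not touch the exponents at 1, ..., m, so the
  quotient still satisfies the cover condition.\<close>

lemma path_ideal_var_factor:
  assumes "f \<in> path_ideal n m" "m < j" "\<And>k. k \<in> Poly_Mapping.keys f \<Longrightarrow> Poly_Mapping.lookup k j \<noteq> 0"
  shows "\<exists>g\<in>path_ideal n m. f = var j * (g :: 'k::field mpoly)"
proof -
  let ?e = "Poly_Mapping.single j (1 :: nat)"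
  let ?g = "\<Sum>k\<in>Poly_Mapping.keys f. Poly_Mapping.single (k - ?e) (Poly_Mapping.lookup f k)"
  have "Poly_Mapping.single (k - ?e) (Poly_Mapping.lookup f k) \<in> path_ideal n m"
    if k: "k \<in> Poly_Mapping.keys f" for k
  proof (rule path_ideal_single)
    show "Poly_Mapping.keys (k - ?e) \<subseteq> {1..n}"
      using k assms(1) keys_minus_subset[of k ?e] by (auto simp: path_ideal_def mpoly_ring_carrier)
    have "covers_path m k" using k assms(1) by (simp add: path_ideal_def)
    then show "covers_path m (k - ?e)"
      using assms(2) by (auto simp: covers_path_def lookup_minus lookup_single when_def)
  qed
  then have "?g \<in> path_ideal n m"
    by (intro sum_memI path_ideal_add) (simp_all add: path_ideal_def)
  moreover have "f = var j * ?g"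
  proof -
    have "f = (\<Sum>k\<in>Poly_Mapping.keys f. Poly_Mapping.single k (Poly_Mapping.lookup f k))"
      by (rule poly_mapping_decompose)
    also have "\<dots> = (\<Sum>k\<in>Poly_Mapping.keys f. var j * Poly_Mapping.single (k - ?e) (Poly_Mapping.lookup f k))"
      unfolding var_def using assms(3)
      by (intro sum.cong refl single_shift) (auto simp: lookup_single when_def Suc_le_eq)
    finally show ?thesis by (simp add: sum_distrib_left)
  qed
  ultimately show ?thesis by (intro bexI[of _ ?g])
qed

text \<open>The factor \<open>x\<^sub>m\<^sub>-\<^sub>2\<close>, read as \<open>1\<close> for \<open>m = 2\<close>.\<close>

definition path_factor :: "nat \<Rightarrow> 'k::field mpoly" where
  "path_factor m = (if m = 2 then 1 else var (m - 2))"

definition path_monom :: "nat \<Rightarrow> nat \<Rightarrow>\<^sub>0 nat" where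
  "path_monom m = Poly_Mapping.single m 1 + (if m = 2 then 0 else Poly_Mapping.single (m - 2) 1)"

lemma path_monom: "var m * path_factor m = Poly_Mapping.single (path_monom m) 1"
  by (simp add: var_def path_factor_def path_monom_def mult_single)

lemma lookup_path_monom:
  "m \<ge> 2 \<Longrightarrow> Poly_Mapping.lookup (path_monom m) a = (if a = m \<or> m \<noteq> 2 \<and> a = m - 2 then 1 else 0)"
  by (auto simp: path_monom_def lookup_add lookup_single when_def)

lemma path_factor_carrier: "m \<ge> 2 \<Longrightarrow> m \<le> n \<Longrightarrow> path_factor m \<in> carrier (mpoly_ring n)"
proof (cases "m = 2")
  case False
  assume "m \<ge> 2" "m \<le> n"
  with False have "m - 2 \<in> {1..n}" by auto
  then show ?thesis using False by (simp add: path_factor_def var_carrier)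
qed (simp add: path_factor_def)

text \<open>Checked on exponent vectors: a term divisible by the variable m - 1 belongs to the first
  summand and any other term to the second. As the right-hand side is closed under addition, it
  suffices to place every single term of an element.\<close>

lemma path_ideal_decompose:
  assumes m: "2 \<le> m" "m \<le> n"
  shows "path_ideal n m = {var (m - 1) * a + var m * path_factor m * b | a b.
    a \<in> path_ideal n (m - 2) \<and> b \<in> (path_ideal n (m - 3) :: 'k::field mpoly set)}" (is "_ = ?R")
proof
  show "?R \<subseteq> path_ideal n m"
  proof clarify
    fix a b :: "'k mpoly" assume a: "a \<in> path_ideal n (m - 2)" and b: "b \<in> path_ideal n (m - 3)"
    have "var (m - 1) * a \<in> path_ideal n m"
    proof -
      have "covers_path m k" if k: "k \<in> Poly_Mapping.keys (var (m - 1) * a)" for k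
      proof -
        obtain l where l: "l \<in> Poly_Mapping.keys a" "k = Poly_Mapping.single (m - 1) 1 + l"
          using k keys_mult[of "var (m - 1)" a] by (auto simp: var_def)
        have "covers_path (m - 2) l" using l(1) a by (simp add: path_ideal_def)
        \<comment> \<open>The factor covers the two edges at m - 1; all other edges belong to the
          path on m - 2 vertices.\<close>
        then have "Poly_Mapping.lookup k c \<noteq> 0 \<or> Poly_Mapping.lookup k (Suc c) \<noteq> 0"
          if "1 \<le> c" "c < m" for c
          using that m
          by (cases "c = m - 1 \<or> c = m - 2") (auto simp: l(2) covers_path_def lookup_add lookup_single when_def)
        then show ?thesis by (simp add: covers_path_def)
      qed
      then show ?thesis
        using a m by (auto simp: path_ideal_def intro!: mpoly_carrier_mult var_carrier)
    qed
    moreover have "var m * path_factor m * b \<in> path_ideal n m"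
    proof -
      have "covers_path m k" if k: "k \<in> Poly_Mapping.keys (var m * path_factor m * b)" for k
      proof -
        obtain l where l: "l \<in> Poly_Mapping.keys b" "k = path_monom m + l"
          using k keys_mult[of "Poly_Mapping.single (path_monom m) 1" b] by (auto simp: path_monom)
        have "covers_path (m - 3) l" using l(1) b by (simp add: path_ideal_def)
        \<comment> \<open>The vertices m and m - 2 cover the last three edges, and the earlier ones
          belong to the path on m - 3 vertices. For m = 2 there is a single edge, covered by
          m.\<close>
        then have "Poly_Mapping.lookup k c \<noteq> 0 \<or> Poly_Mapping.lookup k (Suc c) \<noteq> 0"
          if "1 \<le> c" "c < m" for c
          using that m
          by (cases "c = m - 1 \<or> c = m - 2 \<or> c = m - 3")
            (auto simp: l(2) covers_path_def lookup_add lookup_path_monom)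
        then show ?thesis by (simp add: covers_path_def)
      qed
      then show ?thesis
        using b m by (auto simp: path_ideal_def intro!: mpoly_carrier_mult var_carrier path_factor_carrier)
    qed
    ultimately show "var (m - 1) * a + var m * path_factor m * b \<in> path_ideal n m"
      by (rule path_ideal_add)
  qed
  show "path_ideal n m \<subseteq> ?R"
  proof
    fix f :: "'k mpoly" assume f: "f \<in> path_ideal n m"
    have R0: "0 \<in> ?R"
      by (intro CollectI exI[of _ 0]) (auto simp: path_ideal_def)
    have Radd: "g + h \<in> ?R" if g: "g \<in> ?R" and h: "h \<in> ?R" for g h
    proof -
      obtain a b a' b' where "g = var (m - 1) * a + var m * path_factor m * b"
        "h = var (m - 1) * a' + var m * path_factor m * b'"
        and ab: "a \<in> path_ideal n (m - 2)" "a' \<in> path_ideal n (m - 2)"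
        "b \<in> path_ideal n (m - 3)" "b' \<in> path_ideal n (m - 3)" using g h by auto
      then have "g + h = var (m - 1) * (a + a') + var m * path_factor m * (b + b')"
        by (simp add: algebra_simps)
      then show ?thesis
        using ab path_ideal_add by (intro CollectI exI[of _ "a + a'"] exI[of _ "b + b'"]) auto
    qed
    have "Poly_Mapping.single k c \<in> ?R" if k: "k \<in> Poly_Mapping.keys f" for k c
    proof -
      have kn: "Poly_Mapping.keys k \<subseteq> {1..n}" and cov: "covers_path m k"
        using f k by (auto simp: path_ideal_def mpoly_ring_carrier)
      show ?thesis
      proof (cases "Poly_Mapping.lookup k (m - 1) = 0")
        case False
        let ?e = "Poly_Mapping.single (m - 1) (1 :: nat)"
        have "Poly_Mapping.single (k - ?e) c \<in> path_ideal n (m - 2)"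
          using keys_minus_subset[of k ?e] kn cov
          by (intro path_ideal_single) (auto simp: covers_path_def lookup_minus lookup_single when_def)
        moreover have "Poly_Mapping.single k c = var (m - 1) * Poly_Mapping.single (k - ?e) c"
          unfolding var_def using False by (intro single_shift) (auto simp: lookup_single when_def)
        moreover have "0 \<in> path_ideal n (m - 3)" by (simp add: path_ideal_def)
        ultimately show ?thesis
          by (intro CollectI exI[of _ "Poly_Mapping.single (k - ?e) c"] exI[of _ 0]) simp
      next
        case True
        \<comment> \<open>If m - 1 is missing from the cover, the edges on its two sides force m
          and, unless m = 2, also m - 2.\<close>
        have "Poly_Mapping.lookup k (Suc (m - 1)) \<noteq> 0"
          using cov m True unfolding covers_path_def by (metis One_nat_def Suc_1 Suc_le_eq diff_less less_imp_le_nat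
              zero_less_diff zero_less_one le_trans not_less_eq_eq)
        moreover have "m \<noteq> 2 \<Longrightarrow> Poly_Mapping.lookup k (m - 2) \<noteq> 0"
        proof -
          assume "m \<noteq> 2"
          then have "1 \<le> m - 2" "m - 2 < m" "Suc (m - 2) = m - 1" using m by auto
          then show ?thesis using cov True unfolding covers_path_def by metis
        qed
        ultimately have le: "Poly_Mapping.lookup (path_monom m) a \<le> Poly_Mapping.lookup k a" for a
          using m by (auto simp: lookup_path_monom)
        have "Poly_Mapping.single (k - path_monom m) c \<in> path_ideal n (m - 3)"
          using keys_minus_subset[of k "path_monom m"] kn cov m
          by (intro path_ideal_single) (auto simp: covers_path_def lookup_minus lookup_path_monom)
        moreover have "Poly_Mapping.single k c = var m * path_factor m * Poly_Mapping.single (k - path_monom m) c"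
          unfolding path_monom by (rule single_shift[OF le])
        moreover have "0 \<in> path_ideal n (m - 2)" by (simp add: path_ideal_def)
        ultimately show ?thesis
          by (intro CollectI exI[of _ 0] exI[of _ "Poly_Mapping.single (k - path_monom m) c"]) simp
      qed
    qed
    then have "(\<Sum>k\<in>Poly_Mapping.keys f. Poly_Mapping.single k (Poly_Mapping.lookup f k)) \<in> ?R"
      by (intro sum_memI R0 Radd)
    then show "f \<in> ?R" unfolding poly_mapping_decompose[symmetric] .
  qed
qed

text \<open>The variable m - 2 covers the one edge of the path on m - 2 vertices that the path on m
  - 3 vertices lacks. For m = 2 both ideals are the whole ring.\<close>

lemma path_ideal_factor_mult:
  assumes m: "2 \<le> m" "m \<le> n" and b: "b \<in> path_ideal n (m - 3)"
  shows "path_factor m * b \<in> path_ideal n (m - 2)"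
proof (cases "m = 2")
  case False
  have "covers_path (m - 2) k" if k: "k \<in> Poly_Mapping.keys (var (m - 2) * b)" for k
  proof -
    obtain l where l: "l \<in> Poly_Mapping.keys b" "k = Poly_Mapping.single (m - 2) 1 + l"
      using k keys_mult[of "var (m - 2)" b] by (auto simp: var_def)
    have "covers_path (m - 3) l" using l(1) b by (simp add: path_ideal_def)
    then have "Poly_Mapping.lookup k c \<noteq> 0 \<or> Poly_Mapping.lookup k (Suc c) \<noteq> 0"
      if "1 \<le> c" "c < m - 2" for c
      using that m
      by (cases "c = m - 3") (auto simp: l(2) covers_path_def lookup_add lookup_single when_def)
    then show ?thesis by (simp add: covers_path_def)
  qed
  then show ?thesis
    using False b m by (auto simp: path_ideal_def path_factor_def intro!: mpoly_carrier_mult var_carrier)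
qed (use b in \<open>simp add: path_factor_def path_ideal_def covers_path_def\<close>)

text \<open>Every monomial of the product with \<open>b\<close> is divisible by the variable m - 1,
  because the product is a multiple of it. The monomial \<open>path_monom m\<close> does not involve
  m - 1, so each monomial of \<open>b\<close> does, and dividing stays inside the ideal as m - 1 > m
  - 3.\<close>

lemma path_ideal_colon:
  assumes m: "2 \<le> m" and b: "(b :: 'k::field mpoly) \<in> path_ideal n (m - 3)"
    and eq: "var (m - 1) * a + var m * path_factor m * b = 0"
  shows "\<exists>g\<in>path_ideal n (m - 3). b = var (m - 1) * g"
proof (rule path_ideal_var_factor[OF b])
  show "m - 3 < m - 1" using m by simp
  fix k assume "k \<in> Poly_Mapping.keys b"
  then have "Poly_Mapping.lookup (var m * path_factor m * b) (path_monom m + k) \<noteq> 0"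
    unfolding path_monom lookup_single_mult by (simp add: in_keys_iff)
  moreover have "var (m - 1) * (- a) = var m * path_factor m * b"
    using minus_unique[OF eq] by simp
  ultimately have "Poly_Mapping.lookup (path_monom m + k) (m - 1) \<noteq> 0"
    by (intro var_mult_key[where f = "- a"]) (simp add: in_keys_iff)
  then show "Poly_Mapping.lookup k (m - 1) \<noteq> 0"
    using m by (auto simp: lookup_add lookup_path_monom split: if_splits)
qed

section \<open>Identification with the vertex cover ideal\<close>

lemma prod_var:
  "finite W \<Longrightarrow> (\<Prod>a\<in>W. var a) = Poly_Mapping.single (\<Sum>a\<in>W. Poly_Mapping.single a (1 :: nat)) (1 :: 'k::field)"
  by (induction W rule: finite_induct) (simp_all add: var_def mult_single)

lemma lookup_sum_single:
  "finite W \<Longrightarrow> Poly_Mapping.lookup (\<Sum>a\<in>W. Poly_Mapping.single a (1 :: nat)) b = (if b \<in> W then 1 else 0)"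
  by (induction W rule: finite_induct) (auto simp: lookup_add lookup_single when_def)

lemma minimal_vertex_cover_exists:
  assumes "finite W" "vertex_cover n E W"
  shows "\<exists>V\<subseteq>W. minimal_vertex_cover n E V"
  using assms
proof (induction W rule: finite_psubset_induct)
  case (psubset W)
  show ?case
  proof (cases "minimal_vertex_cover n E W")
    case False
    then obtain V where "V \<subset> W" "vertex_cover n E V"
      using psubset.prems by (auto simp: minimal_vertex_cover_def)
    then show ?thesis using psubset.IH by (meson psubset_imp_subset subset_trans)
  qed auto
qed

lemma vertex_cover_path:
  "vertex_cover n (path_edges n) W \<longleftrightarrow> W \<subseteq> {1..n} \<and> (\<forall>a. 1 \<le> a \<and> a < n \<longrightarrow> a \<in> W \<or> Suc a \<in> W)"
proof -
  have "(\<forall>e\<in>path_edges n. W \<inter> e \<noteq> {}) \<longleftrightarrow> (\<forall>a. 1 \<le> a \<and> a + 1 \<le> n \<longrightarrow> W \<inter> {a, a + 1} \<noteq> {})"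
    unfolding path_edges_def by blast
  then show ?thesis by (auto simp: vertex_cover_def Suc_le_eq)
qed

text \<open>The support of an allowed exponent vector is a vertex cover. It contains a minimal one,
  whose squarefree monomial divides the given term; so each term, and then each element, is
  generated by the minimal covers.\<close>

lemma vertex_cover_ideal_path:
  "vertex_cover_ideal n (path_edges n) = (path_ideal n n :: 'k::field mpoly set)"
proof
  interpret R: cring "mpoly_ring n :: 'k mpoly ring" by (rule cring_mpoly_ring)
  let ?G = "{\<Prod>a\<in>W. var a | W. minimal_vertex_cover n (path_edges n) W} :: 'k mpoly set"
  have G: "?G \<subseteq> path_ideal n n"
  proof clarify
    fix W assume "minimal_vertex_cover n (path_edges n) W"
    then have W: "W \<subseteq> {1..n}" "\<And>a. 1 \<le> a \<Longrightarrow> a < n \<Longrightarrow> a \<in> W \<or> Suc a \<in> W"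
      by (auto simp: minimal_vertex_cover_def vertex_cover_path)
    then have fin: "finite W" using finite_subset by blast
    show "(\<Prod>a\<in>W. var a) \<in> path_ideal n n"
      unfolding prod_var[OF fin] using W
      by (intro path_ideal_single) (auto simp: covers_path_def in_keys_iff lookup_sum_single[OF fin]
          simp del: One_nat_def split: if_splits)
  qed
  then show "vertex_cover_ideal n (path_edges n) \<subseteq> (path_ideal n n :: 'k mpoly set)"
    unfolding vertex_cover_ideal_def by (rule R.genideal_minimal[OF ideal_path_ideal])
  have GC: "?G \<subseteq> carrier (mpoly_ring n)" using G by (auto simp: path_ideal_def)
  define I where "I = (vertex_cover_ideal n (path_edges n) :: 'k mpoly set)"
  have I: "ideal I (mpoly_ring n)" and GI: "?G \<subseteq> I"
    unfolding I_def vertex_cover_ideal_def by (rule R.genideal_ideal[OF GC], rule R.genideal_self[OF GC])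
  show "(path_ideal n n :: 'k mpoly set) \<subseteq> vertex_cover_ideal n (path_edges n)"
    unfolding I_def[symmetric]
  proof
    fix f :: "'k mpoly" assume f: "f \<in> path_ideal n n"
    have "Poly_Mapping.single k c \<in> I" if k: "k \<in> Poly_Mapping.keys f" for k c
    proof -
      have kn: "Poly_Mapping.keys k \<subseteq> {1..n}" and cov: "covers_path n k"
        using f k by (auto simp: path_ideal_def mpoly_ring_carrier)
      then have "vertex_cover n (path_edges n) (Poly_Mapping.keys k)"
        by (auto simp: vertex_cover_path covers_path_def in_keys_iff)
      then obtain W where W: "W \<subseteq> Poly_Mapping.keys k" "minimal_vertex_cover n (path_edges n) W"
        using minimal_vertex_cover_exists[OF finite_keys] by blast
      have fin: "finite W" by (rule finite_subset[OF W(1) finite_keys])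
      let ?w = "\<Sum>a\<in>W. Poly_Mapping.single a (1 :: nat)"
      have "Poly_Mapping.single k c = (\<Prod>a\<in>W. var a) * Poly_Mapping.single (k - ?w) c"
        unfolding prod_var[OF fin] using W(1)
        by (intro single_shift) (auto simp: lookup_sum_single[OF fin] in_keys_iff Suc_le_eq
            simp del: One_nat_def)
      moreover have "(\<Prod>a\<in>W. var a) \<in> I" using GI W(2) by blast
      moreover have "Poly_Mapping.single (k - ?w) c \<in> carrier (mpoly_ring n)"
        using keys_minus_subset[of k ?w] kn by (intro mpoly_carrier_single) blast
      ultimately show ?thesis using ideal.I_r_closed[OF I] by simp
    qed
    then have "(\<Sum>k\<in>Poly_Mapping.keys f. Poly_Mapping.single k (Poly_Mapping.lookup f k)) \<in> I"
      using additive_subgroup.a_closed[OF ideal.axioms(1)[OF I]]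
        additive_subgroup.zero_closed[OF ideal.axioms(1)[OF I]]
      by (intro sum_memI) simp_all
    then show "f \<in> I" unfolding poly_mapping_decompose[symmetric] .
  qed
qed

section \<open>The recursion for the Betti numbers and its extremal values\<close>

lemma path_ideal_trivial: "m \<le> 1 \<Longrightarrow> path_ideal n m = carrier (mpoly_ring n)"
  by (auto simp: path_ideal_def covers_path_def)

text \<open>Base case of the recursion: the ring resolves itself by one generator of degree 0, and
  every differential starts at the zero module.\<close>

lemma minimal_resolution_carrier:
  "minimal_resolution n (carrier (mpoly_ring n) :: 'k::field mpoly set)
     (\<lambda>p. if p = 0 then 1 else 0) (\<lambda>_ _. 0) (\<lambda>_ _ _. 0) (\<lambda>v. v 0)"
proof -
  have "(\<lambda>v. v 0) ` carrier (free_mod n (Suc 0)) = (carrier (mpoly_ring n) :: 'k mpoly set)"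
  proof (intro equalityI subsetI)
    fix f :: "'k mpoly" assume "f \<in> carrier (mpoly_ring n)"
    then have "(\<lambda>t. if t = 0 then f else 0) \<in> carrier (free_mod n (Suc 0))"
      by (simp add: free_module_carrier)
    then show "f \<in> (\<lambda>v. v 0) ` carrier (free_mod n (Suc 0))" by (rule rev_image_eqI) simp
  qed (auto simp: free_mod_entry)
  moreover have "carrier (free_mod n 0) = {\<lambda>_. 0 :: 'k mpoly}"
    by (auto simp: free_module_carrier)
  moreover have "{v \<in> carrier (free_mod n (Suc 0)). v 0 = (0 :: 'k mpoly)} = {\<lambda>_. 0}"
    by (auto simp: free_module_carrier fun_eq_iff) (metis Suc_leI gr0I)
  moreover have "(\<lambda>v. v 0) \<in> module_hom (mpoly_ring n) (free_mod n (Suc 0))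
      (ideal_module (mpoly_ring n) (carrier (mpoly_ring n) :: 'k mpoly set))"
    by (auto simp: module_hom_def free_mod_entry)
  moreover have "(\<lambda>_ _. 0) \<in> module_hom (mpoly_ring n) (free_mod n r)
      (free_mod n r' :: ('k mpoly, nat \<Rightarrow> 'k mpoly) module)" for r r'
    by (simp add: module_hom_def)
  ultimately have "resolution (mpoly_ring n) (ideal_module (mpoly_ring n) (carrier (mpoly_ring n) :: 'k mpoly set))
      (\<lambda>p. free_mod n (if p = 0 then 1 else 0)) (\<lambda>_ _ _. 0) (\<lambda>v. v 0)"
    by (simp add: resolution_def free_mod_module a_kernel_def')
  then show ?thesis
    by (simp add: minimal_resolution_def graded_free_resolution_def const_vec_def unit_vector_def)
qed

text \<open>The conditional on m = 2 is the drop in the degree of \<open>path_factor m\<close>,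
  which is 0 there and 1 otherwise. Degrees are integers so that the shifts can leave the range of
  nonzero values freely.\<close>

fun path_betti :: "nat \<Rightarrow> nat \<Rightarrow> int \<Rightarrow> nat" where
  "path_betti m p q = (if m < 2 then (if p = 0 \<and> q = 0 then 1 else 0) else
     path_betti (m - 2) p (q - 1) + path_betti (m - 3) p (q - 1 - (if m = 2 then 0 else 1)) +
     (case p of 0 \<Rightarrow> 0 | Suc p' \<Rightarrow> path_betti (m - 3) p' (q - 2 - (if m = 2 then 0 else 1))))"

declare path_betti.simps [simp del]

text \<open>Induction on m with the ring fixed. Carrying the generator counts in the statement lets
  the cone formula turn directly into the recursion of \<open>path_betti\<close>.\<close>

lemma path_resolution:
  assumes "m \<le> n"
  shows "\<exists>r dg \<delta> \<epsilon>. minimal_resolution n (path_ideal n m :: 'k::field mpoly set) r dg \<delta> \<epsilon> \<and>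
    (\<forall>p q. card {s. s < r p \<and> dg p s = q} = path_betti m p q)"
  using assms
proof (induction m rule: less_induct)
  case (less m)
  show ?case
  proof (cases "m < 2")
    case True
    then have triv: "path_ideal n m = (carrier (mpoly_ring n) :: 'k mpoly set)"
      by (simp add: path_ideal_trivial)
    have card: "card {s :: nat. s < (if p = 0 then 1 else 0) \<and> (0 :: int) = q} = path_betti m p q" for p q
      using True by (auto simp: path_betti.simps[of m])
    show ?thesis
      unfolding triv
      by (rule exI[of _ "\<lambda>p. if p = 0 then 1 else 0"], rule exI[of _ "\<lambda>_ _. 0"],
          rule exI[of _ "\<lambda>_ _ _. 0"], rule exI[of _ "\<lambda>v. v 0"])
        (intro conjI allI minimal_resolution_carrier card)
  next
    case False
    then have m: "2 \<le> m" by simp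
    have "\<exists>r dg \<delta> \<epsilon>. minimal_resolution n (path_ideal n (m - 2) :: 'k mpoly set) r dg \<delta> \<epsilon> \<and>
      (\<forall>p q. card {s. s < r p \<and> dg p s = q} = path_betti (m - 2) p q)"
      by (rule less.IH) (use less.prems m in simp_all)
    then obtain rF dF \<delta>F \<epsilon>F where F: "minimal_resolution n (path_ideal n (m - 2) :: 'k mpoly set) rF dF \<delta>F \<epsilon>F"
      "\<And>p q. card {s. s < rF p \<and> dF p s = q} = path_betti (m - 2) p q" by metis
    have "\<exists>r dg \<delta> \<epsilon>. minimal_resolution n (path_ideal n (m - 3) :: 'k mpoly set) r dg \<delta> \<epsilon> \<and>
      (\<forall>p q. card {s. s < r p \<and> dg p s = q} = path_betti (m - 3) p q)"
      by (rule less.IH) (use less.prems m in simp_all)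
    then obtain rG dG \<delta>G \<epsilon>G where G: "minimal_resolution n (path_ideal n (m - 3) :: 'k mpoly set) rG dG \<delta>G \<epsilon>G"
      "\<And>p q. card {s. s < rG p \<and> dG p s = q} = path_betti (m - 3) p q" by metis
    let ?e = "if m = 2 then 0 else 1 :: int"
    have "\<exists>r dg \<delta> \<epsilon>. minimal_resolution n (path_ideal n m :: 'k mpoly set) r dg \<delta> \<epsilon> \<and>
      (\<forall>p q. card {s. s < r p \<and> dg p s = q} = card {s. s < rF p \<and> dF p s = q - 1} +
        card {s. s < rG p \<and> dG p s = q - 1 - ?e} +
        (case p of 0 \<Rightarrow> 0 | Suc p' \<Rightarrow> card {s. s < rG p' \<and> dG p' s = q - 2 - ?e}))"
    proof (rule minimal_resolution_cone[OF ideal_path_ideal ideal_path_ideal ideal_path_ideal F(1) G(1)])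
      show "var (m - 1) \<in> carrier (mpoly_ring n)" "var m \<in> carrier (mpoly_ring n)"
        using m less.prems by (auto intro!: var_carrier)
      show "path_factor m \<in> carrier (mpoly_ring n)" using m less.prems by (rule path_factor_carrier)
      show "homogeneous ?e (path_factor m)" by (simp add: path_factor_def)
      show "path_factor m * b \<in> path_ideal n (m - 2)" if "b \<in> path_ideal n (m - 3)" for b
        using m less.prems that by (rule path_ideal_factor_mult)
      show "\<exists>g\<in>path_ideal n (m - 3). b = var (m - 1) * g"
        if "b \<in> path_ideal n (m - 3)" "var (m - 1) * a + var m * path_factor m * b = 0" for a b
        using m that by (rule path_ideal_colon)
      show "path_ideal n m = {var (m - 1) * a + var m * path_factor m * b | a b.
          a \<in> path_ideal n (m - 2) \<and> b \<in> path_ideal n (m - 3)}"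
        using m less.prems by (rule path_ideal_decompose)
    qed (simp_all add: var_nonzero)
    then show ?thesis unfolding F(2) G(2) path_betti.simps[of m] using m by (simp cong: nat.case_cong)
  qed
qed

text \<open>Each summand of the recursion respects both bounds. Going from m - 3 to m raises (m + 1)
  div 3 by 1 and 2 m div 3 by 2, matching the largest growth of p and of q - p; from m - 2 to m, p
  stays and q - p grows by 1. The case m = 2 has shift 0 and is checked separately.\<close>

lemma path_betti_bounds:
  "path_betti m p q \<noteq> 0 \<Longrightarrow> p \<le> (m + 1) div 3 \<and> 0 \<le> q - int p \<and> q - int p \<le> int (2 * m div 3)"
proof (induction m p q rule: path_betti.induct)
  case (1 m p q)
  show ?case
  proof (cases "m < 2")
    case True
    then show ?thesis using "1.prems" by (simp add: path_betti.simps[of m] split: if_splits)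
  next
    case False
    let ?e = "if m = 2 then 0 else 1 :: int"
    consider "path_betti (m - 2) p (q - 1) \<noteq> 0" | "path_betti (m - 3) p (q - 1 - ?e) \<noteq> 0"
      | p' where "p = Suc p'" "path_betti (m - 3) p' (q - 2 - ?e) \<noteq> 0"
      using "1.prems" False by (cases p) (auto simp: path_betti.simps[of m] split: if_splits)
    then show ?thesis
    proof cases
      case 1
      then show ?thesis using "1.IH"(1)[OF False] False by linarith
    next
      case 2
      then show ?thesis using "1.IH"(2)[OF False] False by (cases "m = 2") (simp_all, linarith+)
    next
      case 3
      then show ?thesis using "1.IH"(3)[OF False 3(1)] False by (cases "m = 2") (simp_all, linarith+)
    qed
  qed
qed

lemma path_betti_eq_0: "(m + 1) div 3 < p \<Longrightarrow> path_betti m p q = 0"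
  using path_betti_bounds[of m p q] by linarith

text \<open>The index m + 3 is never 2, so the exceptional shift disappears.\<close>

lemma path_betti_step:
  "path_betti (m + 3) (Suc p) q = path_betti (m + 1) (Suc p) (q - 1) + path_betti m (Suc p) (q - 2) + path_betti m p (q - 3)"
  by (subst path_betti.simps) simp

text \<open>At the top homological degree the first two summands exceed the bound on p for their
  shorter paths, and only the third survives.\<close>

lemma path_betti_top_0: "path_betti (3 * k) k (3 * int k) = 1"
proof (induction k)
  case 0
  show ?case by (simp add: path_betti.simps)
next
  case (Suc k)
  then show ?case
    using path_betti_step[of "3 * k" k "3 * int (Suc k)"] by (simp add: path_betti_eq_0 add.commute)
qed

lemma path_betti_top_2: "path_betti (3 * k + 2) (Suc k) (3 * int k + 2) = 1"
proof (induction k)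
  case 0
  \<comment> \<open>For two vertices the ideal is generated by two variables, and this counts their
    single Koszul relation of degree 2.\<close>
  have "path_betti 2 (Suc 0) 2 = 1" by (simp add: path_betti.simps[of 2] path_betti.simps[of 0])
  then show ?case by (simp add: eval_nat_numeral)
next
  case (Suc k)
  have "3 * Suc k + 2 = 3 * k + 2 + 3" by simp
  then show ?case
    using Suc path_betti_step[of "3 * k + 2" "Suc k" "3 * int (Suc k) + 2"]
    by (simp add: path_betti_eq_0 add.commute)
qed

text \<open>Here two summands survive: the third gives k + 1 by induction, and the first gives the
  value 1 of the path on 3k + 2 vertices, which has the same top homological degree as the new
  path.\<close>

lemma path_betti_top_1: "path_betti (3 * k + 1) k (3 * int k) = k + 1"
proof (induction k)
  case 0
  show ?case by (simp add: path_betti.simps)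
next
  case (Suc k)
  have "3 * Suc k + 1 = 3 * k + 1 + 3" by simp
  then show ?case
    using Suc path_betti_top_2[of k] path_betti_step[of "3 * k + 1" k "3 * int (Suc k)"]
    by (simp add: path_betti_eq_0 add.commute)
qed

section \<open>The invariants of the vertex cover ideal\<close>

text \<open>\<open>d\<close> and \<open>j\<close> are the upper bounds from
  \<open>path_betti_bounds\<close>. One nonzero Betti number at the corner (d, d + j) shows that
  both are attained.\<close>

lemma path_invariants:
  assumes d: "d = (n + 1) div 3" and j: "j = int (2 * n div 3)"
    and top: "path_betti n d (int d + j) \<noteq> 0" and J: "J = vertex_cover_ideal n (path_edges n)"
  shows "proj_dim (mpoly_ring n) (ideal_module (mpoly_ring n) (J :: 'k::field mpoly set)) = enat d \<and>
    regularity n J = j \<and> graded_betti n J d (int d + j) = path_betti n d (int d + j)"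
proof -
  have J': "J = path_ideal n n" using J by (simp add: vertex_cover_ideal_path)
  have I: "ideal J (mpoly_ring n)" unfolding J' by (rule ideal_path_ideal)
  obtain r dg \<delta> \<epsilon> where F: "minimal_resolution n J r dg \<delta> \<epsilon>"
    and card: "\<And>p q. card {s. s < r p \<and> dg p s = q} = path_betti n p q"
    using path_resolution[of n n, where 'k = 'k] J' by auto
  have betti: "graded_betti n J p q = path_betti n p q" for p q
    using graded_betti_minimal[OF I F] card by simp
  have "r d > 0"
  proof (rule ccontr)
    assume "\<not> r d > 0"
    then show False using card[of d "int d + j"] top by simp
  qed
  \<comment> \<open>A basis element in homological degree p > d would be counted in its own internal
    degree and give a nonzero value beyond the bound.\<close>
  moreover have "r p = 0" if "p > d" for p
  proof (rule ccontr)
    assume "r p \<noteq> 0"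
    then have "card {s. s < r p \<and> dg p s = dg p 0} \<noteq> 0" by auto
    then show False using path_betti_eq_0[of n p] that by (simp add: card d)
  qed
  ultimately have "proj_dim (mpoly_ring n) (ideal_module (mpoly_ring n) J) = enat d"
    by (rule proj_dim_minimal[OF I F])
  moreover have "regularity n J = j"
    unfolding regularity_def betti
  proof (rule Max_eqI)
    let ?A = "{q - int p |p q. path_betti n p q \<noteq> 0}"
    \<comment> \<open>\<open>Max\<close> needs a finite set; the lower bound 0 on q - p is what
      provides it.\<close>
    have "?A \<subseteq> {0..j}" using path_betti_bounds[of n] by (auto simp: j)
    then show "finite ?A" by (rule finite_subset) simp
    show "y \<le> j" if "y \<in> ?A" for y using that path_betti_bounds[of n] by (auto simp: j)
    show "j \<in> ?A" using top by (intro CollectI exI[of _ d] exI[of _ "int d + j"]) simp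
  qed
  ultimately show ?thesis by (simp add: betti)
qed

theorem theorem3p7:
  fixes n k :: nat and J :: "('k::field) mpoly set"
  assumes "n \<ge> 2" and "k \<ge> 1"
    and J: "J = vertex_cover_ideal n (path_edges n)"
  shows "(n = 3 * k \<longrightarrow>
           proj_dim (mpoly_ring n) (ideal_module (mpoly_ring n) J) = enat k \<and>
           regularity n J = 2 * int k \<and>
           graded_betti n J k (int k + 2 * int k) = 1) \<and>
         (n = 3 * k - 1 \<longrightarrow>
           proj_dim (mpoly_ring n) (ideal_module (mpoly_ring n) J) = enat k \<and>
           regularity n J = 2 * int k - 1 \<and>
           graded_betti n J k (int k + (2 * int k - 1)) = 1) \<and>
         (n = 3 * k + 1 \<longrightarrow>
           proj_dim (mpoly_ring n) (ideal_module (mpoly_ring n) J) = enat k \<and>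
           regularity n J = 2 * int k \<and>
           graded_betti n J k (int k + 2 * int k) = k + 1)"
proof (intro conjI[of "_ \<longrightarrow> _"] impI)
  assume n: "n = 3 * k"
  have "path_betti n k (int k + 2 * int k) = 1" using path_betti_top_0[of k] by (simp add: n)
  note b = this
  have d: "k = (n + 1) div 3" and j: "2 * int k = int (2 * n div 3)" using n by auto
  have "path_betti n k (int k + 2 * int k) \<noteq> 0" unfolding b by simp
  from path_invariants[OF d j this J]
  show "proj_dim (mpoly_ring n) (ideal_module (mpoly_ring n) J) = enat k \<and>
    regularity n J = 2 * int k \<and> graded_betti n J k (int k + 2 * int k) = 1" unfolding b .
next
  assume n: "n = 3 * k - 1"
  \<comment> \<open>Writing n as 3l + 2 removes the truncated subtraction in 3k - 1 and matches the
    indexing of \<open>path_betti_top_2\<close>.\<close>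
  obtain l where l: "k = Suc l" using assms(2) by (cases k) auto
  have n': "n = 3 * l + 2" using n l by simp
  have "int k + (2 * int k - 1) = 3 * int l + 2" using l by simp
  then have "path_betti n k (int k + (2 * int k - 1)) = 1"
    using path_betti_top_2[of l] unfolding n' l by (simp only:)
  note b = this
  have d: "k = (n + 1) div 3" and j: "2 * int k - 1 = int (2 * n div 3)" using n' l by auto
  have "path_betti n k (int k + (2 * int k - 1)) \<noteq> 0" unfolding b by simp
  from path_invariants[OF d j this J]
  show "proj_dim (mpoly_ring n) (ideal_module (mpoly_ring n) J) = enat k \<and>
    regularity n J = 2 * int k - 1 \<and> graded_betti n J k (int k + (2 * int k - 1)) = 1" unfolding b .
next
  assume n: "n = 3 * k + 1"
  have "path_betti n k (int k + 2 * int k) = k + 1" using path_betti_top_1[of k] by (simp add: n)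
  note b = this
  have d: "k = (n + 1) div 3" and j: "2 * int k = int (2 * n div 3)" using n by auto
  have "path_betti n k (int k + 2 * int k) \<noteq> 0" unfolding b by simp
  from path_invariants[OF d j this J]
  show "proj_dim (mpoly_ring n) (ideal_module (mpoly_ring n) J) = enat k \<and>
    regularity n J = 2 * int k \<and> graded_betti n J k (int k + 2 * int k) = k + 1" unfolding b .
qed

end
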